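(* Let $G$ be a group. Suppose that, for every free power $P$ of $G$, every unimodular equation over $P$ is magnusian. Then every unimodular generalized equation over $G$ (with any variable group $T$) is solvable over $G$.
   Context: A free power of $G$ is a free product of isomorphic copies of $G$. (Ordinary) equations. An equation over a group $P$ with variable $t$ is a formal expression $w(t)\equiv g_1t^{\epsilon_1}\cdots g_nt^{\epsilon_n}=1$ with $g_i\in P$, $\epsilon_i\in\mathbb Z$; its left-hand side is regarded as an element of $P*\langle t\rangle_\infty$, where $\langle t\rangle_\infty$ is the infinite cyclic group generated by $t$. It is unimodular if $\sum\epsilon_i=\pm1$. It is solvable over $P$ if there are a group $\widetilde P$ containing $P$ as a subgroup and an element $\widetilde t\in\widetilde P$ (a solution) with $w(\widetilde t)=1$ in $\widetilde P$. The equation $w(t)=1$ over $P$ is called magnusian if it is solvable over $P$ and, for every free factor $H$ of $P$ (i.e. $P=H*K$ for some subgroup $K$) such that $w$ is not conjugate in $P*\langle t\rangle_\infty$ to an element of $H*\langle t\rangle_\infty$, there is a group containing $P$ as a subgroup and containing a solution $\widetilde t$ of the equation that is transcendental over $H$, i.e. such that $\langle H,\widetilde t\rangle=H*\langle\widetilde t\rangle_\infty$ (the subgroup generated by $H$ and $\widetilde t$ is the free product of $H$ and the infinite cyclic group generated by $\widetilde t$). Generalized equations. A generalized equation over $G$ with variable group $T$ is a formal expression $g_1t_1g_2t_2\cdots g_nt_n=1$ with $g_i\in G$, $t_i\in T$. It is solvable over $G$ if there exist a group $\widetilde G$ containing $G$ as a subgroup and a homomorphism $T\to\widetilde G$, $t\mapsto\widetilde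 t$, such that $g_1\widetilde t_1\cdots g_n\widetilde t_n=1$ in $\widetilde G$. It is called unimodular if, with $\prod t_i=t_1t_2\cdots t_n$: (1) $\prod t_i$ has infinite order in $T$; (2) $\langle\prod t_i\rangle$ is normal in $T$; (3) $T/\langle\prod t_i\rangle$ has the strong unique product property. A group $Q$ has the strong unique product property if for any two finite nonempty subsets $X,Y\subseteq Q$ with $|Y|\ge 2$, the product set $XY$ contains at least two uniquely decomposable elements $x_1y_1$ and $x_2y_2$ with $x_1,x_2\in X$, $y_1,y_2\in Y$ and $y_1\ne y_2$. Here an element of $XY$ is uniquely decomposable if it has exactly one expression as $xy$ with $x\in X$, $y\in Y$. *)

theory Defs
  imports "HOL-Algebra.Multiplicative_Group" "HOL-Algebra.Elementary_Groups"
    "HOL-Algebra.Weak_Morphisms"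
begin

section \<open>Free products\<close>

text \<open>The free product of a family of groups in normal form: an element is a word of syllables
  \<open>(i, x)\<close> with \<open>x\<close> a nontrivial element of the \<open>i\<close>-th group and with different indices at
  adjacent places; words are multiplied by concatenation followed by reduction.\<close>

definition reduced_words :: "'i set \<Rightarrow> ('i \<Rightarrow> ('a, 'm) monoid_scheme) \<Rightarrow> ('i \<times> 'a) list set" where
  "reduced_words I G =
     {w. (\<forall>(i, x) \<in> set w. i \<in> I \<and> x \<in> carrier (G i) \<and> x \<noteq> \<one>\<^bsub>G i\<^esub>) \<and> distinct_adj (map fst w)}"

fun syllable_mult ::
    "('i \<Rightarrow> ('a, 'm) monoid_scheme) \<Rightarrow> 'i \<times> 'a \<Rightarrow> ('i \<times> 'a) list \<Rightarrow> ('i \<times> 'a) list" where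
  "syllable_mult G (i, x) [] = (if x = \<one>\<^bsub>G i\<^esub> then [] else [(i, x)])"
| "syllable_mult G (i, x) ((j, y) # w) =
     (if x = \<one>\<^bsub>G i\<^esub> then (j, y) # w
      else if i = j then (if x \<otimes>\<^bsub>G i\<^esub> y = \<one>\<^bsub>G i\<^esub> then w else (i, x \<otimes>\<^bsub>G i\<^esub> y) # w)
      else (i, x) # (j, y) # w)"

definition free_product :: "'i set \<Rightarrow> ('i \<Rightarrow> ('a, 'm) monoid_scheme) \<Rightarrow> ('i \<times> 'a) list monoid" where
  "free_product I G =
     \<lparr>carrier = reduced_words I G, monoid.mult = (\<lambda>u v. foldr (syllable_mult G) u v), one = []\<rparr>"

definition free_product_incl :: "('i \<Rightarrow> ('a, 'm) monoid_scheme) \<Rightarrow> 'i \<Rightarrow> 'a \<Rightarrow> ('i \<times> 'a) list" where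
  "free_product_incl G i x = (if x = \<one>\<^bsub>G i\<^esub> then [] else [(i, x)])"

text \<open>Index sets of free powers range over the subsets of one fixed type \<open>'i\<close>. Quantifying over all
  \<open>I :: 'i set\<close> loses no generality for the property that every unimodular equation over every free
  power of \<open>G\<close> is magnusian, provided \<open>'i\<close> is infinite and at least as large as \<open>G\<close>. Indeed, let \<open>w\<close>
  be an equation over a free power \<open>P = H * K\<close> with an arbitrary index set. Then the coefficients of
  \<open>w\<close> lie in a subpower \<open>P'\<close> with at most \<open>max |G| \<aleph>\<^sub>0\<close> factors such that \<open>P' = H' * K'\<close>, where
  \<open>H' = H \<inter> P'\<close> and \<open>K' = K \<inter> P'\<close>. By the Kurosh theorem \<open>H = H' * L\<close> and \<open>K = K' * M\<close>, so
  \<open>P = P' * L * M\<close>, and if an overgroup \<open>Q\<close> of \<open>P'\<close> contains a solution transcendental over \<open>H'\<close>, then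
  this solution in the overgroup \<open>Q * L * M\<close> of \<open>P\<close> is transcendental over \<open>H = H' * L\<close>.\<close>

definition free_power :: "'i set \<Rightarrow> ('a, 'm) monoid_scheme \<Rightarrow> ('i \<times> 'a) list monoid" where
  "free_power I G = free_product I (\<lambda>_. G)"

lemma syllable_mult_closed:
  assumes "group (G i)" "i \<in> I" "x \<in> carrier (G i)" "w \<in> reduced_words I G"
  shows "syllable_mult G (i, x) w \<in> reduced_words I G"
proof -
  interpret group "G i" by fact
  show ?thesis
    using assms
    by (cases "(G, (i, x), w)" rule: syllable_mult.cases)
       (auto simp: reduced_words_def distinct_adj_Cons hd_map)
qed

lemma syllable_mult_one: "syllable_mult G (i, \<one>\<^bsub>G i\<^esub>) w = w"
  by (cases "(G, (i, \<one>\<^bsub>G i\<^esub>), w)" rule: syllable_mult.cases) auto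

lemma syllable_mult_mult:
  assumes "group (G i)" "x \<in> carrier (G i)" "y \<in> carrier (G i)" "w \<in> reduced_words I G"
  shows "syllable_mult G (i, x) (syllable_mult G (i, y) w) = syllable_mult G (i, x \<otimes>\<^bsub>G i\<^esub> y) w"
proof -
  interpret group "G i" by fact
  show ?thesis
  proof (cases w)
    case Nil
    then show ?thesis using assms(2,3) by auto
  next
    case (Cons s v)
    obtain j z where s: "s = (j, z)" by (cases s)
    show ?thesis
    proof (cases "i = j")
      case False
      then show ?thesis using Cons s assms(2,3) by auto
    next
      case True
      have z: "z \<in> carrier (G i)" "z \<noteq> \<one>\<^bsub>G i\<^esub>" and v: "v = [] \<or> fst (hd v) \<noteq> i"
        using assms(4) Cons s True by (auto simp: reduced_words_def distinct_adj_Cons hd_map)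
      have hv: "syllable_mult G (i, a) v = (if a = \<one>\<^bsub>G i\<^esub> then v else (i, a) # v)" for a
        using v by (cases v) auto
      have prod: "syllable_mult G (i, a) ((i, b) # v) = syllable_mult G (i, a \<otimes>\<^bsub>G i\<^esub> b) v"
        if "a \<in> carrier (G i)" "b \<in> carrier (G i)" "b \<noteq> \<one>\<^bsub>G i\<^esub>" for a b
        using that by (auto simp: hv)
      have "syllable_mult G (i, x) (syllable_mult G (i, a) v) = syllable_mult G (i, x \<otimes>\<^bsub>G i\<^esub> a) v"
        if "a \<in> carrier (G i)" for a
        using that assms(2) prod[of x a] by (cases "a = \<one>\<^bsub>G i\<^esub>") (auto simp: hv)
      moreover have "w = (i, z) # v" using Cons s True by simp
      ultimately show ?thesis
        using prod z assms(2,3) by (simp del: syllable_mult.simps add: m_assoc)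
    qed
  qed
qed

lemma group_free_product:
  assumes grp: "\<And>i. i \<in> I \<Longrightarrow> group (G i)"
  shows "group (free_product I G)"
proof -
  let ?R = "reduced_words I G"
  let ?m = "\<lambda>u v. foldr (syllable_mult G) u v"
  have syl: "i \<in> I \<and> x \<in> carrier (G i) \<and> w \<in> ?R" if "(i, x) # w \<in> ?R" for i x w
    using that by (auto simp: reduced_words_def distinct_adj_Cons)
  have closed_gen: "?m u v \<in> ?R"
    if "\<forall>(i, x) \<in> set u. i \<in> I \<and> x \<in> carrier (G i)" "v \<in> ?R" for u v
    using that grp by (induction u) (auto intro: syllable_mult_closed)
  have closed: "?m u v \<in> ?R" if "u \<in> ?R" "v \<in> ?R" for u v
    using that by (intro closed_gen) (auto simp: reduced_words_def)
  have step: "?m (syllable_mult G (i, x) v) w = syllable_mult G (i, x) (?m v w)"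
    if "i \<in> I" "x \<in> carrier (G i)" "v \<in> ?R" "w \<in> ?R" for i x v w
  proof -
    interpret group "G i" using grp that by blast
    show ?thesis
    proof (cases v)
      case Nil
      then show ?thesis by (simp add: syllable_mult_one)
    next
      case (Cons s v')
      obtain j y where s: "s = (j, y)" by (cases s)
      have "j \<in> I" "y \<in> carrier (G j)" "v' \<in> ?R"
        using syl that(3) Cons s by auto
      then show ?thesis
        using Cons s that syllable_mult_mult[of G i x y "?m v' w" I] closed[of v' w]
        by (auto simp: syllable_mult_one is_group)
    qed
  qed
  have assoc: "?m (?m u v) w = ?m u (?m v w)" if "u \<in> ?R" "v \<in> ?R" "w \<in> ?R" for u v w
    using that(1)
  proof (induction u)
    case (Cons s u)
    obtain i x where s: "s = (i, x)" by (cases s)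
    then have "i \<in> I" "x \<in> carrier (G i)" "u \<in> ?R" using syl Cons.prems by auto
    then show ?case using s Cons.IH step closed that by simp
  qed simp
  define winv where "winv = (\<lambda>u. rev (map (\<lambda>(i, x). (i, inv\<^bsub>G i\<^esub> x)) u))"
  have winv_in: "winv u \<in> ?R" if "u \<in> ?R" for u
  proof -
    have "map fst (winv u) = rev (map fst u)"
      by (auto simp: winv_def rev_map case_prod_beta)
    moreover have "inv\<^bsub>G i\<^esub> x \<in> carrier (G i) \<and> inv\<^bsub>G i\<^esub> x \<noteq> \<one>\<^bsub>G i\<^esub>"
      if "i \<in> I" "x \<in> carrier (G i)" "x \<noteq> \<one>\<^bsub>G i\<^esub>" for i x
    proof -
      interpret group "G i" using grp that by blast
      show ?thesis using that by (simp add: inv_eq_1_iff)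
    qed
    ultimately show ?thesis
      using that by (auto simp: reduced_words_def winv_def)
  qed
  have left_inv: "?m (winv u) u = []" if "u \<in> ?R" for u
    using that
  proof (induction u)
    case (Cons s u)
    obtain i x where s: "s = (i, x)" by (cases s)
    then have u: "i \<in> I" "x \<in> carrier (G i)" "u \<in> ?R" "x \<noteq> \<one>\<^bsub>G i\<^esub>"
      using syl Cons.prems by (auto simp: reduced_words_def)
    interpret group "G i" using grp u by blast
    have "syllable_mult G (i, inv\<^bsub>G i\<^esub> x) ((i, x) # u) = u"
      using u by (simp add: inv_eq_1_iff)
    then show ?case using s Cons.IH u by (simp add: winv_def)
  qed (simp add: winv_def)
  have one_in: "[] \<in> ?R" by (simp add: reduced_words_def)
  show ?thesis
  proof (rule groupI)
    show "\<exists>y \<in> carrier (free_product I G). y \<otimes>\<^bsub>free_product I G\<^esub> x = \<one>\<^bsub>free_product I G\<^esub>"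
      if "x \<in> carrier (free_product I G)" for x
      using that left_inv winv_in by (auto simp: free_product_def)
  qed (auto simp: free_product_def closed assoc one_in)
qed

text \<open>\<open>Q\<close> is the free product of its subgroups \<open>A i\<close>, \<open>i \<in> I\<close>: the canonical map from their
  (external) free product to \<open>Q\<close>, which multiplies out the syllables, is an isomorphism.\<close>

definition is_free_product_of ::
    "('q, 'm) monoid_scheme \<Rightarrow> 'i set \<Rightarrow> ('i \<Rightarrow> 'q set) \<Rightarrow> bool" where
  "is_free_product_of Q I A \<longleftrightarrow>
     (\<forall>i \<in> I. subgroup (A i) Q) \<and>
     (\<lambda>w. foldr (\<lambda>(i, x) y. x \<otimes>\<^bsub>Q\<^esub> y) w \<one>\<^bsub>Q\<^esub>)
       \<in> iso (free_product I (\<lambda>i. Q\<lparr>carrier := A i\<rparr>)) Q"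

definition is_free_product_of2 :: "('q, 'm) monoid_scheme \<Rightarrow> 'q set \<Rightarrow> 'q set \<Rightarrow> bool" where
  "is_free_product_of2 Q H K \<longleftrightarrow> is_free_product_of Q (UNIV :: bool set) (\<lambda>b. if b then K else H)"

definition free_factor :: "'q set \<Rightarrow> ('q, 'm) monoid_scheme \<Rightarrow> bool" where
  "free_factor H P \<longleftrightarrow> (\<exists>K. is_free_product_of2 P H K)"

text \<open>In HOL-Algebra \<open>ord s = 0\<close> means that \<open>s\<close> has infinite order.\<close>

definition transcendental_over :: "('q, 'm) monoid_scheme \<Rightarrow> 'q set \<Rightarrow> 'q \<Rightarrow> bool" where
  "transcendental_over Q H s \<longleftrightarrow>
     group.ord Q s = 0 \<and>
     is_free_product_of2 (Q\<lparr>carrier := generate Q (H \<union> {s})\<rparr>) H (generate Q {s})"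


section \<open>Equations over a group\<close>

text \<open>An expression \<open>g\<^sub>1 t\<^sub>1 \<dots> g\<^sub>n t\<^sub>n\<close> is the list of the pairs \<open>(g\<^sub>i, t\<^sub>i)\<close>; in the expression
  \<open>g\<^sub>1 t\<^sup>k \<dots>\<close> of an ordinary equation, the second components are the exponents. The function
  below evaluates it in \<open>Q\<close>, with \<open>\<phi>\<close> applied to the coefficients and \<open>\<psi>\<close> to the second
  components.\<close>

definition eval_expr ::
    "('q, 'm) monoid_scheme \<Rightarrow> ('a \<Rightarrow> 'q) \<Rightarrow> ('t \<Rightarrow> 'q) \<Rightarrow> ('a \<times> 't) list \<Rightarrow> 'q" where
  "eval_expr Q \<phi> \<psi> w = foldr (\<lambda>(g, t) y. \<phi> g \<otimes>\<^bsub>Q\<^esub> \<psi> t \<otimes>\<^bsub>Q\<^esub> y) w \<one>\<^bsub>Q\<^esub>"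

definition equation_over :: "('p, 'm) monoid_scheme \<Rightarrow> ('p \<times> int) list \<Rightarrow> bool" where
  "equation_over P w \<longleftrightarrow> fst ` set w \<subseteq> carrier P"

definition unimodular_equation :: "('p \<times> int) list \<Rightarrow> bool" where
  "unimodular_equation w \<longleftrightarrow> \<bar>sum_list (map snd w)\<bar> = 1"

text \<open>The group \<open>P * \<langle>t\<rangle>\<^sub>\<infinity>\<close>; the sum type serves only to give both factors the same type.\<close>

definition adjoin_factors :: "('p, 'm) monoid_scheme \<Rightarrow> bool \<Rightarrow> ('p + int) monoid" where
  "adjoin_factors P b = (if b then image_group Inr integer_group else image_group Inl P)"

definition adjoin_var :: "('p, 'm) monoid_scheme \<Rightarrow> (bool \<times> ('p + int)) list monoid" where
  "adjoin_var P = free_product UNIV (adjoin_factors P)"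

definition adjoin_coeff :: "('p, 'm) monoid_scheme \<Rightarrow> 'p \<Rightarrow> (bool \<times> ('p + int)) list" where
  "adjoin_coeff P g = free_product_incl (adjoin_factors P) False (Inl g)"

definition the_var :: "('p, 'm) monoid_scheme \<Rightarrow> (bool \<times> ('p + int)) list" where
  "the_var P = free_product_incl (adjoin_factors P) True (Inr 1)"

definition lhs :: "('p, 'm) monoid_scheme \<Rightarrow> ('p \<times> int) list \<Rightarrow> (bool \<times> ('p + int)) list" where
  "lhs P w =
     eval_expr (adjoin_var P) (adjoin_coeff P) (\<lambda>k::int. the_var P [^]\<^bsub>adjoin_var P\<^esub> k) w"

definition conjugate_into :: "('q, 'm) monoid_scheme \<Rightarrow> 'q \<Rightarrow> 'q set \<Rightarrow> bool" where
  "conjugate_into F x S \<longleftrightarrow> (\<exists>u \<in> carrier F. u \<otimes>\<^bsub>F\<^esub> x \<otimes>\<^bsub>F\<^esub> inv\<^bsub>F\<^esub> u \<in> S)"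

text \<open>A group containing \<open>P\<close> as a subgroup is a group \<open>Q\<close> with an injective homomorphism from
  \<open>P\<close> to \<open>Q\<close>.\<close>

definition solution_in ::
    "('p, 'm) monoid_scheme \<Rightarrow> ('p \<times> int) list \<Rightarrow> ('q, 'n) monoid_scheme \<Rightarrow> ('p \<Rightarrow> 'q) \<Rightarrow> 'q \<Rightarrow> bool"
  where
  "solution_in P w Q \<phi> s \<longleftrightarrow>
     group Q \<and> \<phi> \<in> mon P Q \<and> s \<in> carrier Q \<and> eval_expr Q \<phi> (\<lambda>k::int. s [^]\<^bsub>Q\<^esub> k) w = \<one>\<^bsub>Q\<^esub>"

text \<open>HOL formulas cannot quantify over types, so the overgroups range over the groups on one
  fixed type. This is no restriction: an overgroup \<open>Q\<close> may be replaced by its subgroup generated by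
  \<open>P\<close> and the solution, and every element of the latter is the value of a word over \<open>'p + int\<close>
  (\<open>Inl g\<close> for an element of \<open>P\<close>, \<open>Inr k\<close> for a power of the solution), so this subgroup is
  isomorphic to a group whose elements are such words.\<close>

definition solvable_over :: "('p, 'm) monoid_scheme \<Rightarrow> ('p \<times> int) list \<Rightarrow> bool" where
  "solvable_over P w \<longleftrightarrow> (\<exists>(Q :: ('p + int) list monoid) \<phi> s. solution_in P w Q \<phi> s)"

definition magnusian :: "('p, 'm) monoid_scheme \<Rightarrow> ('p \<times> int) list \<Rightarrow> bool" where
  "magnusian P w \<longleftrightarrow>
     solvable_over P w \<and>
     (\<forall>H. free_factor H P \<and>
          \<not> conjugate_into (adjoin_var P) (lhs P w)
              (generate (adjoin_var P) (adjoin_coeff P ` H \<union> {the_var P})) \<longrightarrow>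
        (\<exists>(Q :: ('p + int) list monoid) \<phi> s.
           solution_in P w Q \<phi> s \<and> transcendental_over Q (\<phi> ` H) s))"


section \<open>Generalized equations\<close>

definition uniquely_decomposable ::
    "('q, 'm) monoid_scheme \<Rightarrow> 'q set \<Rightarrow> 'q set \<Rightarrow> 'q \<Rightarrow> bool" where
  "uniquely_decomposable Q A B z \<longleftrightarrow> (\<exists>!p. p \<in> A \<times> B \<and> fst p \<otimes>\<^bsub>Q\<^esub> snd p = z)"

definition strong_unique_product :: "('q, 'm) monoid_scheme \<Rightarrow> bool" where
  "strong_unique_product Q \<longleftrightarrow>
     (\<forall>A B. A \<subseteq> carrier Q \<and> B \<subseteq> carrier Q \<and> finite A \<and> finite B \<and> A \<noteq> {} \<and> 2 \<le> card B \<longrightarrow>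
       (\<exists>x1 \<in> A. \<exists>x2 \<in> A. \<exists>y1 \<in> B. \<exists>y2 \<in> B. y1 \<noteq> y2 \<and>
          uniquely_decomposable Q A B (x1 \<otimes>\<^bsub>Q\<^esub> y1) \<and> uniquely_decomposable Q A B (x2 \<otimes>\<^bsub>Q\<^esub> y2)))"

definition gen_equation_over ::
    "('a, 'm) monoid_scheme \<Rightarrow> ('t, 'n) monoid_scheme \<Rightarrow> ('a \<times> 't) list \<Rightarrow> bool" where
  "gen_equation_over G T w \<longleftrightarrow> set w \<subseteq> carrier G \<times> carrier T"

definition var_prod :: "('t, 'n) monoid_scheme \<Rightarrow> ('a \<times> 't) list \<Rightarrow> 't" where
  "var_prod T w = foldr (\<lambda>(g, t) y. t \<otimes>\<^bsub>T\<^esub> y) w \<one>\<^bsub>T\<^esub>"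

definition unimodular_gen_equation :: "('t, 'n) monoid_scheme \<Rightarrow> ('a \<times> 't) list \<Rightarrow> bool" where
  "unimodular_gen_equation T w \<longleftrightarrow>
     group.ord T (var_prod T w) = 0 \<and>
     generate T {var_prod T w} \<lhd> T \<and>
     strong_unique_product (T Mod generate T {var_prod T w})"

text \<open>The type of the overgroup is again no restriction: the subgroup generated by the images of
  \<open>G\<close> and \<open>T\<close> consists of values of words over \<open>'a + 't\<close>.\<close>

definition gen_solvable_over ::
    "('a, 'm) monoid_scheme \<Rightarrow> ('t, 'n) monoid_scheme \<Rightarrow> ('a \<times> 't) list \<Rightarrow> bool" where
  "gen_solvable_over G T w \<longleftrightarrow>
     (\<exists>(Q :: ('a + 't) list monoid) \<phi> \<psi>.
        group Q \<and> \<phi> \<in> mon G Q \<and> \<psi> \<in> hom T Q \<and> eval_expr Q \<phi> \<psi> w = \<one>\<^bsub>Q\<^esub>)"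

end

theory Submission
  imports Defs "HOL-Algebra.Bij"
begin

text \<open>Let \<open>c\<close> be the product of the variables, \<open>Q = T / \<langle>c\<rangle>\<close>, and let \<open>P\<close> be the free power of \<open>G\<close>
  with one factor \<open>G\<^sub>q\<close> for every \<open>q \<in> Q\<close>. Rewriting the generalized equation from the coset \<open>q\<close> turns
  it into a unimodular equation \<open>w\<^sub>q(c) = 1\<close> over \<open>P\<close>. If these equations, for all \<open>q\<close>, have a common
  solution in a group to which \<open>P\<close> is mapped injectively on every \<open>G\<^sub>q\<close>, then the permutation
  representation induced from it solves the generalized equation.

  Left translation by \<open>r \<in> Q\<close> carries \<open>w\<^sub>q\<close> to a conjugate of \<open>w\<^bsub>rq\<^esub>\<close>, so the minimal support of \<open>w\<^sub>q\<close>
  up to conjugation is \<open>qX\<close> for one finite set \<open>X\<close>. The equations \<open>w\<^sub>y\<close> for \<open>y\<close> in a finite set \<open>Y\<close> are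
  solved by induction on \<open>Y\<close>. The unique product property provides \<open>p \<in> yX\<close> for some \<open>y \<in> Y\<close> that lies in no other
  \<open>y'X\<close>, and the solution for \<open>Y - {y}\<close> is amalgamated with a solution of \<open>w\<^sub>y\<close> that is transcendental
  over the factors other than \<open>G\<^sub>p\<close>. To keep the induction going, the solution must also be
  transcendental over the factors with index in \<open>zX\<close> or outside \<open>YX\<close>, for every \<open>z\<close> not in \<open>Y\<close>; choosing \<open>p\<close>
  outside \<open>zX\<close> as well requires a second uniquely decomposable element.\<close>

section \<open>Homomorphisms and group actions\<close>

text \<open>The equations \<open>w\<^sub>q\<close> come from one relator. The kernel of G * T -> Q
  is P * <c>, its q-th factor being the conjugate of G by a representative of q, and the relator
  conjugated by that representative is \<open>w\<^sub>q\<close>. This is why one element c serves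
  all of them, and why inducing from the kernel answers the question over T.

  The obstacle is that a solution transcendental over all factors but one is granted only if
  \<open>w\<^sub>q\<close> cannot be conjugated away from the omitted factor. Supports therefore
  have to be taken up to conjugation, and each equation is replaced by a conjugate with minimal
  support. If that support is empty, unique products say nothing; but then every
  \<open>w\<^sub>q\<close> is conjugate to a power of c, and c = 1 solves them all.

  Solutions are recorded inside P * <c>, by what the normal closure of the \<open>w\<^sub>q\<close>
  meets trivially. So transcendence over a set of factors becomes a trivial intersection, which can
  be tested on finitely many equations. An amalgam only has to show that certain elements survive;
  hence a permutation group on the product of the two groups does instead of an amalgamated free
  product.\<close>

lemma hom_eq_on_generate:
  assumes "group G" "group H" "f \<in> hom G H" "g \<in> hom G H" "S \<subseteq> carrier G"
    and eq: "\<And>x. x \<in> S \<Longrightarrow> f x = g x" and z: "z \<in> generate G S"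
  shows "f z = g z"
proof -
  interpret f: group_hom G H f using assms by (simp add: group_hom_def group_hom_axioms_def)
  interpret g: group_hom G H g using assms by (simp add: group_hom_def group_hom_axioms_def)
  show ?thesis
    using z
  proof induction
    case (inv h)
    then show ?case using eq assms(5) by (metis f.hom_inv g.hom_inv subsetD)
  next
    case (eng h1 h2)
    then show ?case using f.G.generate_in_carrier[OF assms(5)] by simp
  qed (auto simp: eq)
qed

lemma hom_restrict_carrier: "h \<in> hom G H \<Longrightarrow> S \<subseteq> carrier G \<Longrightarrow> h \<in> hom (G\<lparr>carrier := S\<rparr>) H"
  by (auto simp: hom_def)

text \<open>Bijectivity is not assumed because the inverse group element acts as the inverse map.
  The restriction is there because members of \<open>Bij\<close> are extensional.\<close>

lemma hom_BijGroupI: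
  assumes "group A"
    and closed: "\<And>x z. x \<in> carrier A \<Longrightarrow> z \<in> S \<Longrightarrow> f x z \<in> S"
    and one: "\<And>z. z \<in> S \<Longrightarrow> f \<one>\<^bsub>A\<^esub> z = z"
    and mult: "\<And>x y z. x \<in> carrier A \<Longrightarrow> y \<in> carrier A \<Longrightarrow> z \<in> S \<Longrightarrow> f (x \<otimes>\<^bsub>A\<^esub> y) z = f x (f y z)"
  shows "(\<lambda>x. restrict (f x) S) \<in> hom A (BijGroup S)"
proof -
  interpret group A by fact
  have bij: "restrict (f x) S \<in> Bij S" if x: "x \<in> carrier A" for x
  proof -
    have "bij_betw (f x) S S"
      by (rule bij_betw_byWitness[where f' = "f (inv\<^bsub>A\<^esub> x)"])
         (use x closed one mult in \<open>auto simp flip: mult\<close>)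
    then show ?thesis by (simp add: Bij_def cong: bij_betw_cong)
  qed
  show ?thesis
  proof (rule homI)
    fix x y assume xy: "x \<in> carrier A" "y \<in> carrier A"
    show "restrict (f (x \<otimes>\<^bsub>A\<^esub> y)) S = restrict (f x) S \<otimes>\<^bsub>BijGroup S\<^esub> restrict (f y) S"
      using xy bij closed mult by (auto simp: BijGroup_def compose_def fun_eq_iff)
  qed (auto simp: bij BijGroup_def)
qed

lemma BijGroup_mult_apply:
  "f \<in> carrier (BijGroup S) \<Longrightarrow> g \<in> carrier (BijGroup S) \<Longrightarrow> z \<in> S
    \<Longrightarrow> (f \<otimes>\<^bsub>BijGroup S\<^esub> g) z = f (g z)"
  by (simp add: BijGroup_def compose_def)

lemma BijGroup_one_apply: "z \<in> S \<Longrightarrow> \<one>\<^bsub>BijGroup S\<^esub> z = z"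
  by (simp add: BijGroup_def)

lemma mon_conj:
  assumes "group M" "f \<in> mon A M" "t \<in> carrier M" "group A"
  shows "(\<lambda>x. t \<otimes>\<^bsub>M\<^esub> f x \<otimes>\<^bsub>M\<^esub> inv\<^bsub>M\<^esub> t) \<in> mon A M"
proof -
  interpret M: group M by fact
  have f: "f \<in> hom A M" "inj_on f (carrier A)" using assms by (auto simp: mon_def)
  have cl: "f x \<in> carrier M" if "x \<in> carrier A" for x using f that by (auto simp: hom_def)
  have "(\<lambda>x. t \<otimes>\<^bsub>M\<^esub> f x \<otimes>\<^bsub>M\<^esub> inv\<^bsub>M\<^esub> t) \<in> hom A M"
  proof (rule homI)
    fix x y assume xy: "x \<in> carrier A" "y \<in> carrier A"
    have "t \<otimes>\<^bsub>M\<^esub> f x \<otimes>\<^bsub>M\<^esub> inv\<^bsub>M\<^esub> t \<otimes>\<^bsub>M\<^esub> (t \<otimes>\<^bsub>M\<^esub> f y \<otimes>\<^bsub>M\<^esub> inv\<^bsub>M\<^esub> t)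
        = t \<otimes>\<^bsub>M\<^esub> f x \<otimes>\<^bsub>M\<^esub> (inv\<^bsub>M\<^esub> t \<otimes>\<^bsub>M\<^esub> t) \<otimes>\<^bsub>M\<^esub> f y \<otimes>\<^bsub>M\<^esub> inv\<^bsub>M\<^esub> t"
      using cl xy assms(3) by (simp only: M.m_assoc M.m_closed M.inv_closed)
    then show "t \<otimes>\<^bsub>M\<^esub> f (x \<otimes>\<^bsub>A\<^esub> y) \<otimes>\<^bsub>M\<^esub> inv\<^bsub>M\<^esub> t
        = t \<otimes>\<^bsub>M\<^esub> f x \<otimes>\<^bsub>M\<^esub> inv\<^bsub>M\<^esub> t \<otimes>\<^bsub>M\<^esub> (t \<otimes>\<^bsub>M\<^esub> f y \<otimes>\<^bsub>M\<^esub> inv\<^bsub>M\<^esub> t)"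
      using cl xy assms(3) by (simp add: hom_mult[OF f(1)] M.m_assoc)
  qed (use cl assms(3) in auto)
  moreover have "inj_on (\<lambda>x. t \<otimes>\<^bsub>M\<^esub> f x \<otimes>\<^bsub>M\<^esub> inv\<^bsub>M\<^esub> t) (carrier A)"
    using f(2) cl assms(3) by (auto simp: inj_on_def)
  ultimately show ?thesis by (simp add: mon_def)
qed

text \<open>Writing \<open>u = a c r\<close> with \<open>r\<close> in a fixed transversal of the right cosets of \<open>a C\<close>, \<open>\<gamma> u = c\<close> is
  a \<open>C\<close>-equivariant map.\<close>

lemma equivariant_retraction:
  assumes "group A" "group C" and a: "a \<in> mon C A"
  obtains \<gamma> where "\<And>u. u \<in> carrier A \<Longrightarrow> \<gamma> u \<in> carrier C"
    "\<And>c u. c \<in> carrier C \<Longrightarrow> u \<in> carrier A \<Longrightarrow> \<gamma> (a c \<otimes>\<^bsub>A\<^esub> u) = c \<otimes>\<^bsub>C\<^esub> \<gamma> u"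
proof -
  interpret A: group A by fact
  interpret C: group C by fact
  interpret a: group_hom C A a
    using assms by (simp add: group_hom_def group_hom_axioms_def mon_def)
  have inj: "inj_on a (carrier C)" using a by (simp add: mon_def)
  let ?H = "a ` carrier C"
  have H: "subgroup ?H A" by (rule a.img_is_subgroup)
  \<comment> \<open>The choice depends on u only through its coset, so r is invariant under left
    multiplication by the image of C.\<close>
  define r where "r u = (SOME v. v \<in> ?H #>\<^bsub>A\<^esub> u)" for u
  have r: "r u \<in> ?H #>\<^bsub>A\<^esub> u" if "u \<in> carrier A" for u
    unfolding r_def by (rule someI[of _ u]) (rule A.rcos_self[OF that H])
  have r_eq: "r (a c \<otimes>\<^bsub>A\<^esub> u) = r u" if "c \<in> carrier C" "u \<in> carrier A" for c u
  proof -
    have "?H #>\<^bsub>A\<^esub> (a c \<otimes>\<^bsub>A\<^esub> u) = ?H #>\<^bsub>A\<^esub> u"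
      using that H A.coset_mult_assoc[of ?H "a c" u] A.coset_join2[of "a c" ?H]
        subgroup.subset[OF H] by auto
    then show ?thesis by (simp add: r_def)
  qed
  define \<gamma> where "\<gamma> u = inv_into (carrier C) a (u \<otimes>\<^bsub>A\<^esub> inv\<^bsub>A\<^esub> (r u))" for u
  have ru: "r u \<in> carrier A \<and> u \<otimes>\<^bsub>A\<^esub> inv\<^bsub>A\<^esub> (r u) \<in> ?H" if u: "u \<in> carrier A" for u
  proof -
    obtain c where c: "c \<in> carrier C" "r u = a c \<otimes>\<^bsub>A\<^esub> u" using r[OF u] by (auto simp: r_coset_def)
    then have "u \<otimes>\<^bsub>A\<^esub> inv\<^bsub>A\<^esub> (r u) = a (inv\<^bsub>C\<^esub> c)"
      using u by (simp add: A.inv_mult_group flip: A.m_assoc)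
    then show ?thesis using c u by (simp del: a.hom_inv)
  qed
  have a\<gamma>: "a (\<gamma> u) = u \<otimes>\<^bsub>A\<^esub> inv\<^bsub>A\<^esub> (r u)" if "u \<in> carrier A" for u
    unfolding \<gamma>_def by (rule f_inv_into_f) (use ru that in blast)
  show ?thesis
  proof
    show 1: "\<gamma> u \<in> carrier C" if "u \<in> carrier A" for u
      unfolding \<gamma>_def by (rule inv_into_into) (use ru that in blast)
    fix c u assume cu: "c \<in> carrier C" "u \<in> carrier A"
    have "a (\<gamma> (a c \<otimes>\<^bsub>A\<^esub> u)) = a (c \<otimes>\<^bsub>C\<^esub> \<gamma> u)"
      using cu 1 ru by (simp add: a\<gamma> r_eq A.m_assoc)
    then show "\<gamma> (a c \<otimes>\<^bsub>A\<^esub> u) = c \<otimes>\<^bsub>C\<^esub> \<gamma> u"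
      using inj cu 1 by (meson A.m_closed C.m_closed a.hom_closed inj_onD)
  qed
qed

text \<open>With \<open>u = a c r\<close> and \<open>v = b d s\<close>, the involution \<open>(u, v) \<mapsto> (a d r, b c s)\<close> of \<open>A \<times> B\<close>
  turns left multiplication by \<open>b x\<close> on \<open>B\<close> into left multiplication by \<open>a x\<close> on \<open>A\<close>.\<close>

lemma common_permutation_group:
  assumes "group A" "group B" "group C" and a: "a \<in> mon C A" and b: "b \<in> mon C B"
  defines "M \<equiv> BijGroup (carrier A \<times> carrier B)"
  obtains i j where "i \<in> mon A M" "j \<in> mon B M" "\<And>c. c \<in> carrier C \<Longrightarrow> i (a c) = j (b c)"
proof -
  interpret A: group A by fact
  interpret B: group B by fact
  interpret C: group C by fact
  interpret a: group_hom C A a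
    using assms by (simp add: group_hom_def group_hom_axioms_def mon_def)
  interpret b: group_hom C B b
    using assms by (simp add: group_hom_def group_hom_axioms_def mon_def)
  interpret M: group M unfolding M_def by (rule group_BijGroup)
  let ?S = "carrier A \<times> carrier B"
  obtain \<gamma> where \<gamma>: "\<And>u. u \<in> carrier A \<Longrightarrow> \<gamma> u \<in> carrier C"
    and \<gamma>_eq: "\<And>c u. c \<in> carrier C \<Longrightarrow> u \<in> carrier A \<Longrightarrow> \<gamma> (a c \<otimes>\<^bsub>A\<^esub> u) = c \<otimes>\<^bsub>C\<^esub> \<gamma> u"
    using equivariant_retraction[OF assms(1,3) a] by metis
  obtain \<delta> where \<delta>: "\<And>u. u \<in> carrier B \<Longrightarrow> \<delta> u \<in> carrier C"
    and \<delta>_eq: "\<And>c u. c \<in> carrier C \<Longrightarrow> u \<in> carrier B \<Longrightarrow> \<delta> (b c \<otimes>\<^bsub>B\<^esub> u) = c \<otimes>\<^bsub>C\<^esub> \<delta> u"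
    using equivariant_retraction[OF assms(2,3) b] by metis
  \<comment> \<open>\<open>\<gamma> u\<close> is the C-coordinate c of u and
    \<open>\<delta> v\<close> the coordinate d of v, so left multiplication by the image of d
    c\<inverse> turns a c r into a d r without naming r.\<close>
  define \<theta> where "\<theta> = restrict (\<lambda>(u, v). (a (\<delta> v \<otimes>\<^bsub>C\<^esub> inv\<^bsub>C\<^esub> \<gamma> u) \<otimes>\<^bsub>A\<^esub> u,
                             b (\<gamma> u \<otimes>\<^bsub>C\<^esub> inv\<^bsub>C\<^esub> \<delta> v) \<otimes>\<^bsub>B\<^esub> v)) ?S"
  have swap: "\<gamma> (a (d \<otimes>\<^bsub>C\<^esub> inv\<^bsub>C\<^esub> \<gamma> u) \<otimes>\<^bsub>A\<^esub> u) = d" if "u \<in> carrier A" "d \<in> carrier C" for u d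
    using that \<gamma> by (simp del: a.hom_mult add: \<gamma>_eq C.m_assoc)
  have swap': "\<delta> (b (d \<otimes>\<^bsub>C\<^esub> inv\<^bsub>C\<^esub> \<delta> v) \<otimes>\<^bsub>B\<^esub> v) = d" if "v \<in> carrier B" "d \<in> carrier C" for v d
    using that \<delta> by (simp del: b.hom_mult add: \<delta>_eq C.m_assoc)
  have \<theta>_closed: "\<theta> z \<in> ?S" if "z \<in> ?S" for z
    using that \<gamma> \<delta> by (auto simp: \<theta>_def)
  have \<theta>2: "\<theta> (\<theta> z) = z" if "z \<in> ?S" for z
  proof -
    obtain u v where z: "z = (u, v)" "u \<in> carrier A" "v \<in> carrier B" using \<open>z \<in> ?S\<close> by blast
    have cancel: "x \<otimes>\<^bsub>C\<^esub> inv\<^bsub>C\<^esub> y \<otimes>\<^bsub>C\<^esub> (y \<otimes>\<^bsub>C\<^esub> inv\<^bsub>C\<^esub> x) = \<one>\<^bsub>C\<^esub>"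
      if "x \<in> carrier C" "y \<in> carrier C" for x y
    proof -
      have "x \<otimes>\<^bsub>C\<^esub> inv\<^bsub>C\<^esub> y \<otimes>\<^bsub>C\<^esub> (y \<otimes>\<^bsub>C\<^esub> inv\<^bsub>C\<^esub> x) = x \<otimes>\<^bsub>C\<^esub> (inv\<^bsub>C\<^esub> y \<otimes>\<^bsub>C\<^esub> y) \<otimes>\<^bsub>C\<^esub> inv\<^bsub>C\<^esub> x"
        using that by (simp only: C.m_assoc C.m_closed C.inv_closed)
      then show ?thesis using that by simp
    qed
    let ?x = "\<delta> v \<otimes>\<^bsub>C\<^esub> inv\<^bsub>C\<^esub> \<gamma> u" and ?y = "\<gamma> u \<otimes>\<^bsub>C\<^esub> inv\<^bsub>C\<^esub> \<delta> v"
    have "\<theta> (\<theta> z) = (a ?y \<otimes>\<^bsub>A\<^esub> (a ?x \<otimes>\<^bsub>A\<^esub> u), b ?x \<otimes>\<^bsub>B\<^esub> (b ?y \<otimes>\<^bsub>B\<^esub> v))"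
      using z \<gamma> \<delta> by (simp del: a.hom_mult b.hom_mult add: \<theta>_def swap swap')
    also have "\<dots> = (a (?y \<otimes>\<^bsub>C\<^esub> ?x) \<otimes>\<^bsub>A\<^esub> u, b (?x \<otimes>\<^bsub>C\<^esub> ?y) \<otimes>\<^bsub>B\<^esub> v)"
      using z \<gamma> \<delta> by (simp add: A.m_assoc B.m_assoc)
    also have "\<dots> = z"
      using z \<gamma>[of u] \<delta>[of v] by (simp del: a.hom_mult b.hom_mult add: cancel)
    finally show ?thesis .
  qed
  have \<theta>: "\<theta> \<in> carrier M"
    using \<theta>_closed \<theta>2 unfolding M_def BijGroup_def Bij_def
    by (auto intro!: bij_betw_byWitness[where f' = \<theta>] simp: \<theta>_def)
  have "\<theta> \<otimes>\<^bsub>M\<^esub> \<theta> = \<one>\<^bsub>M\<^esub>"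
    using \<theta> \<theta>2 unfolding M_def by (auto simp: BijGroup_def compose_def fun_eq_iff)
  then have \<theta>_inv: "inv\<^bsub>M\<^esub> \<theta> = \<theta>" using \<theta> by (simp add: M.inv_equality)
  define i where "i x = restrict (\<lambda>(u, v). (x \<otimes>\<^bsub>A\<^esub> u, v)) ?S" for x
  define j0 where "j0 y = restrict (\<lambda>(u, v). (u, y \<otimes>\<^bsub>B\<^esub> v)) ?S" for y
  have i: "i \<in> hom A M"
    unfolding M_def i_def by (rule hom_BijGroupI) (auto simp: A.m_assoc A.is_group)
  have j0: "j0 \<in> hom B M"
    unfolding M_def j0_def by (rule hom_BijGroupI) (auto simp: B.m_assoc B.is_group)
  have "inj_on i (carrier A)"
  proof (rule inj_onI)
    fix x y assume xy: "x \<in> carrier A" "y \<in> carrier A" and "i x = i y"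
    from \<open>i x = i y\<close> have "i x (\<one>\<^bsub>A\<^esub>, \<one>\<^bsub>B\<^esub>) = i y (\<one>\<^bsub>A\<^esub>, \<one>\<^bsub>B\<^esub>)" by simp
    then show "x = y" using xy by (simp add: i_def)
  qed
  then have "i \<in> mon A M" using i by (simp add: mon_def)
  have "inj_on j0 (carrier B)"
  proof (rule inj_onI)
    fix x y assume xy: "x \<in> carrier B" "y \<in> carrier B" and "j0 x = j0 y"
    from \<open>j0 x = j0 y\<close> have "j0 x (\<one>\<^bsub>A\<^esub>, \<one>\<^bsub>B\<^esub>) = j0 y (\<one>\<^bsub>A\<^esub>, \<one>\<^bsub>B\<^esub>)" by simp
    then show "x = y" using xy by (simp add: j0_def)
  qed
  then have "j0 \<in> mon B M" using j0 by (simp add: mon_def)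
  define j where "j = (\<lambda>y. \<theta> \<otimes>\<^bsub>M\<^esub> j0 y \<otimes>\<^bsub>M\<^esub> inv\<^bsub>M\<^esub> \<theta>)"
  have j: "j \<in> mon B M"
    unfolding j_def by (rule mon_conj) (use \<theta> \<open>j0 \<in> mon B M\<close> in auto)
  have "i (a c) = j (b c)" if c: "c \<in> carrier C" for c
  proof -
    have "(i (a c) \<otimes>\<^bsub>M\<^esub> \<theta>) z = (\<theta> \<otimes>\<^bsub>M\<^esub> j0 (b c)) z" for z
    proof (cases "z \<in> ?S")
      case True
      then obtain u v where z: "z = (u, v)" "u \<in> carrier A" "v \<in> carrier B" by blast
      have cl: "i (a c) \<in> carrier M" "j0 (b c) \<in> carrier M"
        using i j0 c by (auto simp: hom_def)
      have eq: "\<gamma> u \<otimes>\<^bsub>C\<^esub> inv\<^bsub>C\<^esub> (c \<otimes>\<^bsub>C\<^esub> \<delta> v) \<otimes>\<^bsub>C\<^esub> c = \<gamma> u \<otimes>\<^bsub>C\<^esub> inv\<^bsub>C\<^esub> \<delta> v"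
        using z \<gamma> \<delta> c by (simp add: C.inv_mult_group C.m_assoc)
      have cl': "(u, b c \<otimes>\<^bsub>B\<^esub> v) \<in> ?S" "j0 (b c) z = (u, b c \<otimes>\<^bsub>B\<^esub> v)"
        using c z by (auto simp: j0_def)
      have "(i (a c) \<otimes>\<^bsub>M\<^esub> \<theta>) z = i (a c) (\<theta> z)"
        using True \<theta> cl unfolding M_def by (rule_tac BijGroup_mult_apply)
      also have "\<dots> = (a c \<otimes>\<^bsub>A\<^esub> (a (\<delta> v \<otimes>\<^bsub>C\<^esub> inv\<^bsub>C\<^esub> \<gamma> u) \<otimes>\<^bsub>A\<^esub> u), b (\<gamma> u \<otimes>\<^bsub>C\<^esub> inv\<^bsub>C\<^esub> \<delta> v) \<otimes>\<^bsub>B\<^esub> v)"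
        using \<theta>_closed[OF True] z by (simp add: i_def \<theta>_def)
      also have "\<dots> = (a (c \<otimes>\<^bsub>C\<^esub> \<delta> v \<otimes>\<^bsub>C\<^esub> inv\<^bsub>C\<^esub> \<gamma> u) \<otimes>\<^bsub>A\<^esub> u,
          b (\<gamma> u \<otimes>\<^bsub>C\<^esub> inv\<^bsub>C\<^esub> (c \<otimes>\<^bsub>C\<^esub> \<delta> v) \<otimes>\<^bsub>C\<^esub> c) \<otimes>\<^bsub>B\<^esub> v)"
        unfolding eq using z \<gamma> \<delta> c by (simp add: A.m_assoc)
      also have "\<dots> = \<theta> (u, b c \<otimes>\<^bsub>B\<^esub> v)"
        using z \<gamma> \<delta> c by (simp add: \<theta>_def \<delta>_eq B.m_assoc)
      also have "\<dots> = (\<theta> \<otimes>\<^bsub>M\<^esub> j0 (b c)) z"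
        using True \<theta> cl cl' unfolding M_def by (simp add: BijGroup_mult_apply)
      finally show ?thesis .
    next
      case False
      have "i (a c) \<otimes>\<^bsub>M\<^esub> \<theta> \<in> extensional ?S" "\<theta> \<otimes>\<^bsub>M\<^esub> j0 (b c) \<in> extensional ?S"
        using \<theta> i j0 c M.m_closed unfolding M_def
        by (metis (no_types, lifting) BijGroup_def Bij_imp_extensional a.hom_closed b.hom_closed
            hom_in_carrier partial_object.select_convs(1) M_def)+
      then show ?thesis using extensional_arb[OF _ False] by metis
    qed
    then have eq: "i (a c) \<otimes>\<^bsub>M\<^esub> \<theta> = \<theta> \<otimes>\<^bsub>M\<^esub> j0 (b c)" by blast
    have "i (a c) \<in> carrier M" using i c by (auto simp: hom_def)
    then show ?thesis unfolding j_def using eq[symmetric] \<theta> M.m_assoc by simp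
  qed
  then show ?thesis using that \<open>i \<in> mon A M\<close> j by blast
qed

lemma hom_eq_on_generate_subgroup:
  assumes "group G" "group H" "S \<subseteq> carrier G"
    and "f \<in> hom (G\<lparr>carrier := generate G S\<rparr>) H" "g \<in> hom (G\<lparr>carrier := generate G S\<rparr>) H"
    and eq: "\<And>x. x \<in> S \<Longrightarrow> f x = g x" and z: "z \<in> generate G S"
  shows "f z = g z"
proof -
  interpret group G by fact
  have sub: "subgroup (generate G S) G" using assms(3) by (rule generate_is_subgroup)
  show ?thesis
  proof (rule hom_eq_on_generate[where S = S and z = z])
    show "group (G\<lparr>carrier := generate G S\<rparr>)" using sub is_group by (rule subgroup.subgroup_is_group)
    show "z \<in> generate (G\<lparr>carrier := generate G S\<rparr>) S"
      using z generate_consistent[of S "generate G S"] sub by (simp add: generate.incl subsetI)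
    show "S \<subseteq> carrier (G\<lparr>carrier := generate G S\<rparr>)" by (auto intro: generate.incl)
  qed (use assms in auto)
qed

lemma image_group_iso:
  assumes "group G" "inj_on f (carrier G)"
  shows "f \<in> iso G (image_group f G)" "group (image_group f G)"
proof -
  interpret group G by fact
  show iso: "f \<in> iso G (image_group f G)"
    using assms by (auto simp: iso_def hom_def image_group_def inv_into_f_f bij_betw_def)
  have "group ((image_group f G)\<lparr>one := f \<one>\<^bsub>G\<^esub>\<rparr>)" by (rule iso_imp_img_group[OF iso])
  then show "group (image_group f G)" by (simp add: image_group_def)
qed

lemma hom_image_group:
  assumes "group G" "inj_on f (carrier G)" "h \<in> hom G L" "\<And>x. x \<in> carrier G \<Longrightarrow> h' (f x) = h x"
  shows "h' \<in> hom (image_group f G) L"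
proof -
  interpret group G by fact
  show ?thesis
    using assms by (auto simp: hom_def image_group_def inv_into_f_f Pi_iff)
qed

lemma hom_eval_expr:
  assumes "group L" "group M" "h \<in> hom L M"
    and "\<And>g t. (g, t) \<in> set w \<Longrightarrow>
      \<phi> g \<in> carrier L \<and> \<psi> t \<in> carrier L \<and> h (\<phi> g) = \<phi>' g \<and> h (\<psi> t) = \<psi>' t"
  shows "eval_expr L \<phi> \<psi> w \<in> carrier L"
    and "h (eval_expr L \<phi> \<psi> w) = eval_expr M \<phi>' \<psi>' w"
proof -
  interpret h: group_hom L M h using assms(1-3) by (simp add: group_hom_def group_hom_axioms_def)
  have "eval_expr L \<phi> \<psi> w \<in> carrier L \<and> h (eval_expr L \<phi> \<psi> w) = eval_expr M \<phi>' \<psi>' w"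
    using assms(4)
  proof (induction w)
    case (Cons a w)
    obtain g t where a: "a = (g, t)" by (cases a)
    have "eval_expr L \<phi> \<psi> w \<in> carrier L \<and> h (eval_expr L \<phi> \<psi> w) = eval_expr M \<phi>' \<psi>' w"
      by (rule Cons.IH) (use Cons.prems in auto)
    then show ?case using Cons.prems[of g t] a by (simp add: eval_expr_def)
  qed (simp add: eval_expr_def)
  then show "eval_expr L \<phi> \<psi> w \<in> carrier L" "h (eval_expr L \<phi> \<psi> w) = eval_expr M \<phi>' \<psi>' w" by auto
qed

lemma generate_hom_image:
  assumes "group G" "group L" "f \<in> hom G L" "S \<subseteq> carrier G" "subgroup K L"
    and "\<And>x. x \<in> S \<Longrightarrow> f x \<in> K" "z \<in> generate G S"
  shows "f z \<in> K"
proof -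
  interpret f: group_hom G L f using assms(1-3) by (simp add: group_hom_def group_hom_axioms_def)
  have "f ` generate G S = generate L (f ` S)" using f.generate_img[OF assms(4)] by simp
  moreover have "generate L (f ` S) \<subseteq> K" by (rule f.H.generate_subgroup_incl) (use assms in auto)
  ultimately show ?thesis using assms(7) by blast
qed

section \<open>Normal closures\<close>

definition normal_closure :: "('a, 'm) monoid_scheme \<Rightarrow> 'a set \<Rightarrow> 'a set" where
  "normal_closure F R = generate F (\<Union>u\<in>carrier F. (\<lambda>r. u \<otimes>\<^bsub>F\<^esub> r \<otimes>\<^bsub>F\<^esub> inv\<^bsub>F\<^esub> u) ` R)"

context group
begin

lemma normal_closure_gens:
  "R \<subseteq> carrier G \<Longrightarrow> (\<Union>u\<in>carrier G. (\<lambda>r. u \<otimes> r \<otimes> inv u) ` R) \<subseteq> carrier G"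
  by auto

lemma normal_closure_normal:
  assumes R: "R \<subseteq> carrier G"
  shows "normal_closure G R \<lhd> G"
  unfolding normal_closure_def
proof (rule normal_generateI[OF normal_closure_gens[OF R]])
  fix h g assume h: "h \<in> (\<Union>u\<in>carrier G. (\<lambda>r. u \<otimes> r \<otimes> inv u) ` R)" and g: "g \<in> carrier G"
  then obtain u r where ur: "u \<in> carrier G" "r \<in> R" "r \<in> carrier G" "h = u \<otimes> r \<otimes> inv u" using R by auto
  then have "g \<otimes> h \<otimes> inv g = (g \<otimes> u) \<otimes> r \<otimes> inv (g \<otimes> u)"
    using g by (simp add: m_assoc inv_mult_group)
  then show "g \<otimes> h \<otimes> inv g \<in> (\<Union>u\<in>carrier G. (\<lambda>r. u \<otimes> r \<otimes> inv u) ` R)"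
    using ur g by blast
qed

lemma normal_closure_incl: "R \<subseteq> carrier G \<Longrightarrow> R \<subseteq> normal_closure G R"
proof
  fix r assume "R \<subseteq> carrier G" "r \<in> R"
  then have "r = \<one> \<otimes> r \<otimes> inv \<one>" by auto
  then show "r \<in> normal_closure G R"
    unfolding normal_closure_def using \<open>r \<in> R\<close> by (blast intro: generate.incl)
qed

lemma normal_closure_hom_one:
  assumes "R \<subseteq> carrier G" "group L" "h \<in> hom G L" "\<And>r. r \<in> R \<Longrightarrow> h r = \<one>\<^bsub>L\<^esub>"
    and z: "z \<in> normal_closure G R"
  shows "h z = \<one>\<^bsub>L\<^esub>"
proof -
  interpret h: group_hom G L h using is_group assms(2,3) by (simp add: group_hom_def group_hom_axioms_def)
  have "h z \<in> {\<one>\<^bsub>L\<^esub>}"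
  proof (rule generate_hom_image[OF is_group assms(2,3) normal_closure_gens[OF assms(1)]])
    show "h x \<in> {\<one>\<^bsub>L\<^esub>}" if x: "x \<in> (\<Union>u\<in>carrier G. (\<lambda>r. u \<otimes> r \<otimes> inv u) ` R)" for x
    proof -
      obtain u r where "u \<in> carrier G" "r \<in> R" "x = u \<otimes> r \<otimes> inv u" using x by blast
      moreover have "r \<in> carrier G" using assms(1) \<open>r \<in> R\<close> by blast
      ultimately show ?thesis using assms(4) by simp
    qed
    show "z \<in> generate G (\<Union>u\<in>carrier G. (\<lambda>r. u \<otimes> r \<otimes> inv u) ` R)"
      using z by (simp only: normal_closure_def)
  qed (rule h.H.triv_subgroup)
  then show ?thesis by simp
qed

text \<open>A member of the normal closure is a product of finitely many conjugates. This
  compactness reduces the system of all translates to finite ones.\<close>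

lemma normal_closure_finite:
  assumes "z \<in> normal_closure G R"
  obtains R' where "finite R'" "R' \<subseteq> R" "z \<in> normal_closure G R'"
proof -
  have mono: "normal_closure G A \<subseteq> normal_closure G B" if "A \<subseteq> B" for A B
    unfolding normal_closure_def by (rule mono_generate) (use that in blast)
  have "\<exists>R'. finite R' \<and> R' \<subseteq> R \<and> z \<in> normal_closure G R'"
    using assms unfolding normal_closure_def[of G R]
  proof induction
    case one
    then show ?case by (intro exI[of _ "{}"]) (simp add: normal_closure_def generate.one)
  next
    case (incl h)
    then obtain u r where "u \<in> carrier G" "r \<in> R" "h = u \<otimes> r \<otimes> inv u" by blast
    then show ?case
      unfolding normal_closure_def by (intro exI[of _ "{r}"] conjI generate.incl) auto
  next
    case (inv h)
    then obtain u r where "u \<in> carrier G" "r \<in> R" "h = u \<otimes> r \<otimes> inv u" by blast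
    then show ?case
      unfolding normal_closure_def by (intro exI[of _ "{r}"] conjI generate.inv) auto
  next
    case (eng h1 h2)
    then obtain A B where "finite A" "A \<subseteq> R" "h1 \<in> normal_closure G A"
      "finite B" "B \<subseteq> R" "h2 \<in> normal_closure G B" by blast
    then have "h1 \<in> normal_closure G (A \<union> B)" "h2 \<in> normal_closure G (A \<union> B)"
      using mono[of A "A \<union> B"] mono[of B "A \<union> B"] by auto
    then have "h1 \<otimes> h2 \<in> normal_closure G (A \<union> B)"
      unfolding normal_closure_def by (rule generate.eng)
    then show ?case using \<open>finite A\<close> \<open>finite B\<close> \<open>A \<subseteq> R\<close> \<open>B \<subseteq> R\<close>
      by (intro exI[of _ "A \<union> B"] conjI) simp_all
  qed
  then show ?thesis using that by blast
qed

lemma int_pow_conj: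
  assumes "x \<in> carrier G" "y \<in> carrier G"
  shows "(y \<otimes> x \<otimes> inv y) [^] (n :: int) = y \<otimes> x [^] n \<otimes> inv y"
proof -
  have "(\<lambda>x. y \<otimes> x \<otimes> inv y) \<in> hom G G"
  proof (rule homI)
    fix a b assume ab: "a \<in> carrier G" "b \<in> carrier G"
    have "y \<otimes> a \<otimes> inv y \<otimes> (y \<otimes> b \<otimes> inv y) = y \<otimes> a \<otimes> (inv y \<otimes> y) \<otimes> b \<otimes> inv y"
      using ab assms by (simp only: m_assoc m_closed inv_closed)
    then show "y \<otimes> (a \<otimes> b) \<otimes> inv y = y \<otimes> a \<otimes> inv y \<otimes> (y \<otimes> b \<otimes> inv y)"
      using ab assms by (simp add: m_assoc)
  qed (use assms in auto)
  then interpret c: group_hom G G "\<lambda>x. y \<otimes> x \<otimes> inv y" by unfold_locales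
  show ?thesis using c.hom_int_pow[OF assms(1), of n] by simp
qed

end

section \<open>Conjugation into a subset\<close>

lemma conjugate_into_hom:
  assumes "group F" "group L" "f \<in> hom F L" "x \<in> carrier F" "S \<subseteq> carrier F"
    and "conjugate_into F x S" "\<And>z. z \<in> S \<Longrightarrow> f z \<in> S'"
  shows "conjugate_into L (f x) S'"
proof -
  interpret f: group_hom F L f using assms(1-3) by (simp add: group_hom_def group_hom_axioms_def)
  obtain u where u: "u \<in> carrier F" "u \<otimes>\<^bsub>F\<^esub> x \<otimes>\<^bsub>F\<^esub> inv\<^bsub>F\<^esub> u \<in> S"
    using assms(6) by (auto simp: conjugate_into_def)
  then have "f u \<otimes>\<^bsub>L\<^esub> f x \<otimes>\<^bsub>L\<^esub> inv\<^bsub>L\<^esub> f u \<in> S'" using assms(4) assms(7)[of "u \<otimes>\<^bsub>F\<^esub> x \<otimes>\<^bsub>F\<^esub> inv\<^bsub>F\<^esub> u"] by simp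
  then show ?thesis
    unfolding conjugate_into_def by (rule bexI[of _ "f u"]) (use u(1) in simp)
qed

lemma conjugate_into_conj:
  assumes "group F" "x \<in> carrier F" "v \<in> carrier F"
    and "conjugate_into F (v \<otimes>\<^bsub>F\<^esub> x \<otimes>\<^bsub>F\<^esub> inv\<^bsub>F\<^esub> v) S"
  shows "conjugate_into F x S"
proof -
  interpret group F by fact
  obtain u where u: "u \<in> carrier F" "u \<otimes>\<^bsub>F\<^esub> (v \<otimes>\<^bsub>F\<^esub> x \<otimes>\<^bsub>F\<^esub> inv\<^bsub>F\<^esub> v) \<otimes>\<^bsub>F\<^esub> inv\<^bsub>F\<^esub> u \<in> S"
    using assms(4) by (auto simp: conjugate_into_def)
  moreover have "u \<otimes>\<^bsub>F\<^esub> (v \<otimes>\<^bsub>F\<^esub> x \<otimes>\<^bsub>F\<^esub> inv\<^bsub>F\<^esub> v) \<otimes>\<^bsub>F\<^esub> inv\<^bsub>F\<^esub> u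
      = (u \<otimes>\<^bsub>F\<^esub> v) \<otimes>\<^bsub>F\<^esub> x \<otimes>\<^bsub>F\<^esub> inv\<^bsub>F\<^esub> (u \<otimes>\<^bsub>F\<^esub> v)"
    using u(1) assms by (simp add: m_assoc inv_mult_group)
  ultimately show ?thesis
    unfolding conjugate_into_def using u(1) assms(3) by (intro bexI[of _ "u \<otimes>\<^bsub>F\<^esub> v"]) simp_all
qed

lemma conjugate_into_mono: "conjugate_into F x S \<Longrightarrow> S \<subseteq> S' \<Longrightarrow> conjugate_into F x S'"
  by (auto simp: conjugate_into_def)

section \<open>Universal property of free products\<close>

text \<open>The homomorphism out of the free product that extends the family \<open>f\<close>; for
  identity maps it is the multiplication map in \<open>is_free_product_of\<close>.\<close>

definition free_product_lift ::
    "('q, 'm) monoid_scheme \<Rightarrow> ('i \<Rightarrow> 'a \<Rightarrow> 'q) \<Rightarrow> ('i \<times> 'a) list \<Rightarrow> 'q" where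
  "free_product_lift L f w = foldr (\<lambda>(i, x) y. f i x \<otimes>\<^bsub>L\<^esub> y) w \<one>\<^bsub>L\<^esub>"

lemma free_product_lift_simps [simp]:
  "free_product_lift L f [] = \<one>\<^bsub>L\<^esub>"
  "free_product_lift L f ((i, x) # w) = f i x \<otimes>\<^bsub>L\<^esub> free_product_lift L f w"
  by (simp_all add: free_product_lift_def)

lemma reduced_words_Cons:
  "(i, x) # w \<in> reduced_words I G \<Longrightarrow>
     i \<in> I \<and> x \<in> carrier (G i) \<and> x \<noteq> \<one>\<^bsub>G i\<^esub> \<and> w \<in> reduced_words I G"
  by (auto simp: reduced_words_def distinct_adj_Cons)

lemma carrier_free_product: "carrier (free_product I G) = reduced_words I G"
  and mult_free_product: "u \<otimes>\<^bsub>free_product I G\<^esub> v = foldr (syllable_mult G) u v"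
  and one_free_product: "\<one>\<^bsub>free_product I G\<^esub> = []"
  by (simp_all add: free_product_def)

context
  fixes I :: "'i set" and G :: "'i \<Rightarrow> ('a, 'm) monoid_scheme"
    and L :: "('q, 'n) monoid_scheme" and f :: "'i \<Rightarrow> 'a \<Rightarrow> 'q"
  assumes G: "\<And>i. i \<in> I \<Longrightarrow> group (G i)" and L: "group L"
    and f: "\<And>i. i \<in> I \<Longrightarrow> f i \<in> hom (G i) L"
begin

interpretation L: group L by (rule L)

lemma free_product_lift_closed:
  "w \<in> reduced_words I G \<Longrightarrow> free_product_lift L f w \<in> carrier L"
proof (induction w)
  case (Cons s w)
  obtain i x where "s = (i, x)" by (cases s)
  moreover from this have "i \<in> I" "x \<in> carrier (G i)" "w \<in> reduced_words I G"
    using Cons.prems reduced_words_Cons[of i x w I G] by auto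
  ultimately show ?case using Cons.IH hom_in_carrier[OF f, of i x] by simp
qed simp

text \<open>Merging or cancelling the first two syllables is the only reduction that occurs, so
  multiplicativity of the lift comes down to this case.\<close>

lemma free_product_lift_syllable_mult:
  assumes i: "i \<in> I" and x: "x \<in> carrier (G i)" and w: "w \<in> reduced_words I G"
  shows "free_product_lift L f (syllable_mult G (i, x) w) = f i x \<otimes>\<^bsub>L\<^esub> free_product_lift L f w"
proof -
  interpret fi: group_hom "G i" L "f i"
    using G[OF i] f[OF i] L by (simp add: group_hom_def group_hom_axioms_def)
  show ?thesis
  proof (cases w)
    case Nil
    then show ?thesis using x by auto
  next
    case (Cons s v)
    obtain j y where s: "s = (j, y)" by (cases s)
    have v: "v \<in> reduced_words I G" and jy: "j \<in> I" "y \<in> carrier (G j)"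
      using w Cons s reduced_words_Cons[of j y v I G] by auto
    have fy: "f j y \<in> carrier L" by (rule hom_in_carrier[OF f[OF jy(1)] jy(2)])
    note cl = free_product_lift_closed[OF v] fy hom_in_carrier[OF f[OF i] x]
    have "f i x \<otimes>\<^bsub>L\<^esub> (f i y \<otimes>\<^bsub>L\<^esub> free_product_lift L f v) = free_product_lift L f v"
      if "i = j" "x \<otimes>\<^bsub>G i\<^esub> y = \<one>\<^bsub>G i\<^esub>"
      using that x jy cl fi.hom_mult[of x y] L.m_assoc[of "f i x" "f i y" "free_product_lift L f v"] fi.hom_one
      by simp
    moreover have "f i x \<otimes>\<^bsub>L\<^esub> (f i y \<otimes>\<^bsub>L\<^esub> free_product_lift L f v)
        = f i (x \<otimes>\<^bsub>G i\<^esub> y) \<otimes>\<^bsub>L\<^esub> free_product_lift L f v"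
      if "i = j"
      using that x jy cl fi.hom_mult[of x y] by (simp add: L.m_assoc)
    ultimately show ?thesis using x cl Cons s by auto
  qed
qed

lemma free_product_lift_hom: "free_product_lift L f \<in> hom (free_product I G) L"
proof (rule homI)
  interpret F: group "free_product I G" using group_free_product G by blast
  fix u v assume u: "u \<in> carrier (free_product I G)" and v: "v \<in> carrier (free_product I G)"
  show "free_product_lift L f (u \<otimes>\<^bsub>free_product I G\<^esub> v)
      = free_product_lift L f u \<otimes>\<^bsub>L\<^esub> free_product_lift L f v"
    using u
  proof (induction u)
    case Nil
    show ?case using v by (simp add: mult_free_product carrier_free_product free_product_lift_closed)
  next
    case (Cons s u)
    obtain i x where s: "s = (i, x)" by (cases s)
    have u: "u \<in> reduced_words I G" and ix: "i \<in> I" "x \<in> carrier (G i)"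
      using Cons.prems s reduced_words_Cons[of i x] by (auto simp: carrier_free_product)
    have "foldr (syllable_mult G) u v \<in> reduced_words I G"
      using F.m_closed[of u v] u v by (simp add: mult_free_product carrier_free_product)
    moreover have "f i x \<in> carrier L" by (rule hom_in_carrier[OF f[OF ix(1)] ix(2)])
    ultimately show ?case
      using Cons.IH s u v ix
      by (simp add: mult_free_product carrier_free_product free_product_lift_syllable_mult
          free_product_lift_closed L.m_assoc)
  qed
qed (simp add: carrier_free_product free_product_lift_closed)

lemma free_product_lift_incl:
  assumes i: "i \<in> I" and x: "x \<in> carrier (G i)"
  shows "free_product_lift L f (free_product_incl G i x) = f i x"
proof -
  interpret fi: group_hom "G i" L "f i"
    using G[OF i] f[OF i] L by (simp add: group_hom_def group_hom_axioms_def)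
  show ?thesis using x by (simp add: free_product_incl_def)
qed

end

context
  fixes I :: "'i set" and G :: "'i \<Rightarrow> ('a, 'm) monoid_scheme"
  assumes G: "\<And>i. i \<in> I \<Longrightarrow> group (G i)"
begin

lemma free_product_incl_closed:
  "i \<in> I \<Longrightarrow> x \<in> carrier (G i) \<Longrightarrow> free_product_incl G i x \<in> carrier (free_product I G)"
  by (auto simp: free_product_incl_def carrier_free_product reduced_words_def)

lemma free_product_incl_hom:
  assumes i: "i \<in> I"
  shows "free_product_incl G i \<in> hom (G i) (free_product I G)"
proof (rule homI)
  interpret group "G i" using G i by blast
  fix x y assume "x \<in> carrier (G i)" "y \<in> carrier (G i)"
  then show "free_product_incl G i (x \<otimes>\<^bsub>G i\<^esub> y)
      = free_product_incl G i x \<otimes>\<^bsub>free_product I G\<^esub> free_product_incl G i y"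
    by (auto simp: free_product_incl_def mult_free_product)
qed (use free_product_incl_closed i in auto)

lemma free_product_generated:
  "generate (free_product I G) (\<Union>i\<in>I. free_product_incl G i ` carrier (G i)) = carrier (free_product I G)"
    (is "generate ?F ?S = _")
proof
  interpret F: group ?F using group_free_product G by blast
  show "generate ?F ?S \<subseteq> carrier ?F"
    by (rule F.generate_incl) (auto simp: free_product_incl_closed)
  show "carrier ?F \<subseteq> generate ?F ?S"
  proof
    fix w assume "w \<in> carrier ?F"
    then show "w \<in> generate ?F ?S"
    proof (induction w)
      case Nil
      show ?case using generate.one[of ?F] by (simp add: one_free_product)
    next
      case (Cons s w)
      obtain i x where s: "s = (i, x)" by (cases s)
      have w: "w \<in> reduced_words I G" and ix: "i \<in> I" "x \<in> carrier (G i)" "x \<noteq> \<one>\<^bsub>G i\<^esub>"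
        using Cons.prems s reduced_words_Cons[of i x] by (auto simp: carrier_free_product)
      \<comment> \<open>The word is reduced, so multiplying by its own first syllable triggers no
        reduction.\<close>
      have "s # w = free_product_incl G i x \<otimes>\<^bsub>?F\<^esub> w"
        using Cons.prems ix s
        by (cases w) (auto simp: free_product_incl_def mult_free_product carrier_free_product reduced_words_def)
      moreover have "free_product_incl G i x \<in> generate ?F ?S"
        using ix by (intro generate.incl) blast
      ultimately show ?case
        using Cons.IH w by (simp add: generate.eng carrier_free_product)
    qed
  qed
qed

end

lemma free_product_incl_inj: "free_product_incl G i x = free_product_incl G i y \<Longrightarrow> x = y"
  by (auto simp: free_product_incl_def split: if_splits)

section \<open>Internal free products of two subgroups\<close>

lemma is_free_product_of2_altdef:
  "is_free_product_of2 Q H K \<longleftrightarrow> subgroup H Q \<and> subgroup K Q \<and>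
     free_product_lift Q (\<lambda>_ x. x)
       \<in> iso (free_product UNIV (\<lambda>b. Q\<lparr>carrier := if b then K else H\<rparr>)) Q"
proof -
  have "(\<lambda>w. foldr (\<lambda>(i, x) y. x \<otimes>\<^bsub>Q\<^esub> y) w \<one>\<^bsub>Q\<^esub>) = free_product_lift Q (\<lambda>(_ :: bool) x. x)"
    by (simp add: free_product_lift_def fun_eq_iff)
  then show ?thesis
    by (auto simp: is_free_product_of2_def is_free_product_of_def)
qed

text \<open>A homomorphism \<kappa> with the right values on H and K inverts the multiplication map:
  both composites fix generators. No normal forms have to be compared.\<close>

lemma is_free_product_of2I:
  fixes Q :: "('q, 'm) monoid_scheme"
  assumes Q: "group Q" and H: "subgroup H Q" and K: "subgroup K Q"
    and gen: "generate Q (H \<union> K) = carrier Q"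
  defines "FP \<equiv> free_product UNIV (\<lambda>b. Q\<lparr>carrier := if b then K else H\<rparr>)"
  defines "inc \<equiv> free_product_incl (\<lambda>b. Q\<lparr>carrier := if b then K else H\<rparr>)"
  assumes \<kappa>: "\<kappa> \<in> hom Q FP"
    and \<kappa>H: "\<And>x. x \<in> H \<Longrightarrow> \<kappa> x = inc False x" and \<kappa>K: "\<And>x. x \<in> K \<Longrightarrow> \<kappa> x = inc True x"
  shows "is_free_product_of2 Q H K"
proof -
  interpret Q: group Q by fact
  let ?G = "\<lambda>b. Q\<lparr>carrier := if b then K else H\<rparr>"
  have grp: "group (?G b)" for b using H K Q by (simp add: subgroup.subgroup_is_group)
  have FP: "group FP" unfolding FP_def by (rule group_free_product) (use grp in auto)
  let ?c = "free_product_lift Q (\<lambda>(_ :: bool) x. x)"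
  have hom: "(\<lambda>x. x) \<in> hom (?G b) Q" for b
    using subgroup.subset[OF H] subgroup.subset[OF K] by (auto simp: hom_def)
  have c: "?c \<in> hom FP Q"
    unfolding FP_def by (rule free_product_lift_hom) (use grp hom Q in auto)
  have c_inc: "?c (inc b x) = x" if "x \<in> (if b then K else H)" for b x
    unfolding inc_def using free_product_lift_incl[of UNIV ?G Q "\<lambda>_ x. x" b x] grp hom Q that by simp
  have 1: "?c (\<kappa> z) = z" if "z \<in> carrier Q" for z
  proof -
    have "(?c \<circ> \<kappa>) z = id z"
    proof (rule hom_eq_on_generate[OF Q Q, where S = "H \<union> K" and z = z])
      show "?c \<circ> \<kappa> \<in> hom Q Q" using \<kappa> c by (rule hom_compose)
      show "H \<union> K \<subseteq> carrier Q" using subgroup.subset[OF H] subgroup.subset[OF K] by blast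
      show "z \<in> generate Q (H \<union> K)" using gen that by simp
      show "(?c \<circ> \<kappa>) x = id x" if "x \<in> H \<union> K" for x
        using that c_inc[of x False] c_inc[of x True] \<kappa>H \<kappa>K by auto
    qed (simp add: hom_def)
    then show ?thesis by simp
  qed
  have 2: "\<kappa> (?c w) = w" if "w \<in> carrier FP" for w
  proof -
    let ?S = "\<Union>b. inc b ` carrier (?G b)"
    have "(\<kappa> \<circ> ?c) w = id w"
    proof (rule hom_eq_on_generate[OF FP FP, where S = ?S and z = w])
      show "\<kappa> \<circ> ?c \<in> hom FP FP" using c \<kappa> by (rule hom_compose)
      show "w \<in> generate FP ?S"
        using free_product_generated[of UNIV ?G] grp that by (simp add: FP_def inc_def)
      show "?S \<subseteq> carrier FP"
        unfolding FP_def inc_def using free_product_incl_closed[where I = UNIV and G = ?G] grp by blast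
      show "(\<kappa> \<circ> ?c) x = id x" if "x \<in> ?S" for x
        using that c_inc \<kappa>H \<kappa>K by (auto split: if_splits)
    qed (simp add: hom_def)
    then show ?thesis by simp
  qed
  have "bij_betw ?c (carrier FP) (carrier Q)"
    by (rule bij_betw_byWitness[where f' = \<kappa>]) (use 1 2 c \<kappa> in \<open>auto simp: hom_def\<close>)
  then have "?c \<in> iso FP Q" using c by (simp add: iso_def)
  then show ?thesis using H K by (simp add: is_free_product_of2_altdef FP_def)
qed

lemma is_free_product_of2_hom_ex:
  assumes Q: "group Q" and fp: "is_free_product_of2 Q H K" and L: "group L"
    and f: "f \<in> hom (Q\<lparr>carrier := H\<rparr>) L" and g: "g \<in> hom (Q\<lparr>carrier := K\<rparr>) L"
  obtains \<kappa> where "\<kappa> \<in> hom Q L" "\<And>x. x \<in> H \<Longrightarrow> \<kappa> x = f x" "\<And>x. x \<in> K \<Longrightarrow> \<kappa> x = g x"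
proof -
  interpret Q: group Q by fact
  let ?G = "\<lambda>b. Q\<lparr>carrier := if b then K else H\<rparr>"
  let ?FP = "free_product UNIV ?G"
  have H: "subgroup H Q" and K: "subgroup K Q" using fp by (simp_all add: is_free_product_of2_altdef)
  have grp: "group (?G b)" for b using H K Q by (simp add: subgroup.subgroup_is_group)
  have FP: "group ?FP" by (rule group_free_product) (use grp in auto)
  let ?c = "free_product_lift Q (\<lambda>(_ :: bool) x. x)"
  have c: "?c \<in> iso ?FP Q" using fp by (simp add: is_free_product_of2_altdef)
  have ci: "inv_into (carrier ?FP) ?c \<in> hom Q ?FP"
    using group.iso_set_sym[OF FP c] by (simp add: iso_def)
  let ?h = "\<lambda>b. if b then g else f"
  have h: "?h b \<in> hom (?G b) L" for b using f g by simp
  let ?l = "free_product_lift L ?h"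
  have l: "?l \<in> hom ?FP L" by (rule free_product_lift_hom) (use grp h L in auto)
  have hom: "(\<lambda>x. x) \<in> hom (?G b) Q" for b
    using subgroup.subset[OF H] subgroup.subset[OF K] by (auto simp: hom_def)
  have *: "(?l \<circ> inv_into (carrier ?FP) ?c) x = ?h b x" if "x \<in> (if b then K else H)" for b x
  proof -
    have "?c (free_product_incl ?G b x) = x"
      using free_product_lift_incl[of UNIV ?G Q "\<lambda>_ x. x" b x] grp hom Q that by simp
    moreover have "free_product_incl ?G b x \<in> carrier ?FP"
      by (rule free_product_incl_closed) (use grp that in auto)
    ultimately have "inv_into (carrier ?FP) ?c x = free_product_incl ?G b x"
      using c by (metis (no_types, lifting) bij_betw_def inv_into_f_f iso_def mem_Collect_eq)
    then show ?thesis
      using free_product_lift_incl[of UNIV ?G L ?h b x] grp h L that by simp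
  qed
  show ?thesis
  proof
    show "?l \<circ> inv_into (carrier ?FP) ?c \<in> hom Q L" using ci l by (rule hom_compose)
  qed (use *[of _ False] *[of _ True] in auto)
qed

section \<open>Adjoining a variable to a free power\<close>

context
  fixes P :: "('p, 'm) monoid_scheme"
  assumes P: "group P"
begin

lemma group_adjoin_factors: "group (adjoin_factors P b)"
  by (simp add: adjoin_factors_def image_group_iso P)

lemma group_adjoin_var: "group (adjoin_var P)"
  unfolding adjoin_var_def by (rule group_free_product) (rule group_adjoin_factors)

interpretation F: group "adjoin_var P" by (rule group_adjoin_var)

lemma adjoin_coeff_hom: "adjoin_coeff P \<in> hom P (adjoin_var P)"
proof -
  have 1: "(Inl :: 'p \<Rightarrow> 'p + int) \<in> hom P (adjoin_factors P False)"
    using image_group_iso(1)[OF P, of "Inl :: 'p \<Rightarrow> 'p + int"] by (simp add: iso_def adjoin_factors_def)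
  have 2: "free_product_incl (adjoin_factors P) False \<in> hom (adjoin_factors P False) (adjoin_var P)"
    unfolding adjoin_var_def by (rule free_product_incl_hom) (auto simp: group_adjoin_factors)
  show ?thesis using hom_compose[OF 1 2] by (simp add: comp_def adjoin_coeff_def [abs_def])
qed

lemma adjoin_coeff_inj: "inj (adjoin_coeff P)"
  by (rule injI) (auto simp: adjoin_coeff_def dest!: free_product_incl_inj)

lemma var_incl_hom:
  "(\<lambda>k. free_product_incl (adjoin_factors P) True (Inr k)) \<in> hom integer_group (adjoin_var P)"
proof -
  have 1: "(Inr :: int \<Rightarrow> 'p + int) \<in> hom integer_group (adjoin_factors P True)"
    using image_group_iso(1)[of integer_group "Inr :: int \<Rightarrow> 'p + int"] by (simp add: iso_def adjoin_factors_def)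
  have 2: "free_product_incl (adjoin_factors P) True \<in> hom (adjoin_factors P True) (adjoin_var P)"
    unfolding adjoin_var_def by (rule free_product_incl_hom) (auto simp: group_adjoin_factors)
  show ?thesis using hom_compose[OF 1 2] by (simp add: comp_def)
qed

lemma the_var_closed: "the_var P \<in> carrier (adjoin_var P)"
  using hom_in_carrier[OF var_incl_hom, of 1] by (simp add: the_var_def)

lemma adjoin_var_hom_ex:
  assumes L: "group L" and \<phi>: "\<phi> \<in> hom P L" and s: "s \<in> carrier L"
  obtains h where "h \<in> hom (adjoin_var P) L" "\<And>p. p \<in> carrier P \<Longrightarrow> h (adjoin_coeff P p) = \<phi> p"
    "h (the_var P) = s"
proof -
  interpret L: group L by fact
  define f where "f = (\<lambda>(b :: bool) x. case x of Inl p \<Rightarrow> \<phi> p | Inr (k :: int) \<Rightarrow> s [^]\<^bsub>L\<^esub> k)"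
  have f: "f b \<in> hom (adjoin_factors P b) L" for b
  proof (cases b)
    case True
    have "f b \<in> hom (image_group Inr integer_group) L"
      by (rule hom_image_group[where h = "\<lambda>k. s [^]\<^bsub>L\<^esub> k"])
         (use s L.hom_integer_group_pow in \<open>auto simp: f_def\<close>)
    then show ?thesis using True by (simp add: adjoin_factors_def)
  next
    case False
    have "f b \<in> hom (image_group Inl P) L"
      by (rule hom_image_group[where h = \<phi>]) (use P \<phi> in \<open>auto simp: f_def\<close>)
    then show ?thesis using False by (simp add: adjoin_factors_def)
  qed
  have incl: "free_product_lift L f (free_product_incl (adjoin_factors P) b x) = f b x"
    if "x \<in> carrier (adjoin_factors P b)" for b x
    by (rule free_product_lift_incl[of UNIV]) (use that f L group_adjoin_factors in auto)
  show ?thesis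
  proof
    show "free_product_lift L f \<in> hom (adjoin_var P) L"
      unfolding adjoin_var_def by (rule free_product_lift_hom) (use f L group_adjoin_factors in auto)
    show "free_product_lift L f (adjoin_coeff P p) = \<phi> p" if "p \<in> carrier P" for p
      using incl[of "Inl p" False] that
      by (simp add: adjoin_coeff_def adjoin_factors_def image_group_carrier f_def)
    show "free_product_lift L f (the_var P) = s"
      using incl[of "Inr 1" True] s
      by (simp add: the_var_def adjoin_factors_def image_group_carrier f_def)
  qed
qed

lemma hom_lhs:
  assumes w: "equation_over P w" and L: "group L" and h: "h \<in> hom (adjoin_var P) L"
    and h\<phi>: "\<And>p. p \<in> carrier P \<Longrightarrow> h (adjoin_coeff P p) = \<phi> p" and hs: "h (the_var P) = s"
  shows "h (lhs P w) = eval_expr L \<phi> (\<lambda>k :: int. s [^]\<^bsub>L\<^esub> k) w"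
  unfolding lhs_def
proof (rule hom_eval_expr(2)[OF group_adjoin_var L h])
  fix p k assume "(p, k) \<in> set w"
  then have p: "p \<in> carrier P" using w by (auto simp: equation_over_def)
  show "adjoin_coeff P p \<in> carrier (adjoin_var P) \<and>
      the_var P [^]\<^bsub>adjoin_var P\<^esub> k \<in> carrier (adjoin_var P) \<and>
      h (adjoin_coeff P p) = \<phi> p \<and> h (the_var P [^]\<^bsub>adjoin_var P\<^esub> k) = s [^]\<^bsub>L\<^esub> k"
    using hom_in_carrier[OF adjoin_coeff_hom p] the_var_closed h\<phi>[OF p] hs
      hom_int_pow[OF h the_var_closed group_adjoin_var L] by simp
qed

text \<open>Transcendence makes the image of H * <t> a free product of the image of H and <s>. Its
  universal property provides a homomorphism back, with s going to t, and this is a left inverse of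
  h.\<close>

lemma transcendental_hom_inj:
  assumes Q: "group Q" and H: "subgroup H P" and h: "h \<in> hom (adjoin_var P) Q"
    and \<phi>: "\<phi> \<in> mon P Q" and s: "s \<in> carrier Q"
    and h\<phi>: "\<And>p. p \<in> carrier P \<Longrightarrow> h (adjoin_coeff P p) = \<phi> p" and hs: "h (the_var P) = s"
    and tr: "transcendental_over Q (\<phi> ` H) s"
  shows "inj_on h (generate (adjoin_var P) (adjoin_coeff P ` H \<union> {the_var P}))"
proof -
  interpret Q: group Q by fact
  interpret h: group_hom "adjoin_var P" Q h
    using h F.is_group Q by (simp add: group_hom_def group_hom_axioms_def)
  let ?F = "adjoin_var P"
  let ?S = "adjoin_coeff P ` H \<union> {the_var P}"
  let ?R = "generate Q (\<phi> ` H \<union> {s})"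
  have HP: "H \<subseteq> carrier P" by (rule subgroup.subset[OF H])
  have \<phi>': "\<phi> \<in> hom P Q" "inj_on \<phi> (carrier P)" using \<phi> by (auto simp: mon_def)
  have S: "?S \<subseteq> carrier ?F"
    using the_var_closed hom_in_carrier[OF adjoin_coeff_hom] HP by auto
  have S': "\<phi> ` H \<union> {s} \<subseteq> carrier Q" using s HP hom_in_carrier[OF \<phi>'(1)] by auto
  have R: "group (Q\<lparr>carrier := ?R\<rparr>)"
    using Q.generate_is_subgroup[OF S'] Q by (rule subgroup.subgroup_is_group)
  have hS: "h ` ?S = \<phi> ` H \<union> {s}" using h\<phi> hs HP by force
  have hR: "h ` generate ?F ?S = ?R" using h.generate_img[OF S] hS by simp
  have fp: "is_free_product_of2 (Q\<lparr>carrier := ?R\<rparr>) (\<phi> ` H) (generate Q {s})"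
    and ord: "Q.ord s = 0" using tr by (simp_all add: transcendental_over_def)
  let ?f = "adjoin_coeff P \<circ> inv_into (carrier P) \<phi>"
  have inv\<phi>: "inv_into (carrier P) \<phi> (\<phi> x) = x" if "x \<in> H" for x
    using that HP \<phi>'(2) by (auto simp: inv_into_f_f)
  have f: "?f \<in> hom (Q\<lparr>carrier := \<phi> ` H\<rparr>) ?F"
  proof (rule homI)
    fix x y assume "x \<in> carrier (Q\<lparr>carrier := \<phi> ` H\<rparr>)" "y \<in> carrier (Q\<lparr>carrier := \<phi> ` H\<rparr>)"
    then obtain x' y' where xy: "x = \<phi> x'" "y = \<phi> y'" "x' \<in> H" "y' \<in> H" by auto
    then have cl: "x' \<in> carrier P" "y' \<in> carrier P" "x' \<otimes>\<^bsub>P\<^esub> y' \<in> H"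
      using HP subgroup.m_closed[OF H] by auto
    have "x \<otimes>\<^bsub>Q\<^esub> y = \<phi> (x' \<otimes>\<^bsub>P\<^esub> y')" using xy cl hom_mult[OF \<phi>'(1)] by simp
    then show "?f (x \<otimes>\<^bsub>Q\<lparr>carrier := \<phi> ` H\<rparr>\<^esub> y) = ?f x \<otimes>\<^bsub>?F\<^esub> ?f y"
      using xy cl inv\<phi> hom_mult[OF adjoin_coeff_hom] by simp
  qed (use inv\<phi> HP hom_in_carrier[OF adjoin_coeff_hom] in auto)
  \<comment> \<open>The logarithm to base s is well defined because s has infinite order.\<close>
  define lg where "lg x = (SOME k :: int. s [^]\<^bsub>Q\<^esub> k = x)" for x
  have pow_inj: "s [^]\<^bsub>Q\<^esub> k = s [^]\<^bsub>Q\<^esub> l \<Longrightarrow> k = l" for k l :: int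
    using Q.int_pow_eq[OF s] ord by simp
  have lg: "lg (s [^]\<^bsub>Q\<^esub> k) = k" for k
    unfolding lg_def by (rule some_equality) (auto dest: pow_inj)
  let ?g = "\<lambda>x. the_var P [^]\<^bsub>?F\<^esub> lg x"
  have cyc: "generate Q {s} = range (\<lambda>k :: int. s [^]\<^bsub>Q\<^esub> k)" using Q.generate_pow[OF s] by auto
  have g: "?g \<in> hom (Q\<lparr>carrier := generate Q {s}\<rparr>) ?F"
    by (rule homI)
       (use the_var_closed s in \<open>auto simp: cyc lg F.int_pow_mult simp flip: Q.int_pow_mult\<close>)
  obtain \<kappa> where \<kappa>: "\<kappa> \<in> hom (Q\<lparr>carrier := ?R\<rparr>) ?F"
    and \<kappa>f: "\<And>x. x \<in> \<phi> ` H \<Longrightarrow> \<kappa> x = ?f x" and \<kappa>g: "\<And>x. x \<in> generate Q {s} \<Longrightarrow> \<kappa> x = ?g x"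
    by (rule is_free_product_of2_hom_ex[OF R fp group_adjoin_var, of ?f ?g]) (use f g in auto)
  have "(\<kappa> \<circ> h) z = id z" if z: "z \<in> generate ?F ?S" for z
  proof (rule hom_eq_on_generate_subgroup[OF group_adjoin_var group_adjoin_var S _ _ _ z])
    have "h \<in> hom (?F\<lparr>carrier := generate ?F ?S\<rparr>) (Q\<lparr>carrier := ?R\<rparr>)"
      by (rule homI) (use hR F.generate_in_carrier[OF S] in auto)
    then show "\<kappa> \<circ> h \<in> hom (?F\<lparr>carrier := generate ?F ?S\<rparr>) ?F" using \<kappa> by (rule hom_compose)
    show "id \<in> hom (?F\<lparr>carrier := generate ?F ?S\<rparr>) ?F"
      using F.generate_incl[OF S] by (auto simp: hom_def)
    show "(\<kappa> \<circ> h) x = id x" if "x \<in> ?S" for x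
    proof (cases "x = the_var P")
      case True
      have "s \<in> generate Q {s}" by (simp add: generate.incl)
      then show ?thesis using True hs \<kappa>g lg[of 1] s the_var_closed by simp
    next
      case False
      then obtain p where "p \<in> H" "x = adjoin_coeff P p" using \<open>x \<in> ?S\<close> by blast
      then show ?thesis using h\<phi> HP \<kappa>f inv\<phi> by (auto simp: subset_iff)
    qed
  qed
  then show ?thesis by (intro inj_on_inverseI[where g = \<kappa>]) simp
qed

end

section \<open>Subpowers and their extension by the variable\<close>

definition power_coeff where
  "power_coeff I G q g = adjoin_coeff (free_power I G) (free_product_incl (\<lambda>_. G) q g)"

definition subpower where
  "subpower I G S = generate (free_power I G) (\<Union>q\<in>S. free_product_incl (\<lambda>_. G) q ` carrier G)"

text \<open>The free product of the factors in S with <t>, kept as a subgroup of one ambient group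
  so that different sets S can be compared and conjugated into.\<close>

definition subpower_var where
  "subpower_var I G S =
     generate (adjoin_var (free_power I G))
       ((\<Union>q\<in>S. power_coeff I G q ` carrier G) \<union> {the_var (free_power I G)})"

context
  fixes G :: "('a, 'm) monoid_scheme" and I :: "'i set"
  assumes G: "group G"
begin

private abbreviation (input) "P \<equiv> free_power I G"
private abbreviation (input) "F \<equiv> adjoin_var (free_power I G)"

lemma group_free_power: "group P"
  unfolding free_power_def by (rule group_free_product) (rule G)

lemma group_power_var: "group F"
  by (rule group_adjoin_var) (rule group_free_power)

interpretation P: group P by (rule group_free_power)
interpretation F: group F by (rule group_power_var)

lemma power_incl_hom: "q \<in> I \<Longrightarrow> free_product_incl (\<lambda>_. G) q \<in> hom G P"
  unfolding free_power_def using free_product_incl_hom[of I "\<lambda>_. G" q] G by simp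

lemma power_incl_closed:
  "q \<in> I \<Longrightarrow> g \<in> carrier G \<Longrightarrow> free_product_incl (\<lambda>_. G) q g \<in> carrier P"
  by (rule hom_in_carrier[OF power_incl_hom])

lemma power_generated: "subpower I G I = carrier P"
  unfolding free_power_def subpower_def using free_product_generated[of I "\<lambda>_. G"] G by simp

lemma power_coeff_hom: "q \<in> I \<Longrightarrow> power_coeff I G q \<in> hom G F"
  using hom_compose[OF power_incl_hom adjoin_coeff_hom[OF group_free_power]]
  by (simp add: comp_def power_coeff_def [abs_def])

lemma power_coeff_closed: "q \<in> I \<Longrightarrow> g \<in> carrier G \<Longrightarrow> power_coeff I G q g \<in> carrier F"
  by (rule hom_in_carrier[OF power_coeff_hom])

lemma power_var_closed: "the_var P \<in> carrier F"
  by (rule the_var_closed) (rule group_free_power)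

lemma subpower_subgroup: "S \<subseteq> I \<Longrightarrow> subgroup (subpower I G S) P"
  unfolding subpower_def
  by (rule P.generate_is_subgroup) (use power_incl_closed in blast)

lemma subpower_var_gens:
  "S \<subseteq> I \<Longrightarrow> (\<Union>q\<in>S. power_coeff I G q ` carrier G) \<union> {the_var P} \<subseteq> carrier F"
  using power_coeff_closed power_var_closed by blast

lemma subpower_var_subgroup: "S \<subseteq> I \<Longrightarrow> subgroup (subpower_var I G S) F"
  unfolding subpower_var_def by (rule F.generate_is_subgroup) (rule subpower_var_gens)

lemma subpower_var_mono: "S \<subseteq> S' \<Longrightarrow> subpower_var I G S \<subseteq> subpower_var I G S'"
  unfolding subpower_var_def by (rule F.mono_generate) blast

lemma subpower_var_coeff: "q \<in> S \<Longrightarrow> g \<in> carrier G \<Longrightarrow> power_coeff I G q g \<in> subpower_var I G S"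
  and subpower_var_var: "the_var P \<in> subpower_var I G S"
  unfolding subpower_var_def by (auto intro: generate.incl)

lemma power_var_hom_ex:
  assumes L: "group L" and \<phi>: "\<And>q. q \<in> I \<Longrightarrow> \<phi> q \<in> hom G L" and s: "s \<in> carrier L"
  obtains h where "h \<in> hom F L"
    "\<And>q g. q \<in> I \<Longrightarrow> g \<in> carrier G \<Longrightarrow> h (power_coeff I G q g) = \<phi> q g"
    "h (the_var P) = s"
proof -
  have l: "free_product_lift L \<phi> \<in> hom P L"
    unfolding free_power_def by (rule free_product_lift_hom) (use G L \<phi> in auto)
  obtain h where h: "h \<in> hom F L" "h (the_var P) = s"
    "\<And>p. p \<in> carrier P \<Longrightarrow> h (adjoin_coeff P p) = free_product_lift L \<phi> p"
    using adjoin_var_hom_ex[OF group_free_power L l s] by metis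
  have "h (power_coeff I G q g) = \<phi> q g" if qg: "q \<in> I" "g \<in> carrier G" for q g
    using h(3)[OF power_incl_closed[OF qg]]
      free_product_lift_incl[of I "\<lambda>_. G" L \<phi> q g] G L \<phi> qg
    by (simp add: power_coeff_def)
  then show ?thesis using that h by blast
qed

lemma subpower_var_hom_eq:
  assumes "S \<subseteq> I" "group L" "f \<in> hom F L" "f' \<in> hom F L"
    and "\<And>q g. q \<in> S \<Longrightarrow> g \<in> carrier G \<Longrightarrow> f (power_coeff I G q g) = f' (power_coeff I G q g)"
    and "f (the_var P) = f' (the_var P)" and z: "z \<in> subpower_var I G S"
  shows "f z = f' z"
  by (rule hom_eq_on_generate[OF group_power_var assms(2-4) subpower_var_gens[OF assms(1)]])
     (use assms(5,6) z in \<open>auto simp: subpower_var_def\<close>)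

text \<open>The left-hand side is the form in which \<open>magnusian\<close> presents the subgroup,
  with H a whole subpower instead of its generators.\<close>

lemma subpower_var_altdef:
  assumes S: "S \<subseteq> I"
  shows "generate F (adjoin_coeff P ` subpower I G S \<union> {the_var P}) = subpower_var I G S"
    (is "generate F ?A = _")
proof
  let ?S = "\<Union>q\<in>S. free_product_incl (\<lambda>_. G) q ` carrier G"
  interpret c: group_hom P F "adjoin_coeff P"
    using adjoin_coeff_hom[OF group_free_power] group_power_var group_free_power
    by (simp add: group_hom_def group_hom_axioms_def)
  have S': "?S \<subseteq> carrier P" using S power_incl_closed by blast
  have im: "adjoin_coeff P ` ?S = (\<Union>q\<in>S. power_coeff I G q ` carrier G)"
    by (auto simp: power_coeff_def)
  have cA: "adjoin_coeff P ` subpower I G S = generate F (\<Union>q\<in>S. power_coeff I G q ` carrier G)"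
    unfolding subpower_def using c.generate_img[OF S'] im by simp
  have "adjoin_coeff P ` subpower I G S \<subseteq> subpower_var I G S"
    unfolding cA subpower_var_def by (rule F.mono_generate) blast
  then show "generate F ?A \<subseteq> subpower_var I G S"
    using subpower_var_subgroup[OF S] subpower_var_var by (intro F.generate_subgroup_incl) auto
  have "(\<Union>q\<in>S. power_coeff I G q ` carrier G) \<subseteq> adjoin_coeff P ` subpower I G S"
    unfolding cA by (auto intro: generate.incl)
  then show "subpower_var I G S \<subseteq> generate F ?A"
    unfolding subpower_var_def by (intro F.mono_generate) blast
qed

text \<open>The complement is the single factor p, and the inverse of the multiplication map is
  obtained from the universal property of the free power.\<close>

lemma free_factor_subpower:
  assumes p: "p \<in> I"
  shows "free_factor (subpower I G (I - {p})) P"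
proof -
  let ?H = "subpower I G (I - {p})"
  let ?i = "free_product_incl (\<lambda>_. G)"
  let ?K = "?i p ` carrier G"
  let ?G = "\<lambda>b. P\<lparr>carrier := if b then ?K else ?H\<rparr>"
  let ?FP = "free_product UNIV ?G"
  let ?inc = "free_product_incl ?G"
  have H: "subgroup ?H P" by (rule subpower_subgroup) blast
  interpret ip: group_hom G P "?i p"
    using power_incl_hom[OF p] G by (simp add: group_hom_def group_hom_axioms_def P.is_group)
  have K: "subgroup ?K P" by (rule ip.img_is_subgroup)
  have grp: "group (?G b)" for b
    using H K P.is_group by (simp add: subgroup.subgroup_is_group)
  have FP: "group ?FP" by (rule group_free_product) (use grp in auto)
  have inc: "?inc b \<in> hom (?G b) ?FP" for b
    by (rule free_product_incl_hom) (use grp in auto)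
  \<comment> \<open>The truth value of \<open>q = p\<close> selects the side: \<open>True\<close> is
    the index of the second subgroup, here the factor p.\<close>
  define \<phi> where "\<phi> q = ?inc (q = p) \<circ> ?i q" for q
  have mem: "?i q g \<in> (if q = p then ?K else ?H)" if "q \<in> I" "g \<in> carrier G" for q g
    using that by (auto simp: subpower_def intro: generate.incl)
  have \<phi>: "\<phi> q \<in> hom G ?FP" if q: "q \<in> I" for q
  proof -
    have "?i q \<in> hom G (?G (q = p))"
      using power_incl_hom[OF q] mem[OF q] by (auto simp: hom_def)
    then show ?thesis unfolding \<phi>_def using inc by (rule hom_compose)
  qed
  let ?\<kappa> = "free_product_lift ?FP \<phi>"
  have \<kappa>: "?\<kappa> \<in> hom P ?FP"
    unfolding free_power_def[of I G] by (rule free_product_lift_hom) (use G FP \<phi> in \<open>auto simp: free_power_def\<close>)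
  have \<kappa>i: "?\<kappa> (?i q g) = \<phi> q g" if "q \<in> I" "g \<in> carrier G" for q g
    by (rule free_product_lift_incl) (use G FP \<phi> that in auto)
  have "is_free_product_of2 P ?H ?K"
  proof (rule is_free_product_of2I[OF P.is_group H K _ \<kappa>])
    have "carrier P \<subseteq> generate P (?H \<union> ?K)"
      unfolding power_generated[symmetric] subpower_def[of I G I]
    proof (rule P.generate_subgroup_incl)
      show "subgroup (generate P (?H \<union> ?K)) P"
        using H K by (intro P.generate_is_subgroup) (auto dest: subgroup.subset)
      show "(\<Union>q\<in>I. ?i q ` carrier G) \<subseteq> generate P (?H \<union> ?K)"
        using mem by (fastforce intro: generate.incl split: if_splits)
    qed
    then show "generate P (?H \<union> ?K) = carrier P"
      using P.generate_incl[of "?H \<union> ?K"] subgroup.subset[OF H] subgroup.subset[OF K] by blast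
    show "?\<kappa> x = ?inc True x" if "x \<in> ?K" for x
      using that \<kappa>i p by (auto simp: \<phi>_def)
    show "?\<kappa> x = ?inc False x" if x: "x \<in> ?H" for x
    proof (rule hom_eq_on_generate_subgroup[OF P.is_group FP])
      let ?S = "\<Union>q\<in>I - {p}. ?i q ` carrier G"
      show S: "?S \<subseteq> carrier P" using power_incl_closed by blast
      show "x \<in> generate P ?S" using x by (simp add: subpower_def)
      show "?\<kappa> \<in> hom (P\<lparr>carrier := generate P ?S\<rparr>) ?FP"
        using \<kappa> P.generate_incl[OF S] by (rule hom_restrict_carrier)
      show "?inc False \<in> hom (P\<lparr>carrier := generate P ?S\<rparr>) ?FP"
        using inc[of False] by (simp add: subpower_def)
      show "?\<kappa> y = ?inc False y" if y: "y \<in> ?S" for y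
      proof -
        obtain q g where qg: "q \<in> I" "(q = p) = False" "g \<in> carrier G" "y = ?i q g" using y by blast
        then have "?\<kappa> y = \<phi> q g" using \<kappa>i by blast
        then show ?thesis by (simp only: \<phi>_def qg comp_apply)
      qed
    qed
  qed
  then show ?thesis unfolding free_factor_def by blast
qed

text \<open>Restates a magnusian solution as a homomorphism h on P * <t>. Injectivity away from p is
  transcendence; injectivity on each factor, p included, comes from the embedding of P.\<close>

lemma magnusian_hom_ex:
  assumes w: "equation_over P w" "magnusian P w" and p: "p \<in> I"
    and nc: "\<not> conjugate_into F (lhs P w) (subpower_var I G (I - {p}))"
  obtains Q :: "(('i \<times> 'a) list + int) list monoid" and h where
    "group Q" "h \<in> hom F Q" "h (lhs P w) = \<one>\<^bsub>Q\<^esub>" "inj_on h (subpower_var I G (I - {p}))"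
    "\<And>q. q \<in> I \<Longrightarrow> inj_on (\<lambda>g. h (power_coeff I G q g)) (carrier G)"
proof -
  let ?H = "subpower I G (I - {p})"
  have gen: "generate F (adjoin_coeff P ` ?H \<union> {the_var P}) = subpower_var I G (I - {p})"
    by (rule subpower_var_altdef) blast
  then obtain Q :: "(('i \<times> 'a) list + int) list monoid" and \<phi> s where
    sol: "solution_in P w Q \<phi> s" and tr: "transcendental_over Q (\<phi> ` ?H) s"
    using w(2) free_factor_subpower[OF p] nc unfolding magnusian_def by metis
  have Q: "group Q" and \<phi>: "\<phi> \<in> mon P Q" and s: "s \<in> carrier Q"
    and ev: "eval_expr Q \<phi> (\<lambda>k :: int. s [^]\<^bsub>Q\<^esub> k) w = \<one>\<^bsub>Q\<^esub>"
    using sol by (auto simp: solution_in_def)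
  have \<phi>': "\<phi> \<in> hom P Q" "inj_on \<phi> (carrier P)" using \<phi> by (auto simp: mon_def)
  obtain h where h: "h \<in> hom F Q" "h (the_var P) = s"
    "\<And>p. p \<in> carrier P \<Longrightarrow> h (adjoin_coeff P p) = \<phi> p"
    using adjoin_var_hom_ex[OF group_free_power Q \<phi>'(1) s] by metis
  show ?thesis
  proof
    show "h (lhs P w) = \<one>\<^bsub>Q\<^esub>"
      using hom_lhs[OF group_free_power w(1) Q h(1) h(3) h(2)] ev by simp
    show "inj_on h (subpower_var I G (I - {p}))"
      using transcendental_hom_inj[OF group_free_power Q subpower_subgroup[OF Diff_subset] h(1) \<phi> s h(3) h(2) tr]
      by (simp only: gen)
    show "inj_on (\<lambda>g. h (power_coeff I G q g)) (carrier G)" if q: "q \<in> I" for q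
    proof (rule inj_onI)
      fix x y assume xy: "x \<in> carrier G" "y \<in> carrier G" "h (power_coeff I G q x) = h (power_coeff I G q y)"
      have cl: "free_product_incl (\<lambda>_. G) q x \<in> carrier P" "free_product_incl (\<lambda>_. G) q y \<in> carrier P"
        using xy power_incl_closed[OF q] by auto
      then have "\<phi> (free_product_incl (\<lambda>_. G) q x) = \<phi> (free_product_incl (\<lambda>_. G) q y)"
        using xy(3) h(3) by (simp add: power_coeff_def)
      then show "x = y" using \<phi>'(2) cl by (metis inj_onD free_product_incl_inj)
    qed
  qed (use Q h in auto)
qed

end

section \<open>Conjugates in subpowers\<close>

context
  fixes G :: "('a, 'm) monoid_scheme" and I :: "'i set"
  assumes G: "group G"
begin

private abbreviation (input) "V \<equiv> adjoin_var (free_power I G)"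

interpretation V: group V using G by (rule group_power_var)

lemma subpower_var_hom_image:
  assumes "S \<subseteq> I" "group L" "f \<in> hom V L" "subgroup K L"
    and "\<And>q g. q \<in> S \<Longrightarrow> g \<in> carrier G \<Longrightarrow> f (power_coeff I G q g) \<in> K"
    and "f (the_var (free_power I G)) \<in> K" "z \<in> subpower_var I G S"
  shows "f z \<in> K"
  by (rule generate_hom_image[OF V.is_group assms(2,3) subpower_var_gens[OF G assms(1)] assms(4)])
     (use assms(5-) in \<open>auto simp: subpower_var_def\<close>)

text \<open>The retraction \<rho> that kills the factors outside S fixes a conjugate lying over S,
  while it carries everything lying over S' into the part over the intersection. Applied to a
  conjugation into S', it gives one into the intersection.\<close>

lemma conjugate_into_Int:
  assumes S: "S \<subseteq> I" and S': "S' \<subseteq> I" and x: "x \<in> carrier V"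
    and c: "conjugate_into V x (subpower_var I G S)" and c': "conjugate_into V x (subpower_var I G S')"
  shows "conjugate_into V x (subpower_var I G (S \<inter> S'))"
proof -
  have "(\<lambda>g. if q \<in> S then power_coeff I G q g else \<one>\<^bsub>V\<^esub>) \<in> hom G V" if "q \<in> I" for q
    using power_coeff_hom[OF G that] by (auto simp: hom_def)
  then obtain \<rho> where \<rho>: "\<rho> \<in> hom V V" "\<rho> (the_var (free_power I G)) = the_var (free_power I G)"
    "\<And>q g. q \<in> I \<Longrightarrow> g \<in> carrier G \<Longrightarrow> \<rho> (power_coeff I G q g) = (if q \<in> S then power_coeff I G q g else \<one>\<^bsub>V\<^esub>)"
    using power_var_hom_ex[OF G V.is_group _ power_var_closed[OF G],
        where \<phi> = "\<lambda>q g. if q \<in> S then power_coeff I G q g else \<one>\<^bsub>V\<^esub>"] by blast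
  have \<rho>S: "\<rho> z = z" if "z \<in> subpower_var I G S" for z
  proof -
    have "id \<in> hom V V" by (simp add: hom_def)
    moreover have "\<rho> (power_coeff I G q g) = id (power_coeff I G q g)" if "q \<in> S" "g \<in> carrier G" for q g
      using \<rho>(3)[of q g] S that by auto
    ultimately have "\<rho> z = id z"
      by (rule subpower_var_hom_eq[OF G S V.is_group \<rho>(1)]) (use \<rho>(2) that in auto)
    then show ?thesis by simp
  qed
  have SS: "subgroup (subpower_var I G (S \<inter> S')) V" using S by (intro subpower_var_subgroup[OF G]) blast
  have \<rho>S': "\<rho> z \<in> subpower_var I G (S \<inter> S')" if "z \<in> subpower_var I G S'" for z
  proof (rule subpower_var_hom_image[OF S' V.is_group \<rho>(1) SS _ _ that])
    show "\<rho> (power_coeff I G q g) \<in> subpower_var I G (S \<inter> S')" if "q \<in> S'" "g \<in> carrier G" for q g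
      using that \<rho>(3)[of q g] S' subpower_var_coeff[OF G, of q "S \<inter> S'"] subgroup.one_closed[OF SS] by auto
    show "\<rho> (the_var (free_power I G)) \<in> subpower_var I G (S \<inter> S')"
      using \<rho>(2) subpower_var_var[OF G] by simp
  qed
  obtain u where u: "u \<in> carrier V" "u \<otimes>\<^bsub>V\<^esub> x \<otimes>\<^bsub>V\<^esub> inv\<^bsub>V\<^esub> u \<in> subpower_var I G S"
    using c by (auto simp: conjugate_into_def)
  define z where "z = u \<otimes>\<^bsub>V\<^esub> x \<otimes>\<^bsub>V\<^esub> inv\<^bsub>V\<^esub> u"
  have z: "z \<in> carrier V" "z \<in> subpower_var I G S" using u x by (auto simp: z_def)
  have "inv\<^bsub>V\<^esub> u \<otimes>\<^bsub>V\<^esub> z \<otimes>\<^bsub>V\<^esub> inv\<^bsub>V\<^esub> (inv\<^bsub>V\<^esub> u) = x"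
  proof -
    have "inv\<^bsub>V\<^esub> u \<otimes>\<^bsub>V\<^esub> z \<otimes>\<^bsub>V\<^esub> u = (inv\<^bsub>V\<^esub> u \<otimes>\<^bsub>V\<^esub> u) \<otimes>\<^bsub>V\<^esub> x \<otimes>\<^bsub>V\<^esub> (inv\<^bsub>V\<^esub> u \<otimes>\<^bsub>V\<^esub> u)"
      using u(1) x unfolding z_def by (simp only: V.m_assoc V.m_closed V.inv_closed)
    then show ?thesis using u(1) x by simp
  qed
  \<comment> \<open>z is conjugate to x and thus inherits its conjugacy into S'; unlike x, it is
    fixed by \<rho>.\<close>
  then have "conjugate_into V z (subpower_var I G S')"
    using conjugate_into_conj[OF V.is_group z(1), of "inv\<^bsub>V\<^esub> u"] u(1) c' by simp
  then have "conjugate_into V (\<rho> z) (subpower_var I G (S \<inter> S'))"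
    by (rule conjugate_into_hom[OF V.is_group V.is_group \<rho>(1) z(1), rotated])
       (use \<rho>S' subgroup.subset[OF subpower_var_subgroup[OF G S']] in auto)
  then have "conjugate_into V z (subpower_var I G (S \<inter> S'))" using \<rho>S z by simp
  then show ?thesis using conjugate_into_conj[OF V.is_group x u(1)] by (simp add: z_def)
qed

end

section \<open>Coset data of T over the quotient Q\<close>

locale cyclic_extension =
  fixes G :: "('a, 'm) monoid_scheme" and T :: "('t, 'n) monoid_scheme" and Q :: "'i monoid"
    and \<pi> :: "'t \<Rightarrow> 'i" and \<tau> :: "'i \<Rightarrow> 't" and c :: 't
  assumes G: "group G" and T: "group T" and Q: "group Q"
    and \<pi>: "\<pi> \<in> hom T Q"
    and \<tau>: "\<And>q. q \<in> carrier Q \<Longrightarrow> \<tau> q \<in> carrier T \<and> \<pi> (\<tau> q) = q"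
    and c: "c \<in> carrier T" and c_ord: "group.ord T c = 0"
    and ker: "kernel T Q \<pi> = generate T {c}"
begin

sublocale T: group T by (rule T)
sublocale Q: group Q by (rule Q)
sublocale \<pi>: group_hom T Q \<pi> using T Q \<pi> by (simp add: group_hom_def group_hom_axioms_def)

abbreviation "P \<equiv> free_power (carrier Q) G"
abbreviation "F \<equiv> adjoin_var P"
abbreviation "x \<equiv> the_var P"
abbreviation "\<iota> \<equiv> power_coeff (carrier Q) G"
abbreviation "FS \<equiv> subpower_var (carrier Q) G"

sublocale F: group F by (rule group_power_var) (rule G)

lemma x_closed [simp]: "x \<in> carrier F"
  by (rule power_var_closed) (rule G)

lemma \<iota>_closed [simp]: "q \<in> carrier Q \<Longrightarrow> g \<in> carrier G \<Longrightarrow> \<iota> q g \<in> carrier F"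
  by (rule power_coeff_closed) (rule G)

lemma FS_closed: "S \<subseteq> carrier Q \<Longrightarrow> FS S \<subseteq> carrier F"
  using subpower_var_subgroup[OF G] subgroup.subset by blast

lemma c_pow_inj: "c [^]\<^bsub>T\<^esub> (k :: int) = c [^]\<^bsub>T\<^esub> l \<longleftrightarrow> k = l"
  using T.int_pow_eq[OF c, of k l] c_ord by auto

lemma \<pi>_c: "\<pi> c = \<one>\<^bsub>Q\<^esub>"
proof -
  have "c \<in> kernel T Q \<pi>" unfolding ker by (simp add: generate.incl)
  then show ?thesis by (simp add: kernel_def)
qed

lemma same_coset:
  assumes s: "s \<in> carrier T" and s': "s' \<in> carrier T" and eq: "\<pi> s = \<pi> s'"
  shows "\<exists>k :: int. s = c [^]\<^bsub>T\<^esub> k \<otimes>\<^bsub>T\<^esub> s'"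
proof -
  have "s \<otimes>\<^bsub>T\<^esub> inv\<^bsub>T\<^esub> s' \<in> kernel T Q \<pi>" using s s' eq by (simp add: kernel_def)
  then obtain k :: int where "s \<otimes>\<^bsub>T\<^esub> inv\<^bsub>T\<^esub> s' = c [^]\<^bsub>T\<^esub> k"
    unfolding ker using T.generate_pow[OF c] by auto
  then have "s = c [^]\<^bsub>T\<^esub> k \<otimes>\<^bsub>T\<^esub> s'" using s s' c T.inv_solve_right' by simp
  then show ?thesis by blast
qed

text \<open>\<open>\<tau>\<close> is only a set-theoretic section. Right multiplication by s moves
  the coset q to the coset of q and s, and this is the Schreier exponent by which the
  representatives are off. \<open>cocycle_mult\<close> is the cocycle identity for the right action
  of T on Q.\<close>

definition cocycle :: "'i \<Rightarrow> 't \<Rightarrow> int" where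
  "cocycle q s = (SOME k. \<tau> q \<otimes>\<^bsub>T\<^esub> s = c [^]\<^bsub>T\<^esub> k \<otimes>\<^bsub>T\<^esub> \<tau> (q \<otimes>\<^bsub>Q\<^esub> \<pi> s))"

lemma cocycle:
  assumes "q \<in> carrier Q" "s \<in> carrier T"
  shows "\<tau> q \<otimes>\<^bsub>T\<^esub> s = c [^]\<^bsub>T\<^esub> cocycle q s \<otimes>\<^bsub>T\<^esub> \<tau> (q \<otimes>\<^bsub>Q\<^esub> \<pi> s)"
  unfolding cocycle_def by (rule someI_ex, rule same_coset) (use assms \<tau> in auto)

lemma cocycle_unique:
  assumes "q \<in> carrier Q" "s \<in> carrier T"
    and "\<tau> q \<otimes>\<^bsub>T\<^esub> s = c [^]\<^bsub>T\<^esub> k \<otimes>\<^bsub>T\<^esub> \<tau> (q \<otimes>\<^bsub>Q\<^esub> \<pi> s)"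
  shows "cocycle q s = k"
proof -
  have "\<tau> (q \<otimes>\<^bsub>Q\<^esub> \<pi> s) \<in> carrier T" using assms \<tau> by simp
  then show ?thesis using cocycle[OF assms(1,2)] assms(3) c c_pow_inj by simp
qed

lemma cocycle_mult:
  assumes q: "q \<in> carrier Q" and s: "s \<in> carrier T" and s': "s' \<in> carrier T"
  shows "cocycle q (s \<otimes>\<^bsub>T\<^esub> s') = cocycle q s + cocycle (q \<otimes>\<^bsub>Q\<^esub> \<pi> s) s'"
proof (rule cocycle_unique)
  let ?r = "q \<otimes>\<^bsub>Q\<^esub> \<pi> s"
  have r: "?r \<in> carrier Q" "\<tau> ?r \<in> carrier T" "\<tau> q \<in> carrier T"
    "\<tau> (?r \<otimes>\<^bsub>Q\<^esub> \<pi> s') \<in> carrier T" using q s s' \<tau> by auto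
  have "\<tau> q \<otimes>\<^bsub>T\<^esub> (s \<otimes>\<^bsub>T\<^esub> s') = c [^]\<^bsub>T\<^esub> cocycle q s \<otimes>\<^bsub>T\<^esub> (\<tau> ?r \<otimes>\<^bsub>T\<^esub> s')"
    using cocycle[OF q s] r s s' c by (simp flip: T.m_assoc)
  also have "\<dots> = c [^]\<^bsub>T\<^esub> cocycle q s \<otimes>\<^bsub>T\<^esub> (c [^]\<^bsub>T\<^esub> cocycle ?r s' \<otimes>\<^bsub>T\<^esub> \<tau> (?r \<otimes>\<^bsub>Q\<^esub> \<pi> s'))"
    using cocycle[OF r(1) s'] by simp
  also have "\<dots> = c [^]\<^bsub>T\<^esub> (cocycle q s + cocycle ?r s') \<otimes>\<^bsub>T\<^esub> \<tau> (q \<otimes>\<^bsub>Q\<^esub> \<pi> (s \<otimes>\<^bsub>T\<^esub> s'))"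
    using r c q s s' by (simp add: T.int_pow_mult T.m_assoc Q.m_assoc)
  finally show "\<tau> q \<otimes>\<^bsub>T\<^esub> (s \<otimes>\<^bsub>T\<^esub> s') = \<dots>" .
qed (use q s s' in auto)

lemma cocycle_one: "q \<in> carrier Q \<Longrightarrow> cocycle q \<one>\<^bsub>T\<^esub> = 0"
  by (rule cocycle_unique) (use \<tau> in auto)

lemma conj_c: "s \<in> carrier T \<Longrightarrow> \<exists>\<epsilon> :: int. s \<otimes>\<^bsub>T\<^esub> c \<otimes>\<^bsub>T\<^esub> inv\<^bsub>T\<^esub> s = c [^]\<^bsub>T\<^esub> \<epsilon>"
  using same_coset[of "s \<otimes>\<^bsub>T\<^esub> c \<otimes>\<^bsub>T\<^esub> inv\<^bsub>T\<^esub> s" "\<one>\<^bsub>T\<^esub>"] c \<pi>_c by auto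

definition sign :: "'t \<Rightarrow> int" where
  "sign s = (SOME \<epsilon>. s \<otimes>\<^bsub>T\<^esub> c \<otimes>\<^bsub>T\<^esub> inv\<^bsub>T\<^esub> s = c [^]\<^bsub>T\<^esub> \<epsilon>)"

lemma sign: "s \<in> carrier T \<Longrightarrow> s \<otimes>\<^bsub>T\<^esub> c \<otimes>\<^bsub>T\<^esub> inv\<^bsub>T\<^esub> s = c [^]\<^bsub>T\<^esub> sign s"
  unfolding sign_def by (rule someI_ex) (rule conj_c)

lemma conj_c_pow:
  assumes s: "s \<in> carrier T"
  shows "s \<otimes>\<^bsub>T\<^esub> c [^]\<^bsub>T\<^esub> (k :: int) = c [^]\<^bsub>T\<^esub> (sign s * k) \<otimes>\<^bsub>T\<^esub> s"
proof -
  have "s \<otimes>\<^bsub>T\<^esub> c [^]\<^bsub>T\<^esub> k \<otimes>\<^bsub>T\<^esub> inv\<^bsub>T\<^esub> s = c [^]\<^bsub>T\<^esub> (sign s * k)"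
    using T.int_pow_conj[OF c s, of k] sign[OF s] T.int_pow_pow[OF c] by simp
  then show ?thesis using s c by (metis T.inv_closed T.inv_solve_right T.int_pow_closed T.m_closed)
qed

text \<open>Conjugations by s and by its inverse undo each other, so their exponents are integers
  with product 1; infinite order of c is needed to compare exponents.\<close>

lemma abs_sign:
  assumes s: "s \<in> carrier T"
  shows "\<bar>sign s\<bar> = 1"
proof -
  let ?s = "inv\<^bsub>T\<^esub> s"
  have "c = s \<otimes>\<^bsub>T\<^esub> (?s \<otimes>\<^bsub>T\<^esub> c)" using s c by (simp flip: T.m_assoc)
  also have "?s \<otimes>\<^bsub>T\<^esub> c = c [^]\<^bsub>T\<^esub> sign ?s \<otimes>\<^bsub>T\<^esub> ?s" using conj_c_pow[of ?s 1] s c by simp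
  also have "s \<otimes>\<^bsub>T\<^esub> (c [^]\<^bsub>T\<^esub> sign ?s \<otimes>\<^bsub>T\<^esub> ?s) = c [^]\<^bsub>T\<^esub> (sign s * sign ?s)"
    using s c conj_c_pow[OF s, of "sign ?s"] T.m_assoc[of s "c [^]\<^bsub>T\<^esub> sign ?s" ?s]
      T.m_assoc[of "c [^]\<^bsub>T\<^esub> (sign s * sign ?s)" s ?s] by simp
  finally have "sign s * sign ?s = 1" using c_pow_inj[of 1 "sign s * sign ?s"] c by simp
  then show ?thesis using zmult_eq_1_iff by auto
qed

section \<open>The equation over the free power\<close>

text \<open>Schreier rewriting of the expression started at the representative of q: the index is
  the coset reached so far, and each variable leaves only a power of c behind.\<close>

fun power_equation :: "'i \<Rightarrow> ('a \<times> 't) list \<Rightarrow> (('i \<times> 'a) list \<times> int) list" where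
  "power_equation q [] = []"
| "power_equation q ((g, s) # e) =
     (free_product_incl (\<lambda>_. G) q g, cocycle q s) # power_equation (q \<otimes>\<^bsub>Q\<^esub> \<pi> s) e"

definition word :: "'i \<Rightarrow> ('a \<times> 't) list \<Rightarrow> (bool \<times> (('i \<times> 'a) list + int)) list" where
  "word q e = lhs P (power_equation q e)"

lemma word_Nil [simp]: "word q [] = \<one>\<^bsub>F\<^esub>"
  and word_Cons [simp]: "word q ((g, s) # e) = \<iota> q g \<otimes>\<^bsub>F\<^esub> x [^]\<^bsub>F\<^esub> cocycle q s \<otimes>\<^bsub>F\<^esub> word (q \<otimes>\<^bsub>Q\<^esub> \<pi> s) e"
  by (simp_all add: word_def lhs_def eval_expr_def power_coeff_def)

lemma var_prod_simps [simp]: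
  "var_prod T [] = \<one>\<^bsub>T\<^esub>" "var_prod T ((g, s) # e) = s \<otimes>\<^bsub>T\<^esub> var_prod T e"
  by (simp_all add: var_prod_def)

lemma gen_equation_over_Cons [simp]:
  "gen_equation_over G T ((g, s) # e) \<longleftrightarrow> g \<in> carrier G \<and> s \<in> carrier T \<and> gen_equation_over G T e"
  by (auto simp: gen_equation_over_def)

lemma var_prod_closed: "gen_equation_over G T e \<Longrightarrow> var_prod T e \<in> carrier T"
  by (induction e) auto

lemma word_closed: "gen_equation_over G T e \<Longrightarrow> q \<in> carrier Q \<Longrightarrow> word q e \<in> carrier F"
  by (induction e arbitrary: q) auto

lemma equation_over_power_equation:
  "gen_equation_over G T e \<Longrightarrow> q \<in> carrier Q \<Longrightarrow> equation_over P (power_equation q e)"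
proof (induction e arbitrary: q)
  case (Cons a e)
  then have "equation_over P (power_equation (q \<otimes>\<^bsub>Q\<^esub> \<pi> (snd a)) e)" by (cases a) simp
  then show ?case using Cons.prems by (cases a) (auto simp: equation_over_def power_incl_closed G)
qed (simp add: equation_over_def)

lemma sum_power_equation:
  "gen_equation_over G T e \<Longrightarrow> q \<in> carrier Q
    \<Longrightarrow> sum_list (map snd (power_equation q e)) = cocycle q (var_prod T e)"
  by (induction e arbitrary: q) (auto simp: cocycle_one cocycle_mult var_prod_closed)

text \<open>The exponent sum is \<open>cocycle q c\<close>. As c lies in the kernel, this is the
  exponent of c conjugated by \<open>\<tau> q\<close>, which is -1 exactly when the representative
  inverts c.\<close>

lemma unimodular_power_equation:
  assumes "gen_equation_over G T e" "q \<in> carrier Q" "var_prod T e = c"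
  shows "unimodular_equation (power_equation q e)"
proof -
  have "cocycle q c = sign (\<tau> q)"
    by (rule cocycle_unique) (use assms c \<tau> \<pi>_c conj_c_pow[of "\<tau> q" 1] in auto)
  then show ?thesis
    using sum_power_equation[OF assms(1,2)] assms abs_sign \<tau> by (simp add: unimodular_equation_def)
qed

lemma word_finite_support:
  assumes "gen_equation_over G T e" "q \<in> carrier Q"
  shows "\<exists>S. finite S \<and> S \<subseteq> carrier Q \<and> word q e \<in> FS S"
  using assms
proof (induction e arbitrary: q)
  case Nil
  have "\<one>\<^bsub>F\<^esub> \<in> FS {}" by (rule subgroup.one_closed[OF subpower_var_subgroup[OF G]]) simp
  then show ?case by (intro exI[of _ "{}"]) simp
next
  case (Cons a e)
  obtain g s where a: "a = (g, s)" by (cases a)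
  then obtain S where S: "finite S" "S \<subseteq> carrier Q" "word (q \<otimes>\<^bsub>Q\<^esub> \<pi> s) e \<in> FS S"
    using Cons.IH[of "q \<otimes>\<^bsub>Q\<^esub> \<pi> s"] Cons.prems by auto
  have sub: "subgroup (FS (insert q S)) F" using S Cons.prems by (intro subpower_var_subgroup[OF G]) simp
  have "word (q \<otimes>\<^bsub>Q\<^esub> \<pi> s) e \<in> FS (insert q S)"
    using S(3) subpower_var_mono[OF G, of S "insert q S" "carrier Q"] by blast
  moreover have "\<iota> q g \<in> FS (insert q S)" using Cons.prems a by (intro subpower_var_coeff[OF G]) auto
  moreover have "x [^]\<^bsub>F\<^esub> cocycle q s \<in> FS (insert q S)"
    using F.subgroup_int_pow_closed[OF sub] subpower_var_var[OF G] by blast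
  ultimately have "word q (a # e) \<in> FS (insert q S)"
    using a subgroup.m_closed[OF sub] by simp
  then show ?case using S Cons.prems by (intro exI[of _ "insert q S"]) simp
qed

section \<open>Equivariance\<close>

text \<open>If \<open>F\<close> is regarded as the kernel of \<open>G * T \<rightarrow> Q\<close>, with \<open>x\<close> for \<open>c\<close> and \<open>\<iota> q g\<close> for
  \<open>\<tau> q g (\<tau> q)\<inverse>\<close>, then the map \<open>\<alpha>\<close> of the next lemmas is conjugation by \<open>\<sigma>\<close>.\<close>

definition shift_exp :: "'t \<Rightarrow> 'i \<Rightarrow> int" where
  "shift_exp \<sigma> q = (SOME k. \<sigma> \<otimes>\<^bsub>T\<^esub> \<tau> q = c [^]\<^bsub>T\<^esub> k \<otimes>\<^bsub>T\<^esub> \<tau> (\<pi> \<sigma> \<otimes>\<^bsub>Q\<^esub> q))"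

lemma shift_exp:
  assumes "\<sigma> \<in> carrier T" "q \<in> carrier Q"
  shows "\<sigma> \<otimes>\<^bsub>T\<^esub> \<tau> q = c [^]\<^bsub>T\<^esub> shift_exp \<sigma> q \<otimes>\<^bsub>T\<^esub> \<tau> (\<pi> \<sigma> \<otimes>\<^bsub>Q\<^esub> q)"
  unfolding shift_exp_def by (rule someI_ex, rule same_coset) (use assms \<tau> in auto)

text \<open>Compares the two ways of collecting powers of c on the left of \<sigma> (\<tau> q) s:
  starting from \<sigma> (\<tau> q), or from (\<tau> q) s. In the second way the power passes
  \<sigma> and picks up its sign.\<close>

lemma shift_exp_cocycle:
  assumes \<sigma>: "\<sigma> \<in> carrier T" and q: "q \<in> carrier Q" and s: "s \<in> carrier T"
  shows "shift_exp \<sigma> q + cocycle (\<pi> \<sigma> \<otimes>\<^bsub>Q\<^esub> q) s = sign \<sigma> * cocycle q s + shift_exp \<sigma> (q \<otimes>\<^bsub>Q\<^esub> \<pi> s)"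
proof -
  let ?q = "\<pi> \<sigma> \<otimes>\<^bsub>Q\<^esub> q" and ?r = "q \<otimes>\<^bsub>Q\<^esub> \<pi> s" and ?qr = "\<pi> \<sigma> \<otimes>\<^bsub>Q\<^esub> q \<otimes>\<^bsub>Q\<^esub> \<pi> s"
  have mem: "?q \<in> carrier Q" "?r \<in> carrier Q" "?qr \<in> carrier Q" using \<sigma> q s by auto
  note cl = \<tau>[OF q] \<tau>[OF mem(1)] \<tau>[OF mem(2)] \<tau>[OF mem(3)] \<sigma> s c
  have qr: "\<pi> \<sigma> \<otimes>\<^bsub>Q\<^esub> ?r = ?qr" using \<sigma> q s by (simp add: Q.m_assoc)
  have "\<sigma> \<otimes>\<^bsub>T\<^esub> (\<tau> q \<otimes>\<^bsub>T\<^esub> s) = c [^]\<^bsub>T\<^esub> shift_exp \<sigma> q \<otimes>\<^bsub>T\<^esub> (\<tau> ?q \<otimes>\<^bsub>T\<^esub> s)"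
    using shift_exp[OF \<sigma> q] cl by (simp flip: T.m_assoc)
  also have "\<dots> = c [^]\<^bsub>T\<^esub> (shift_exp \<sigma> q + cocycle ?q s) \<otimes>\<^bsub>T\<^esub> \<tau> ?qr"
    using cocycle[OF mem(1) s] cl by (simp add: T.int_pow_mult T.m_assoc)
  finally have 1: "\<sigma> \<otimes>\<^bsub>T\<^esub> (\<tau> q \<otimes>\<^bsub>T\<^esub> s) = \<dots>" .
  have "\<sigma> \<otimes>\<^bsub>T\<^esub> (\<tau> q \<otimes>\<^bsub>T\<^esub> s) = \<sigma> \<otimes>\<^bsub>T\<^esub> c [^]\<^bsub>T\<^esub> cocycle q s \<otimes>\<^bsub>T\<^esub> \<tau> ?r"
    using cocycle[OF q s] cl by (simp add: T.m_assoc)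
  also have "\<dots> = c [^]\<^bsub>T\<^esub> (sign \<sigma> * cocycle q s) \<otimes>\<^bsub>T\<^esub> (\<sigma> \<otimes>\<^bsub>T\<^esub> \<tau> ?r)"
    using conj_c_pow[OF \<sigma>] cl by (simp add: T.m_assoc)
  also have "\<dots> = c [^]\<^bsub>T\<^esub> (sign \<sigma> * cocycle q s + shift_exp \<sigma> ?r) \<otimes>\<^bsub>T\<^esub> \<tau> ?qr"
    using shift_exp[OF \<sigma> mem(2)] cl qr by (simp add: T.int_pow_mult T.m_assoc)
  finally have "c [^]\<^bsub>T\<^esub> (shift_exp \<sigma> q + cocycle ?q s) \<otimes>\<^bsub>T\<^esub> \<tau> ?qr
      = c [^]\<^bsub>T\<^esub> (sign \<sigma> * cocycle q s + shift_exp \<sigma> ?r) \<otimes>\<^bsub>T\<^esub> \<tau> ?qr"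
    using 1 by simp
  then show ?thesis using cl c_pow_inj by (metis T.int_pow_closed T.right_cancel)
qed

lemma shift_hom_ex:
  assumes \<sigma>: "\<sigma> \<in> carrier T"
  obtains \<alpha> where "\<alpha> \<in> hom F F" "\<alpha> x = x [^]\<^bsub>F\<^esub> sign \<sigma>"
    "\<And>q g. q \<in> carrier Q \<Longrightarrow> g \<in> carrier G \<Longrightarrow>
       \<alpha> (\<iota> q g) = x [^]\<^bsub>F\<^esub> shift_exp \<sigma> q \<otimes>\<^bsub>F\<^esub> \<iota> (\<pi> \<sigma> \<otimes>\<^bsub>Q\<^esub> q) g \<otimes>\<^bsub>F\<^esub> inv\<^bsub>F\<^esub> (x [^]\<^bsub>F\<^esub> shift_exp \<sigma> q)"
proof -
  define \<phi> where "\<phi> q g = x [^]\<^bsub>F\<^esub> shift_exp \<sigma> q \<otimes>\<^bsub>F\<^esub> \<iota> (\<pi> \<sigma> \<otimes>\<^bsub>Q\<^esub> q) g \<otimes>\<^bsub>F\<^esub> inv\<^bsub>F\<^esub> (x [^]\<^bsub>F\<^esub> shift_exp \<sigma> q)" for q g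
  have "\<phi> q \<in> hom G F" if q: "q \<in> carrier Q" for q
  proof -
    have q': "\<pi> \<sigma> \<otimes>\<^bsub>Q\<^esub> q \<in> carrier Q" using \<sigma> q by simp
    have conj: "y \<otimes>\<^bsub>F\<^esub> (a \<otimes>\<^bsub>F\<^esub> b) \<otimes>\<^bsub>F\<^esub> inv\<^bsub>F\<^esub> y = y \<otimes>\<^bsub>F\<^esub> a \<otimes>\<^bsub>F\<^esub> inv\<^bsub>F\<^esub> y \<otimes>\<^bsub>F\<^esub> (y \<otimes>\<^bsub>F\<^esub> b \<otimes>\<^bsub>F\<^esub> inv\<^bsub>F\<^esub> y)"
      if "y \<in> carrier F" "a \<in> carrier F" "b \<in> carrier F" for y a b
    proof -
      have "y \<otimes>\<^bsub>F\<^esub> a \<otimes>\<^bsub>F\<^esub> inv\<^bsub>F\<^esub> y \<otimes>\<^bsub>F\<^esub> (y \<otimes>\<^bsub>F\<^esub> b \<otimes>\<^bsub>F\<^esub> inv\<^bsub>F\<^esub> y)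
          = y \<otimes>\<^bsub>F\<^esub> a \<otimes>\<^bsub>F\<^esub> (inv\<^bsub>F\<^esub> y \<otimes>\<^bsub>F\<^esub> y) \<otimes>\<^bsub>F\<^esub> b \<otimes>\<^bsub>F\<^esub> inv\<^bsub>F\<^esub> y"
        using that by (simp only: F.m_assoc F.m_closed F.inv_closed)
      then show ?thesis using that by (simp add: F.m_assoc)
    qed
    show ?thesis
      by (rule homI) (use q' in \<open>auto simp: \<phi>_def hom_mult[OF power_coeff_hom[OF G q']] conj\<close>)
  qed
  then obtain h where h: "h \<in> hom F F"
    "\<And>q g. q \<in> carrier Q \<Longrightarrow> g \<in> carrier G \<Longrightarrow> h (\<iota> q g) = \<phi> q g" "h x = x [^]\<^bsub>F\<^esub> sign \<sigma>"
    using power_var_hom_ex[OF G F.is_group _ F.int_pow_closed[OF x_closed], where \<phi> = \<phi>] by blast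
  show ?thesis by (rule that[OF h(1,3)]) (simp add: h(2) \<phi>_def)
qed

text \<open>The powers of x between consecutive syllables combine by
  \<open>shift_exp_cocycle\<close>, so only the two ends survive. If the product of the variables is
  c, the end exponents agree and the result is a conjugate.\<close>

lemma shift_word:
  assumes e: "gen_equation_over G T e" and \<sigma>: "\<sigma> \<in> carrier T" and q: "q \<in> carrier Q"
    and \<alpha>: "\<alpha> \<in> hom F F" "\<alpha> x = x [^]\<^bsub>F\<^esub> sign \<sigma>"
    "\<And>q g. q \<in> carrier Q \<Longrightarrow> g \<in> carrier G \<Longrightarrow>
       \<alpha> (\<iota> q g) = x [^]\<^bsub>F\<^esub> shift_exp \<sigma> q \<otimes>\<^bsub>F\<^esub> \<iota> (\<pi> \<sigma> \<otimes>\<^bsub>Q\<^esub> q) g \<otimes>\<^bsub>F\<^esub> inv\<^bsub>F\<^esub> (x [^]\<^bsub>F\<^esub> shift_exp \<sigma> q)"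
  shows "\<alpha> (word q e) = x [^]\<^bsub>F\<^esub> shift_exp \<sigma> q \<otimes>\<^bsub>F\<^esub> word (\<pi> \<sigma> \<otimes>\<^bsub>Q\<^esub> q) e
           \<otimes>\<^bsub>F\<^esub> x [^]\<^bsub>F\<^esub> (- shift_exp \<sigma> (q \<otimes>\<^bsub>Q\<^esub> \<pi> (var_prod T e)))"
proof -
  interpret \<alpha>: group_hom F F \<alpha> using \<alpha>(1) F.is_group by (simp add: group_hom_def group_hom_axioms_def)
  show ?thesis
    using e q
  proof (induction e arbitrary: q)
    case Nil
    then show ?case using \<sigma> by (simp add: F.int_pow_neg)
  next
    case (Cons a e)
    obtain g s where a: "a = (g, s)" by (cases a)
    have gs: "g \<in> carrier G" "s \<in> carrier T" "gen_equation_over G T e" using Cons.prems a by auto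
    note q = \<open>q \<in> carrier Q\<close>
    let ?q = "\<pi> \<sigma> \<otimes>\<^bsub>Q\<^esub> q" and ?r = "q \<otimes>\<^bsub>Q\<^esub> \<pi> s" and ?qr = "\<pi> \<sigma> \<otimes>\<^bsub>Q\<^esub> q \<otimes>\<^bsub>Q\<^esub> \<pi> s"
    let ?m = "shift_exp \<sigma> q" and ?n = "shift_exp \<sigma> (?r \<otimes>\<^bsub>Q\<^esub> \<pi> (var_prod T e))"
    let ?k = "cocycle q s" and ?l = "cocycle ?q s" and ?o = "shift_exp \<sigma> ?r"
    have mem: "?q \<in> carrier Q" "?r \<in> carrier Q" "?qr \<in> carrier Q" using \<sigma> q gs by auto
    have qr: "\<pi> \<sigma> \<otimes>\<^bsub>Q\<^esub> ?r = ?qr" using \<sigma> q gs by (simp add: Q.m_assoc)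
    have cl: "word ?r e \<in> carrier F" "word ?qr e \<in> carrier F" "\<iota> ?q g \<in> carrier F" "\<iota> q g \<in> carrier F"
      using word_closed gs mem q by auto
    have exps: "x [^]\<^bsub>F\<^esub> (- ?m) \<otimes>\<^bsub>F\<^esub> (x [^]\<^bsub>F\<^esub> (sign \<sigma> * ?k) \<otimes>\<^bsub>F\<^esub> x [^]\<^bsub>F\<^esub> ?o) = x [^]\<^bsub>F\<^esub> ?l"
    proof -
      have "- ?m + (sign \<sigma> * ?k + ?o) = ?l" using shift_exp_cocycle[OF \<sigma> q gs(2)] by simp
      then show ?thesis by (simp only: F.int_pow_mult[OF x_closed, symmetric])
    qed
    have "\<alpha> (word q (a # e)) = (x [^]\<^bsub>F\<^esub> ?m \<otimes>\<^bsub>F\<^esub> \<iota> ?q g \<otimes>\<^bsub>F\<^esub> x [^]\<^bsub>F\<^esub> (- ?m)) \<otimes>\<^bsub>F\<^esub> x [^]\<^bsub>F\<^esub> (sign \<sigma> * ?k)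
        \<otimes>\<^bsub>F\<^esub> (x [^]\<^bsub>F\<^esub> ?o \<otimes>\<^bsub>F\<^esub> word ?qr e \<otimes>\<^bsub>F\<^esub> x [^]\<^bsub>F\<^esub> (- ?n))"
      using Cons.IH[OF gs(3) mem(2)] a cl \<alpha>(2,3) q gs qr
      by (simp add: \<alpha>.hom_int_pow F.int_pow_pow F.int_pow_neg)
    also have "\<dots> = x [^]\<^bsub>F\<^esub> ?m \<otimes>\<^bsub>F\<^esub> (\<iota> ?q g \<otimes>\<^bsub>F\<^esub> (x [^]\<^bsub>F\<^esub> (- ?m) \<otimes>\<^bsub>F\<^esub> (x [^]\<^bsub>F\<^esub> (sign \<sigma> * ?k)
        \<otimes>\<^bsub>F\<^esub> x [^]\<^bsub>F\<^esub> ?o)) \<otimes>\<^bsub>F\<^esub> word ?qr e) \<otimes>\<^bsub>F\<^esub> x [^]\<^bsub>F\<^esub> (- ?n)"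
      using cl by (simp only: F.m_assoc F.m_closed F.int_pow_closed x_closed)
    also have "\<dots> = x [^]\<^bsub>F\<^esub> ?m \<otimes>\<^bsub>F\<^esub> word ?q (a # e) \<otimes>\<^bsub>F\<^esub> x [^]\<^bsub>F\<^esub> (- ?n)"
      unfolding exps using a by simp
    also have "?r \<otimes>\<^bsub>Q\<^esub> \<pi> (var_prod T e) = q \<otimes>\<^bsub>Q\<^esub> \<pi> (var_prod T (a # e))"
      using a q gs var_prod_closed by (simp add: Q.m_assoc)
    finally show ?case .
  qed
qed

end

text \<open>\<open>unique\<close> is the form of the unique product property used below. It excludes
  only competitors with \<open>y2\<close> other than \<open>y1\<close>, since equal left factors
  force equal right ones. The element y is the translate at which transcendence has to be
  preserved.\<close>

locale cyclic_extension_equation = cyclic_extension G T Q \<pi> \<tau> c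
  for G :: "('a, 'm) monoid_scheme" and T :: "('t, 'n) monoid_scheme" and Q :: "'i monoid"
    and \<pi> :: "'t \<Rightarrow> 'i" and \<tau> :: "'i \<Rightarrow> 't" and c :: 't +
  fixes e :: "('a \<times> 't) list"
  assumes e: "gen_equation_over G T e" and prod_e: "var_prod T e = c"
    and magnus: "\<And>w. equation_over (free_power (carrier Q) G) w \<Longrightarrow> unimodular_equation w
                      \<Longrightarrow> magnusian (free_power (carrier Q) G) w"
    and unique: "\<And>X Y y. finite X \<Longrightarrow> X \<noteq> {} \<Longrightarrow> X \<subseteq> carrier Q \<Longrightarrow> finite Y \<Longrightarrow> Y \<subseteq> carrier Q \<Longrightarrow>
       y \<in> carrier Q \<Longrightarrow> \<not> Y \<subseteq> {y} \<Longrightarrow>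
       \<exists>y1 \<in> Y - {y}. \<exists>x1 \<in> X. \<forall>y2 \<in> insert y Y - {y1}. \<forall>x2 \<in> X. y1 \<otimes>\<^bsub>Q\<^esub> x1 \<noteq> y2 \<otimes>\<^bsub>Q\<^esub> x2"
begin

section \<open>Minimal supports of the translates\<close>

abbreviation "W q \<equiv> word q e"

lemma W_closed [simp]: "q \<in> carrier Q \<Longrightarrow> W q \<in> carrier F"
  using word_closed e by simp

abbreviation conj_into :: "'i \<Rightarrow> 'i set \<Rightarrow> bool" where
  "conj_into q S \<equiv> conjugate_into F (W q) (FS S)"

text \<open>Conjugation by \<open>\<tau> r\<close> permutes the factors by left translation up to
  powers of x. These powers lie over every index set, so they do not enlarge the support.\<close>

lemma conj_into_shift:
  assumes r: "r \<in> carrier Q" and q: "q \<in> carrier Q" and S: "S \<subseteq> carrier Q" and "conj_into q S"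
  shows "conj_into (r \<otimes>\<^bsub>Q\<^esub> q) ((\<lambda>p. r \<otimes>\<^bsub>Q\<^esub> p) ` S)"
proof -
  let ?S = "(\<lambda>p. r \<otimes>\<^bsub>Q\<^esub> p) ` S" and ?\<sigma> = "\<tau> r"
  have \<sigma>: "?\<sigma> \<in> carrier T" "\<pi> ?\<sigma> = r" using \<tau>[OF r] by auto
  obtain \<alpha> where \<alpha>: "\<alpha> \<in> hom F F" "\<alpha> x = x [^]\<^bsub>F\<^esub> sign ?\<sigma>"
    "\<And>q g. q \<in> carrier Q \<Longrightarrow> g \<in> carrier G \<Longrightarrow>
       \<alpha> (\<iota> q g) = x [^]\<^bsub>F\<^esub> shift_exp ?\<sigma> q \<otimes>\<^bsub>F\<^esub> \<iota> (\<pi> ?\<sigma> \<otimes>\<^bsub>Q\<^esub> q) g \<otimes>\<^bsub>F\<^esub> inv\<^bsub>F\<^esub> (x [^]\<^bsub>F\<^esub> shift_exp ?\<sigma> q)"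
    using shift_hom_ex[OF \<sigma>(1)] by metis
  have S': "?S \<subseteq> carrier Q" using r S by auto
  have sub: "subgroup (FS ?S) F" by (rule subpower_var_subgroup[OF G S'])
  have xp: "x [^]\<^bsub>F\<^esub> (k :: int) \<in> FS ?S" for k
    using F.subgroup_int_pow_closed[OF sub] subpower_var_var[OF G] by blast
  have im: "\<alpha> z \<in> FS ?S" if z: "z \<in> FS S" for z
  proof (rule subpower_var_hom_image[OF G S F.is_group \<alpha>(1) sub _ _ z])
    fix q g assume q: "q \<in> S" and g: "g \<in> carrier G"
    have "\<iota> (r \<otimes>\<^bsub>Q\<^esub> q) g \<in> FS ?S" using q g by (intro subpower_var_coeff[OF G]) auto
    then show "\<alpha> (\<iota> q g) \<in> FS ?S"
      using \<alpha>(3)[of q g] q g S \<sigma>(2) xp subgroup.m_inv_closed[OF sub] subgroup.m_closed[OF sub] by auto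
  qed (use \<alpha>(2) xp in simp)
  have "conjugate_into F (\<alpha> (W q)) (FS ?S)"
    by (rule conjugate_into_hom[OF F.is_group F.is_group \<alpha>(1) _ FS_closed[OF S] assms(4)])
       (use q im in auto)
  moreover have "\<alpha> (W q) = x [^]\<^bsub>F\<^esub> shift_exp ?\<sigma> q \<otimes>\<^bsub>F\<^esub> W (r \<otimes>\<^bsub>Q\<^esub> q) \<otimes>\<^bsub>F\<^esub> inv\<^bsub>F\<^esub> (x [^]\<^bsub>F\<^esub> shift_exp ?\<sigma> q)"
    using shift_word[OF e \<sigma>(1) q \<alpha>] \<sigma>(2) q by (simp add: prod_e \<pi>_c F.int_pow_neg)
  ultimately show ?thesis
    using conjugate_into_conj[OF F.is_group, of "W (r \<otimes>\<^bsub>Q\<^esub> q)" "x [^]\<^bsub>F\<^esub> shift_exp ?\<sigma> q"] r q by simp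
qed

text \<open>The minimal support of \<open>W q\<close> up to conjugation: by \<open>conjugate_into_Int\<close>, the factors that can be
  avoided one at a time can be avoided simultaneously.\<close>

definition ess :: "'i \<Rightarrow> 'i set" where
  "ess q = {p \<in> carrier Q. \<not> conj_into q (carrier Q - {p})}"

lemma ess_closed: "ess q \<subseteq> carrier Q"
  by (auto simp: ess_def)

text \<open>If the translated index could be avoided by the translated word, translating back by the
  inverse of r would avoid p.\<close>

lemma ess_shift_subset:
  assumes r: "r \<in> carrier Q" and q: "q \<in> carrier Q"
  shows "(\<lambda>p. r \<otimes>\<^bsub>Q\<^esub> p) ` ess q \<subseteq> ess (r \<otimes>\<^bsub>Q\<^esub> q)"
proof (rule image_subsetI, rule ccontr)
  fix p assume "p \<in> ess q" and "r \<otimes>\<^bsub>Q\<^esub> p \<notin> ess (r \<otimes>\<^bsub>Q\<^esub> q)"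
  then have p: "p \<in> carrier Q" and np: "\<not> conj_into q (carrier Q - {p})"
    and c: "conj_into (r \<otimes>\<^bsub>Q\<^esub> q) (carrier Q - {r \<otimes>\<^bsub>Q\<^esub> p})"
    using r by (auto simp: ess_def)
  let ?i = "inv\<^bsub>Q\<^esub> r"
  have "conj_into (?i \<otimes>\<^bsub>Q\<^esub> (r \<otimes>\<^bsub>Q\<^esub> q)) ((\<lambda>p. ?i \<otimes>\<^bsub>Q\<^esub> p) ` (carrier Q - {r \<otimes>\<^bsub>Q\<^esub> p}))"
    by (rule conj_into_shift) (use r q c in auto)
  moreover have "?i \<otimes>\<^bsub>Q\<^esub> (r \<otimes>\<^bsub>Q\<^esub> q) = q" using r q by (simp flip: Q.m_assoc)
  moreover have "(\<lambda>p. ?i \<otimes>\<^bsub>Q\<^esub> p) ` (carrier Q - {r \<otimes>\<^bsub>Q\<^esub> p}) \<subseteq> carrier Q - {p}"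
  proof (rule image_subsetI)
    fix a assume "a \<in> carrier Q - {r \<otimes>\<^bsub>Q\<^esub> p}"
    then show "?i \<otimes>\<^bsub>Q\<^esub> a \<in> carrier Q - {p}" using r p Q.inv_solve_left' by auto
  qed
  ultimately have "conj_into q (carrier Q - {p})"
    using conjugate_into_mono[OF _ subpower_var_mono[OF G]] by simp
  then show False using np by simp
qed

lemma ess_shift:
  assumes q: "q \<in> carrier Q"
  shows "ess q = (\<lambda>p. q \<otimes>\<^bsub>Q\<^esub> p) ` ess \<one>\<^bsub>Q\<^esub>"
proof
  show "(\<lambda>p. q \<otimes>\<^bsub>Q\<^esub> p) ` ess \<one>\<^bsub>Q\<^esub> \<subseteq> ess q" using ess_shift_subset[OF q Q.one_closed] q by simp
  show "ess q \<subseteq> (\<lambda>p. q \<otimes>\<^bsub>Q\<^esub> p) ` ess \<one>\<^bsub>Q\<^esub>"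
  proof
    fix p assume p: "p \<in> ess q"
    then have "p \<in> carrier Q" using ess_closed by blast
    then have "p = q \<otimes>\<^bsub>Q\<^esub> (inv\<^bsub>Q\<^esub> q \<otimes>\<^bsub>Q\<^esub> p)" using q by (simp flip: Q.m_assoc)
    moreover have "inv\<^bsub>Q\<^esub> q \<otimes>\<^bsub>Q\<^esub> p \<in> ess \<one>\<^bsub>Q\<^esub>"
      using ess_shift_subset[of "inv\<^bsub>Q\<^esub> q" q] p q by auto
    ultimately show "p \<in> (\<lambda>p. q \<otimes>\<^bsub>Q\<^esub> p) ` ess \<one>\<^bsub>Q\<^esub>" by blast
  qed
qed

lemma conj_into_self: "q \<in> carrier Q \<Longrightarrow> W q \<in> FS S \<Longrightarrow> conj_into q S"
  unfolding conjugate_into_def by (rule bexI[of _ "\<one>\<^bsub>F\<^esub>"]) auto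

lemma finite_ess:
  assumes q: "q \<in> carrier Q"
  shows "finite (ess q)" and "conj_into q (ess q)"
proof -
  obtain S where S: "finite S" "S \<subseteq> carrier Q" "W q \<in> FS S"
    using word_finite_support[OF e q] by blast
  have "p \<in> S" if "p \<in> ess q" for p
  proof (rule ccontr)
    assume "p \<notin> S"
    then have "W q \<in> FS (carrier Q - {p})"
      using S subpower_var_mono[OF G, of S "carrier Q - {p}" "carrier Q"] by blast
    then have "conj_into q (carrier Q - {p})" by (rule conj_into_self[OF q])
    then show False using \<open>p \<in> ess q\<close> by (simp add: ess_def)
  qed
  then show "finite (ess q)" by (intro finite_subset[OF _ S(1)] subsetI)
  \<comment> \<open>Intersections are available only two at a time, so inessential indices are
    dropped one by one from a finite support.\<close>
  have "conj_into q (S - A)" if "finite A" "A \<subseteq> S - ess q" for A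
    using that
  proof (induction A)
    case empty
    then show ?case using conj_into_self[OF q S(3)] by simp
  next
    case (insert a A)
    then have "conj_into q (S - A)" "conj_into q (carrier Q - {a})" using S(2) by (auto simp: ess_def)
    then have "conj_into q ((S - A) \<inter> (carrier Q - {a}))"
      by (intro conjugate_into_Int[OF G]) (use S(2) q in auto)
    moreover have "(S - A) \<inter> (carrier Q - {a}) = S - insert a A" using S(2) by auto
    ultimately show ?case by simp
  qed
  then have "conj_into q (S - (S - ess q))" using S(1) by blast
  then show "conj_into q (ess q)"
    by (rule conjugate_into_mono) (auto intro!: subpower_var_mono[OF G])
qed

text \<open>\<open>W q\<close> itself may involve factors outside \<open>ess q\<close>. This
  conjugate does not, and by \<open>hom_core_one_iff\<close> the same homomorphisms kill it.\<close>

definition core :: "'i \<Rightarrow> (bool \<times> (('i \<times> 'a) list + int)) list" where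
  "core q = (SOME z. z \<in> FS (ess q) \<and> (\<exists>u \<in> carrier F. z = u \<otimes>\<^bsub>F\<^esub> W q \<otimes>\<^bsub>F\<^esub> inv\<^bsub>F\<^esub> u))"

lemma core:
  assumes q: "q \<in> carrier Q"
  shows "core q \<in> FS (ess q)" "\<exists>u \<in> carrier F. core q = u \<otimes>\<^bsub>F\<^esub> W q \<otimes>\<^bsub>F\<^esub> inv\<^bsub>F\<^esub> u"
proof -
  have "\<exists>z. z \<in> FS (ess q) \<and> (\<exists>u \<in> carrier F. z = u \<otimes>\<^bsub>F\<^esub> W q \<otimes>\<^bsub>F\<^esub> inv\<^bsub>F\<^esub> u)"
    using finite_ess(2)[OF q] unfolding conjugate_into_def by blast
  from someI_ex[OF this] show "core q \<in> FS (ess q)" "\<exists>u \<in> carrier F. core q = u \<otimes>\<^bsub>F\<^esub> W q \<otimes>\<^bsub>F\<^esub> inv\<^bsub>F\<^esub> u"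
    by (simp_all add: core_def)
qed

lemma hom_core_one_iff:
  assumes q: "q \<in> carrier Q" and L: "group L" and h: "h \<in> hom F L"
  shows "h (core q) = \<one>\<^bsub>L\<^esub> \<longleftrightarrow> h (W q) = \<one>\<^bsub>L\<^esub>"
proof -
  interpret h: group_hom F L h using L h F.is_group by (simp add: group_hom_def group_hom_axioms_def)
  obtain u where u: "u \<in> carrier F" "core q = u \<otimes>\<^bsub>F\<^esub> W q \<otimes>\<^bsub>F\<^esub> inv\<^bsub>F\<^esub> u" using core[OF q] by blast
  then have "h (core q) = h u \<otimes>\<^bsub>L\<^esub> h (W q) \<otimes>\<^bsub>L\<^esub> inv\<^bsub>L\<^esub> h u" using q by simp
  then show ?thesis
    using u(1) q by (auto simp: h.H.inv_solve_right' h.H.r_cancel_one)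
qed

section \<open>Amalgamating the solutions of finitely many translates\<close>

abbreviation "NC Y \<equiv> normal_closure F (W ` Y)"

lemma W_image_closed: "Y \<subseteq> carrier Q \<Longrightarrow> W ` Y \<subseteq> carrier F"
  by auto

text \<open>For a subgroup S this says that S embeds in the quotient by \<open>NC Y\<close>. With
  \<open>FS\<close> of an index set as S, it says that x becomes a solution transcendental over
  those factors.\<close>

definition trivial_on :: "'i set \<Rightarrow> (bool \<times> (('i \<times> 'a) list + int)) list set \<Rightarrow> bool" where
  "trivial_on Y S \<longleftrightarrow> NC Y \<inter> S \<subseteq> {\<one>\<^bsub>F\<^esub>}"

text \<open>The quotient by \<open>NC Y\<close> and the overgroup with a solution of \<open>W y\<close> that is transcendental over the
  factors other than \<open>p\<close> are amalgamated over \<open>FS J\<close>. The factor \<open>p\<close> is mapped through the second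
  group, all other factors through the first.\<close>

lemma amalgamation_step:
  assumes Y: "Y \<subseteq> carrier Q" and y: "y \<in> carrier Q" and p: "p \<in> ess y"
    and pY: "\<And>y'. y' \<in> Y \<Longrightarrow> p \<notin> ess y'"
    and triv: "trivial_on Y (FS (ess y \<union> (carrier Q - \<Union> (ess ` Y))))"
  shows "S \<subseteq> carrier Q - {p} \<Longrightarrow> trivial_on Y (FS S) \<Longrightarrow> trivial_on (insert y Y) (FS S)"
    and "(\<And>q. q \<in> carrier Q \<Longrightarrow> trivial_on Y (\<iota> q ` carrier G)) \<Longrightarrow> q \<in> carrier Q \<Longrightarrow>
         trivial_on (insert y Y) (\<iota> q ` carrier G)"
proof -
  \<comment> \<open>Both maps are injective over J: the quotient map by \<open>triv\<close>, the
    magnusian one because p is left out. Restoring p gives a set that contains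
    \<open>ess y\<close>.\<close>
  define J where "J = (ess y \<union> (carrier Q - \<Union> (ess ` Y))) - {p}"
  have J: "J \<subseteq> carrier Q" using ess_closed by (auto simp: J_def)
  have pQ: "p \<in> carrier Q" using p ess_closed by blast
  let ?N = "NC Y"
  have N: "?N \<lhd> F" by (rule F.normal_closure_normal[OF W_image_closed[OF Y]])
  interpret N: normal ?N F by (rule N)
  let ?A = "F Mod ?N" and ?f = "\<lambda>z. ?N #>\<^bsub>F\<^esub> z"
  have A: "group ?A" by (rule N.factorgroup_is_group)
  have f: "?f \<in> hom F ?A" by (rule N.r_coset_hom_Mod)
  have f_one: "?f z = \<one>\<^bsub>?A\<^esub> \<longleftrightarrow> z \<in> ?N" if "z \<in> carrier F" for z
    using that N.rcos_const F.coset_join1[of ?N z] N.subset N.is_subgroup by auto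
  \<comment> \<open>That p is essential for y is precisely the condition under which
    \<open>magnusian\<close> grants transcendence over the other factors.\<close>
  have nc: "\<not> conjugate_into F (lhs P (power_equation y e)) (FS (carrier Q - {p}))"
    using p by (simp add: ess_def word_def)
  have eq: "equation_over P (power_equation y e)" by (rule equation_over_power_equation[OF e y])
  obtain B :: "(('i \<times> 'a) list + int) list monoid" and g where
    B: "group B" and g: "g \<in> hom F B" and gW: "g (W y) = \<one>\<^bsub>B\<^esub>" and g_inj: "inj_on g (FS (carrier Q - {p}))"
    and g\<iota>: "\<And>q. q \<in> carrier Q \<Longrightarrow> inj_on (\<lambda>a. g (\<iota> q a)) (carrier G)"
    by (rule magnusian_hom_ex[OF G eq magnus[OF eq unimodular_power_equation[OF e y prod_e]] pQ nc])
       (use word_def in simp)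
  interpret g: group_hom F B g using B g F.is_group by (simp add: group_hom_def group_hom_axioms_def)
  interpret f: group_hom F ?A ?f using A f F.is_group by (simp add: group_hom_def group_hom_axioms_def)
  let ?C = "F\<lparr>carrier := FS J\<rparr>"
  have FJ: "subgroup (FS J) F" by (rule subpower_var_subgroup[OF G J])
  then have C: "group ?C" using F.is_group by (rule subgroup.subgroup_is_group)
  have fC: "?f \<in> mon ?C ?A"
    unfolding mon_iff_hom_one[OF C A]
  proof (intro conjI allI impI)
    show "?f \<in> hom ?C ?A" by (rule hom_restrict_carrier[OF f FS_closed[OF J]])
    fix z assume z: "z \<in> carrier ?C \<and> ?f z = \<one>\<^bsub>?A\<^esub>"
    then have "z \<in> ?N" "z \<in> FS (ess y \<union> (carrier Q - \<Union> (ess ` Y)))"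
      using f_one FS_closed[OF J] subpower_var_mono[OF G, of J "ess y \<union> (carrier Q - \<Union> (ess ` Y))" "carrier Q"]
      by (auto simp: J_def)
    then show "z = \<one>\<^bsub>?C\<^esub>" using triv by (auto simp: trivial_on_def)
  qed
  have gC: "g \<in> mon ?C B"
    unfolding mon_def using hom_restrict_carrier[OF g FS_closed[OF J]] g_inj
      subpower_var_mono[OF G, of J "carrier Q - {p}" "carrier Q"] J
    by (auto simp: J_def intro: inj_on_subset)
  let ?M = "BijGroup (carrier ?A \<times> carrier B)"
  have M: "group ?M" by (rule group_BijGroup)
  obtain i j where i: "i \<in> mon ?A ?M" and j: "j \<in> mon B ?M"
    and ij: "\<And>z. z \<in> carrier ?C \<Longrightarrow> i (?f z) = j (g z)"
    using common_permutation_group[OF A B C fC gC] by blast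
  have i': "i \<in> hom ?A ?M" "inj_on i (carrier ?A)" and j': "j \<in> hom B ?M" "inj_on j (carrier B)"
    using i j by (auto simp: mon_def)
  interpret i: group_hom ?A ?M i using A M i' by (simp add: group_hom_def group_hom_axioms_def)
  interpret j: group_hom B ?M j using B M j' by (simp add: group_hom_def group_hom_axioms_def)
  have ih: "i \<circ> ?f \<in> hom F ?M" using f i'(1) by (rule hom_compose)
  have jh: "j \<circ> g \<in> hom F ?M" using g j'(1) by (rule hom_compose)
  define \<phi> where "\<phi> q = (if q = p then (j \<circ> g) \<circ> \<iota> q else (i \<circ> ?f) \<circ> \<iota> q)" for q
  have "\<phi> q \<in> hom G ?M" if "q \<in> carrier Q" for q
    unfolding \<phi>_def using hom_compose[OF power_coeff_hom[OF G that] ih] hom_compose[OF power_coeff_hom[OF G that] jh]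
    by (cases "q = p") simp_all
  moreover have "(i \<circ> ?f) x \<in> carrier ?M" using ih x_closed by (rule hom_in_carrier)
  ultimately obtain h where h: "h \<in> hom F ?M"
    "\<And>q a. q \<in> carrier Q \<Longrightarrow> a \<in> carrier G \<Longrightarrow> h (\<iota> q a) = \<phi> q a" "h x = (i \<circ> ?f) x"
    using power_var_hom_ex[OF G M, where \<phi> = \<phi> and s = "(i \<circ> ?f) x"] by blast
  have h_i: "h z = (i \<circ> ?f) z" if "z \<in> FS (carrier Q - {p})" for z
    by (rule subpower_var_hom_eq[OF G _ M h(1) ih _ h(3) that]) (auto simp: h(2) \<phi>_def)
  have xJ: "x \<in> FS J" by (rule subpower_var_var[OF G])
  \<comment> \<open>On the factors in J and on x the two composites agree by amalgamation, so h,
    defined there by the first, is also given by the second.\<close>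
  have h_j: "h z = (j \<circ> g) z" if "z \<in> FS (insert p J)" for z
  proof (rule subpower_var_hom_eq[OF G _ M h(1) jh _ _ that])
    show "insert p J \<subseteq> carrier Q" using J pQ by simp
    show "h x = (j \<circ> g) x" using h(3) ij xJ by simp
    show "h (\<iota> q a) = (j \<circ> g) (\<iota> q a)" if qa: "q \<in> insert p J" "a \<in> carrier G" for q a
    proof (cases "q = p")
      case True
      then show ?thesis using h(2) pQ qa by (simp add: \<phi>_def)
    next
      case False
      then have "q \<in> J" using qa by simp
      then have "\<iota> q a \<in> FS J" using qa by (intro subpower_var_coeff[OF G])
      then show ?thesis using False h(2)[of q a] \<open>q \<in> J\<close> J qa ij by (auto simp: \<phi>_def)
    qed
  qed
  \<comment> \<open>Each relator is tested on its core: for y' in Y it avoids p and is seen by the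
    first group; for y it lies over J with p added and is seen by the second.\<close>
  have hY: "h (W y') = \<one>\<^bsub>?M\<^esub>" if y': "y' \<in> Y" for y'
  proof -
    have y'Q: "y' \<in> carrier Q" using y' Y by blast
    have "W y' \<in> ?N" using F.normal_closure_incl[OF W_image_closed[OF Y]] y' by blast
    then have "?f (W y') = \<one>\<^bsub>?A\<^esub>" using f_one y'Q by simp
    then have "(i \<circ> ?f) (core y') = \<one>\<^bsub>?M\<^esub>" using hom_core_one_iff[OF y'Q A f] by (simp del: one_FactGroup)
    moreover have "core y' \<in> FS (carrier Q - {p})"
      using core(1)[OF y'Q] subpower_var_mono[OF G, of "ess y'" "carrier Q - {p}" "carrier Q"]
        pY[OF y'] ess_closed[of y'] by blast
    ultimately show ?thesis using h_i hom_core_one_iff[OF y'Q M h(1)] by simp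
  qed
  have hy: "h (W y) = \<one>\<^bsub>?M\<^esub>"
  proof -
    have "(j \<circ> g) (core y) = \<one>\<^bsub>?M\<^esub>" using hom_core_one_iff[OF y B g] gW by simp
    moreover have "core y \<in> FS (insert p J)"
      using core(1)[OF y] subpower_var_mono[OF G, of "ess y" "insert p J" "carrier Q"] by (auto simp: J_def)
    ultimately show ?thesis using h_j hom_core_one_iff[OF y M h(1)] by simp
  qed
  have hN: "h z = \<one>\<^bsub>?M\<^esub>" if "z \<in> NC (insert y Y)" for z
    by (rule F.normal_closure_hom_one[OF W_image_closed M h(1) _ that]) (use Y y hY hy in auto)
  \<comment> \<open>Away from p, h is the quotient map followed by an injection, so the new relator
    kills nothing there that \<open>NC Y\<close> had not killed.\<close>
  have in_N: "z \<in> ?N" if z: "z \<in> NC (insert y Y)" "z \<in> FS (carrier Q - {p})" for z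
  proof -
    have zF: "z \<in> carrier F" using FS_closed[of "carrier Q - {p}"] z(2) by blast
    have "i (?f z) = i \<one>\<^bsub>?A\<^esub>" using hN[OF z(1)] h_i[OF z(2)] by (simp del: one_FactGroup)
    then have "?f z = \<one>\<^bsub>?A\<^esub>" by (rule inj_onD[OF i'(2) _ f.hom_closed[OF zF] f.H.one_closed])
    then show ?thesis using f_one zF by simp
  qed
  show "trivial_on (insert y Y) (FS S)" if S: "S \<subseteq> carrier Q - {p}" "trivial_on Y (FS S)"
    using in_N subpower_var_mono[OF G S(1), of "carrier Q"] S(2) unfolding trivial_on_def by blast
  show "trivial_on (insert y Y) (\<iota> q ` carrier G)"
    if *: "\<And>q. q \<in> carrier Q \<Longrightarrow> trivial_on Y (\<iota> q ` carrier G)" and q: "q \<in> carrier Q"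
  proof (cases "q = p")
    case True
    \<comment> \<open>The factor p is seen only through g, where it survives because P embeds in the
      group of the solution.\<close>
    have "\<iota> p a = \<one>\<^bsub>F\<^esub>" if a: "a \<in> carrier G" "\<iota> p a \<in> NC (insert y Y)" for a
    proof -
      interpret \<iota>p: group_hom G F "\<iota> p"
        using power_coeff_hom[OF G pQ] G F.is_group by (simp add: group_hom_def group_hom_axioms_def)
      have "j (g (\<iota> p a)) = j \<one>\<^bsub>B\<^esub>" using hN[OF a(2)] h(2)[OF pQ a(1)] by (simp add: \<phi>_def)
      then have "g (\<iota> p a) = \<one>\<^bsub>B\<^esub>" by (rule inj_onD[OF j'(2) _ g.hom_closed[OF \<iota>_closed[OF pQ a(1)]] g.H.one_closed])
      also have "\<dots> = g (\<iota> p \<one>\<^bsub>G\<^esub>)" by simp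
      finally have "a = \<one>\<^bsub>G\<^esub>" by (rule inj_onD[OF g\<iota>[OF pQ] _ a(1) \<iota>p.G.one_closed])
      then show ?thesis by simp
    qed
    then show ?thesis using True by (auto simp: trivial_on_def)
  next
    case False
    have "\<iota> q ` carrier G \<subseteq> FS (carrier Q - {p})"
      using subpower_var_coeff[OF G, of q "carrier Q - {p}"] q False by auto
    then show ?thesis using in_N *[OF q] unfolding trivial_on_def by blast
  qed
qed

end

section \<open>Induction on finite sets of translates\<close>

context cyclic_extension_equation
begin

lemma ess_unique:
  assumes "ess \<one>\<^bsub>Q\<^esub> \<noteq> {}" "finite Y" "Y \<subseteq> carrier Q" "y \<in> carrier Q" "\<not> Y \<subseteq> {y}"
  obtains y1 p where "y1 \<in> Y" "y1 \<noteq> y" "p \<in> ess y1" "\<And>y2. y2 \<in> insert y Y - {y1} \<Longrightarrow> p \<notin> ess y2"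
proof -
  obtain y1 x1 where y1: "y1 \<in> Y - {y}" "x1 \<in> ess \<one>\<^bsub>Q\<^esub>"
    and ne: "\<forall>y2 \<in> insert y Y - {y1}. \<forall>x2 \<in> ess \<one>\<^bsub>Q\<^esub>. y1 \<otimes>\<^bsub>Q\<^esub> x1 \<noteq> y2 \<otimes>\<^bsub>Q\<^esub> x2"
    using unique[OF finite_ess(1)[OF Q.one_closed] assms(1) ess_closed assms(2-5)] by blast
  show ?thesis
  proof
    show "y1 \<otimes>\<^bsub>Q\<^esub> x1 \<in> ess y1" using ess_shift[of y1] y1 assms(3) by blast
    show "y1 \<otimes>\<^bsub>Q\<^esub> x1 \<notin> ess y2" if "y2 \<in> insert y Y - {y1}" for y2
      using ess_shift[of y2] ne that assms(3,4) by auto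
  qed (use y1 in auto)
qed

text \<open>The second conjunct is the goal; the first is what \<open>amalgamation_step\<close>
  requires of the smaller set. The translate removed is one that owns an index p belonging to no
  other support in Y.\<close>

lemma trivial_on_finite:
  assumes ne: "ess \<one>\<^bsub>Q\<^esub> \<noteq> {}" and "finite Y" "Y \<subseteq> carrier Q"
  shows "(\<forall>y \<in> carrier Q - Y. trivial_on Y (FS (ess y \<union> (carrier Q - \<Union> (ess ` Y))))) \<and>
         (\<forall>q \<in> carrier Q. trivial_on Y (\<iota> q ` carrier G))"
  using assms(2,3)
proof (induction Y rule: finite_psubset_induct)
  case (psubset Y)
  have step: "trivial_on Y (FS S)" if "y1 \<in> Y" "p \<in> ess y1" "\<And>y'. y' \<in> Y - {y1} \<Longrightarrow> p \<notin> ess y'"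
    "S \<subseteq> carrier Q - {p}" "trivial_on (Y - {y1}) (FS S)" for y1 p S
  proof -
    have IH: "trivial_on (Y - {y1}) (FS (ess y1 \<union> (carrier Q - \<Union> (ess ` (Y - {y1})))))"
      using psubset.IH[of "Y - {y1}"] that(1) psubset.prems by blast
    have "trivial_on (insert y1 (Y - {y1})) (FS S)"
      by (rule amalgamation_step(1)[OF _ _ that(2,3) IH that(4,5)]) (use that(1) psubset.prems in auto)
    then show ?thesis using that(1) by (simp add: insert_absorb)
  qed
  have step': "\<forall>q \<in> carrier Q. trivial_on Y (\<iota> q ` carrier G)"
    if "y1 \<in> Y" "p \<in> ess y1" "\<And>y'. y' \<in> Y - {y1} \<Longrightarrow> p \<notin> ess y'" for y1 p
  proof
    fix q assume q: "q \<in> carrier Q"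
    have IH: "trivial_on (Y - {y1}) (FS (ess y1 \<union> (carrier Q - \<Union> (ess ` (Y - {y1})))))"
      "\<And>q. q \<in> carrier Q \<Longrightarrow> trivial_on (Y - {y1}) (\<iota> q ` carrier G)"
      using psubset.IH[of "Y - {y1}"] that(1) psubset.prems by blast+
    have "trivial_on (insert y1 (Y - {y1})) (\<iota> q ` carrier G)"
      by (rule amalgamation_step(2)[OF _ _ that(2,3) IH q]) (use that(1) psubset.prems in auto)
    then show "trivial_on Y (\<iota> q ` carrier G)" using that(1) by (simp add: insert_absorb)
  qed
  show ?case
  proof (cases "Y = {}")
    case True
    then show ?thesis by (simp add: trivial_on_def normal_closure_def F.generate_empty)
  next
    case False
    then obtain y0 where y0: "y0 \<in> Y" by blast
    \<comment> \<open>For the coefficients, p has to avoid only the other supports in Y, so the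
      auxiliary translate is taken from Y. A singleton is outside the scope of
      \<open>ess_unique\<close>, but there any index of the nonempty support will do.\<close>
    have "\<exists>y1 p. y1 \<in> Y \<and> p \<in> ess y1 \<and> (\<forall>y' \<in> Y - {y1}. p \<notin> ess y')"
    proof (cases "Y \<subseteq> {y0}")
      case True
      then have "Y = {y0}" using y0 by blast
      moreover have "ess y0 \<noteq> {}" using ess_shift[of y0] ne y0 psubset.prems by blast
      ultimately show ?thesis by blast
    next
      case False
      then show ?thesis
        using ess_unique[OF ne psubset.hyps psubset.prems, of y0] y0 psubset.prems by (metis insert_absorb subsetD)
    qed
    then have E: "\<forall>q \<in> carrier Q. trivial_on Y (\<iota> q ` carrier G)" using step' by metis
    have D: "trivial_on Y (FS (ess y \<union> (carrier Q - \<Union> (ess ` Y))))" if y: "y \<in> carrier Q - Y" for y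
    proof -
      have "\<not> Y \<subseteq> {y}" using False y by blast
      \<comment> \<open>Here p must also miss \<open>ess y\<close>, and its owner must be in Y
        instead of being y. This is where the second uniquely decomposable product is used.\<close>
      then obtain y1 p where p: "y1 \<in> Y" "y1 \<noteq> y" "p \<in> ess y1" "\<And>y2. y2 \<in> insert y Y - {y1} \<Longrightarrow> p \<notin> ess y2"
        using ess_unique[OF ne psubset.hyps psubset.prems, of y] y by blast
      let ?S = "ess y \<union> (carrier Q - \<Union> (ess ` Y))"
      let ?S' = "ess y \<union> (carrier Q - \<Union> (ess ` (Y - {y1})))"
      have "trivial_on (Y - {y1}) (FS ?S')"
        using psubset.IH[of "Y - {y1}"] p(1) psubset.prems y by blast
      \<comment> \<open>Removing \<open>y1\<close> enlarges the complement of the supports, so the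
        induction hypothesis for the same y covers \<open>?S\<close>.\<close>
      moreover have "FS ?S \<subseteq> FS ?S'" by (rule subpower_var_mono[OF G]) blast
      ultimately have "trivial_on (Y - {y1}) (FS ?S)" unfolding trivial_on_def by blast
      moreover have "?S \<subseteq> carrier Q - {p}" using p y ess_closed by auto
      ultimately show ?thesis using step[of y1 p ?S] p by simp
    qed
    show ?thesis using D E by blast
  qed
qed

lemma \<iota>_trivial_intersection:
  assumes q: "q \<in> carrier Q" and g: "g \<in> carrier G" and N: "\<iota> q g \<in> NC (carrier Q)"
  shows "g = \<one>\<^bsub>G\<^esub>"
proof -
  interpret G: group G by (rule G)
  interpret P: group P by (rule group_free_power[OF G])
  let ?incl = "free_product_incl (\<lambda>_ :: 'i. G)"
  obtain h where h: "h \<in> hom F P" "h x = \<one>\<^bsub>P\<^esub>"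
    "\<And>q g. q \<in> carrier Q \<Longrightarrow> g \<in> carrier G \<Longrightarrow> h (\<iota> q g) = ?incl q g"
  proof (rule power_var_hom_ex[OF G P.is_group _ P.one_closed, where \<phi> = ?incl])
    show "?incl q \<in> hom G P" if "q \<in> carrier Q" for q using G that by (rule power_incl_hom)
  qed (rule that)
  have "\<iota> q g = \<one>\<^bsub>F\<^esub>"
  proof (cases "ess \<one>\<^bsub>Q\<^esub> = {}")
    case True
    \<comment> \<open>With empty support the core is a power of x, so h, which kills x and retracts
      onto P, kills every relator and still detects g.\<close>
    have "h (W y) = \<one>\<^bsub>P\<^esub>" if y: "y \<in> carrier Q" for y
    proof -
      have "core y \<in> FS {}" using core(1)[OF y] ess_shift[OF y] True by simp
      then have "h (core y) \<in> {\<one>\<^bsub>P\<^esub>}"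
        by (rule subpower_var_hom_image[OF G _ P.is_group h(1) P.triv_subgroup, rotated -1]) (use h(2) in auto)
      then show ?thesis using hom_core_one_iff[OF y P.is_group h(1)] by simp
    qed
    then have "h (\<iota> q g) = \<one>\<^bsub>P\<^esub>"
      by (rule_tac F.normal_closure_hom_one[OF W_image_closed[OF subset_refl] P.is_group h(1) _ N]) auto
    then have "?incl q g = ?incl q \<one>\<^bsub>G\<^esub>"
      using h(3)[OF q g] by (simp add: free_product_incl_def free_power_def one_free_product)
    then have "g = \<one>\<^bsub>G\<^esub>" by (rule free_product_incl_inj)
    then show ?thesis using hom_one[OF power_coeff_hom[OF G q] G F.is_group] by simp
  next
    case False
    \<comment> \<open>Only finitely many translates take part in writing the given element, so the
      finite case decides.\<close>
    obtain R where R: "finite R" "R \<subseteq> W ` carrier Q" "\<iota> q g \<in> normal_closure F R"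
      using F.normal_closure_finite[OF N] by blast
    obtain Y where Y: "Y \<subseteq> carrier Q" "finite Y" "R = W ` Y"
      using finite_subset_image[OF R(1,2)] by blast
    then have "trivial_on Y (\<iota> q ` carrier G)" using trivial_on_finite[OF False] q by blast
    then show ?thesis using R(3) Y g unfolding trivial_on_def by blast
  qed
  then have "adjoin_coeff P (?incl q g) = adjoin_coeff P (?incl q \<one>\<^bsub>G\<^esub>)"
    using hom_one[OF power_coeff_hom[OF G q] G F.is_group] by (simp add: power_coeff_def)
  then show ?thesis
    using adjoin_coeff_inj[OF P.is_group] free_product_incl_inj by (metis injD)
qed

section \<open>The induced permutation representation\<close>

text \<open>The generalized equation is evaluated from right to left, so \<open>s\<close> moves the coset \<open>q\<close> to
  \<open>q (\<pi> s)\<inverse>\<close>.\<close>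

lemma solution_ex:
  defines "M \<equiv> BijGroup (carrier Q \<times> carrier (F Mod NC (carrier Q)))"
  obtains \<phi> \<psi> where "\<phi> \<in> mon G M" "\<psi> \<in> hom T M" "eval_expr M \<phi> \<psi> e = \<one>\<^bsub>M\<^esub>"
proof -
  interpret G: group G by (rule G)
  let ?N = "NC (carrier Q)"
  let ?L = "F Mod ?N"
  let ?f = "\<lambda>z. ?N #>\<^bsub>F\<^esub> z"
  let ?S = "carrier Q \<times> carrier ?L"
  have N: "?N \<lhd> F" by (rule F.normal_closure_normal[OF W_image_closed[OF subset_refl]])
  interpret N: normal ?N F by (rule N)
  have L: "group ?L" by (rule N.factorgroup_is_group)
  then interpret L: group ?L .
  have f_hom: "?f \<in> hom F ?L" by (rule N.r_coset_hom_Mod)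
  interpret f: group_hom F ?L ?f using L f_hom F.is_group by (simp add: group_hom_def group_hom_axioms_def)
  have f_one: "?f z = \<one>\<^bsub>?L\<^esub> \<longleftrightarrow> z \<in> ?N" if "z \<in> carrier F" for z
    using that N.rcos_const F.coset_join1[of ?N z] N.subset N.is_subgroup by auto
  obtain f where f_def: "f = ?f" by blast
  have f_mult: "f (a \<otimes>\<^bsub>F\<^esub> b) = f a \<otimes>\<^bsub>?L\<^esub> f b" if "a \<in> carrier F" "b \<in> carrier F" for a b
    unfolding f_def using that by (rule f.hom_mult)
  have f_closed: "f a \<in> carrier ?L" if "a \<in> carrier F" for a
    unfolding f_def using that by (rule f.hom_closed)
  have f_1: "f \<one>\<^bsub>F\<^esub> = \<one>\<^bsub>?L\<^esub>" unfolding f_def by (rule f.hom_one)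
  define \<phi> where "\<phi> g = restrict (\<lambda>(q, l). (q, f (\<iota> q g) \<otimes>\<^bsub>?L\<^esub> l)) ?S" for g
  \<comment> \<open>The exponent is taken at the new coset: it is the one from which s leads back to
    q.\<close>
  define \<psi> where "\<psi> s = restrict (\<lambda>(q, l). (q \<otimes>\<^bsub>Q\<^esub> inv\<^bsub>Q\<^esub> \<pi> s,
      f (x [^]\<^bsub>F\<^esub> cocycle (q \<otimes>\<^bsub>Q\<^esub> inv\<^bsub>Q\<^esub> \<pi> s) s) \<otimes>\<^bsub>?L\<^esub> l)) ?S" for s
  have \<phi>: "\<phi> \<in> hom G M"
    unfolding M_def \<phi>_def
  proof (rule hom_BijGroupI[OF G])
    fix a b z assume ab: "a \<in> carrier G" "b \<in> carrier G" and "z \<in> ?S"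
    then obtain q l where z: "z = (q, l)" "q \<in> carrier Q" "l \<in> carrier ?L" by blast
    have "f (\<iota> q (a \<otimes>\<^bsub>G\<^esub> b)) = f (\<iota> q a) \<otimes>\<^bsub>?L\<^esub> f (\<iota> q b)"
      using hom_mult[OF power_coeff_hom[OF G z(2)] ab] f_mult z ab by simp
    then show "(case z of (q, l) \<Rightarrow> (q, f (\<iota> q (a \<otimes>\<^bsub>G\<^esub> b)) \<otimes>\<^bsub>?L\<^esub> l)) =
      (case case z of (q, l) \<Rightarrow> (q, f (\<iota> q b) \<otimes>\<^bsub>?L\<^esub> l) of (q, l) \<Rightarrow> (q, f (\<iota> q a) \<otimes>\<^bsub>?L\<^esub> l))"
      using z ab by (simp del: mult_FactGroup add: L.m_assoc f_closed)
  next
    fix z assume "z \<in> ?S"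
    then show "(case z of (q, l) \<Rightarrow> (q, f (\<iota> q \<one>\<^bsub>G\<^esub>) \<otimes>\<^bsub>?L\<^esub> l)) = z"
      using hom_one[OF power_coeff_hom[OF G] G F.is_group] f_1
      by (auto simp del: mult_FactGroup one_FactGroup)
  qed (use f_closed in \<open>auto simp del: mult_FactGroup\<close>)
  have \<psi>: "\<psi> \<in> hom T M"
    unfolding M_def \<psi>_def
  proof (rule hom_BijGroupI[OF T])
    fix s s' z assume s: "s \<in> carrier T" "s' \<in> carrier T" and "z \<in> ?S"
    then obtain q l where z: "z = (q, l)" "q \<in> carrier Q" "l \<in> carrier ?L" by blast
    let ?q = "q \<otimes>\<^bsub>Q\<^esub> inv\<^bsub>Q\<^esub> \<pi> s'"
    let ?r = "?q \<otimes>\<^bsub>Q\<^esub> inv\<^bsub>Q\<^esub> \<pi> s"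
    have r: "q \<otimes>\<^bsub>Q\<^esub> inv\<^bsub>Q\<^esub> \<pi> (s \<otimes>\<^bsub>T\<^esub> s') = ?r" using s z by (simp add: Q.inv_mult_group Q.m_assoc)
    have "?r \<otimes>\<^bsub>Q\<^esub> \<pi> s = ?q" using s z by (simp add: Q.m_assoc)
    then have "cocycle ?r (s \<otimes>\<^bsub>T\<^esub> s') = cocycle ?r s + cocycle ?q s'"
      using cocycle_mult[of ?r s s'] s z by simp
    then have "f (x [^]\<^bsub>F\<^esub> cocycle ?r (s \<otimes>\<^bsub>T\<^esub> s'))
        = f (x [^]\<^bsub>F\<^esub> cocycle ?r s) \<otimes>\<^bsub>?L\<^esub> f (x [^]\<^bsub>F\<^esub> cocycle ?q s')"
      by (simp add: F.int_pow_mult f_mult del: mult_FactGroup)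
    then show "(case z of (q, l) \<Rightarrow> (q \<otimes>\<^bsub>Q\<^esub> inv\<^bsub>Q\<^esub> \<pi> (s \<otimes>\<^bsub>T\<^esub> s'),
          f (x [^]\<^bsub>F\<^esub> cocycle (q \<otimes>\<^bsub>Q\<^esub> inv\<^bsub>Q\<^esub> \<pi> (s \<otimes>\<^bsub>T\<^esub> s')) (s \<otimes>\<^bsub>T\<^esub> s')) \<otimes>\<^bsub>?L\<^esub> l)) =
        (case case z of (q, l) \<Rightarrow> (q \<otimes>\<^bsub>Q\<^esub> inv\<^bsub>Q\<^esub> \<pi> s', f (x [^]\<^bsub>F\<^esub> cocycle (q \<otimes>\<^bsub>Q\<^esub> inv\<^bsub>Q\<^esub> \<pi> s') s') \<otimes>\<^bsub>?L\<^esub> l)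
         of (q, l) \<Rightarrow> (q \<otimes>\<^bsub>Q\<^esub> inv\<^bsub>Q\<^esub> \<pi> s, f (x [^]\<^bsub>F\<^esub> cocycle (q \<otimes>\<^bsub>Q\<^esub> inv\<^bsub>Q\<^esub> \<pi> s) s) \<otimes>\<^bsub>?L\<^esub> l))"
      unfolding z(1) prod.case r using z by (simp del: mult_FactGroup add: L.m_assoc f_closed)
  next
    fix z assume "z \<in> ?S"
    then show "(case z of (q, l) \<Rightarrow> (q \<otimes>\<^bsub>Q\<^esub> inv\<^bsub>Q\<^esub> \<pi> \<one>\<^bsub>T\<^esub>,
        f (x [^]\<^bsub>F\<^esub> cocycle (q \<otimes>\<^bsub>Q\<^esub> inv\<^bsub>Q\<^esub> \<pi> \<one>\<^bsub>T\<^esub>) \<one>\<^bsub>T\<^esub>) \<otimes>\<^bsub>?L\<^esub> l)) = z"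
      using f_1 by (auto simp del: mult_FactGroup one_FactGroup simp: cocycle_one)
  qed (use f_closed in \<open>auto simp del: mult_FactGroup\<close>)
  interpret M: group M unfolding M_def by (rule group_BijGroup)
  \<comment> \<open>The starting coset is chosen so that the path ends at q. Read backwards, it
    passes the cosets that occur in \<open>word q w\<close>, and the second coordinate accumulates
    exactly this word.\<close>
  have eval: "eval_expr M \<phi> \<psi> w \<in> carrier M \<and>
      eval_expr M \<phi> \<psi> w (q \<otimes>\<^bsub>Q\<^esub> \<pi> (var_prod T w), l) = (q, f (word q w) \<otimes>\<^bsub>?L\<^esub> l)"
    if "gen_equation_over G T w" "q \<in> carrier Q" "l \<in> carrier ?L" for w q l
    using that
  proof (induction w arbitrary: q)
    case Nil
    then show ?case
      using f_1 by (simp del: mult_FactGroup one_FactGroup add: eval_expr_def M_def BijGroup_one_apply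
          L.l_one M.one_closed[unfolded M_def])
  next
    case (Cons a w)
    obtain g s where a: "a = (g, s)" by (cases a)
    have gs: "g \<in> carrier G" "s \<in> carrier T" "gen_equation_over G T w" using Cons.prems a by auto
    let ?E = "eval_expr M \<phi> \<psi> w" and ?q = "q \<otimes>\<^bsub>Q\<^esub> \<pi> s"
    have q: "q \<in> carrier Q" "?q \<in> carrier Q" and l: "l \<in> carrier ?L" using Cons.prems gs by auto
    have E: "?E \<in> carrier M" "?E (?q \<otimes>\<^bsub>Q\<^esub> \<pi> (var_prod T w), l) = (?q, f (word ?q w) \<otimes>\<^bsub>?L\<^esub> l)"
      using Cons.IH[OF gs(3) q(2) l] by auto
    have mem: "\<phi> g \<in> carrier M" "\<psi> s \<in> carrier M" using gs hom_in_carrier[OF \<phi>] hom_in_carrier[OF \<psi>] by auto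
    have wc: "word ?q w \<in> carrier F" using word_closed gs q by simp
    have v: "var_prod T w \<in> carrier T" by (rule var_prod_closed[OF gs(3)])
    have z: "(?q \<otimes>\<^bsub>Q\<^esub> \<pi> (var_prod T w), l) \<in> ?S" using q l v by simp
    have Ea: "eval_expr M \<phi> \<psi> (a # w) = \<phi> g \<otimes>\<^bsub>M\<^esub> \<psi> s \<otimes>\<^bsub>M\<^esub> ?E" using a by (simp add: eval_expr_def)
    have qs: "?q \<otimes>\<^bsub>Q\<^esub> inv\<^bsub>Q\<^esub> \<pi> s = q" using q gs by (simp add: Q.m_assoc)
    have fE: "f (word ?q w) \<otimes>\<^bsub>?L\<^esub> l \<in> carrier ?L" using f_closed[OF wc] l by (rule L.m_closed)
    have "(\<phi> g \<otimes>\<^bsub>M\<^esub> \<psi> s \<otimes>\<^bsub>M\<^esub> ?E) (?q \<otimes>\<^bsub>Q\<^esub> \<pi> (var_prod T w), l)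
        = \<phi> g (\<psi> s (?q, f (word ?q w) \<otimes>\<^bsub>?L\<^esub> l))"
      using mem E z q fE M.m_closed[OF mem] unfolding M_def
      by (simp del: mult_FactGroup add: BijGroup_mult_apply)
    also have "\<psi> s (?q, f (word ?q w) \<otimes>\<^bsub>?L\<^esub> l)
        = (q, f (x [^]\<^bsub>F\<^esub> cocycle q s) \<otimes>\<^bsub>?L\<^esub> (f (word ?q w) \<otimes>\<^bsub>?L\<^esub> l))"
      using q fE by (simp del: mult_FactGroup add: \<psi>_def qs)
    also have "\<phi> g \<dots> = (q, f (word q (a # w)) \<otimes>\<^bsub>?L\<^esub> l)"
      using q fE l wc gs a f_closed by (simp del: mult_FactGroup add: \<phi>_def f_mult L.m_assoc)
    finally show ?case
      using Ea a q gs v E mem by (simp add: Q.m_assoc)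
  qed
  show ?thesis
  proof
    \<comment> \<open>Faithfulness is visible over a single coset: on the fibre of the identity, g
      acts as multiplication by its copy in that factor.\<close>
    have "g = \<one>\<^bsub>G\<^esub>" if g: "g \<in> carrier G" "\<phi> g = \<one>\<^bsub>M\<^esub>" for g
    proof -
      have "(\<one>\<^bsub>Q\<^esub>, \<one>\<^bsub>?L\<^esub>) \<in> ?S" by (simp only: mem_Times_iff fst_conv snd_conv Q.one_closed L.one_closed simp_thms)
      then have "\<phi> g (\<one>\<^bsub>Q\<^esub>, \<one>\<^bsub>?L\<^esub>) = (\<one>\<^bsub>Q\<^esub>, \<one>\<^bsub>?L\<^esub>)" unfolding g(2) M_def by (rule BijGroup_one_apply)
      then have "f (\<iota> \<one>\<^bsub>Q\<^esub> g) \<otimes>\<^bsub>?L\<^esub> \<one>\<^bsub>?L\<^esub> = \<one>\<^bsub>?L\<^esub>"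
        using \<open>(\<one>\<^bsub>Q\<^esub>, \<one>\<^bsub>?L\<^esub>) \<in> ?S\<close> by (simp del: mult_FactGroup one_FactGroup add: \<phi>_def)
      then have "f (\<iota> \<one>\<^bsub>Q\<^esub> g) = \<one>\<^bsub>?L\<^esub>"
        using L.r_one[OF f_closed[OF \<iota>_closed[OF Q.one_closed g(1)]]] by (simp only:)
      then have "\<iota> \<one>\<^bsub>Q\<^esub> g \<in> ?N" using f_one[OF \<iota>_closed[OF Q.one_closed g(1)]] unfolding f_def by blast
      then show ?thesis by (rule \<iota>_trivial_intersection[OF Q.one_closed g(1)])
    qed
    then show "\<phi> \<in> mon G M" using mon_iff_hom_one[OF G M.is_group] \<phi> by blast
    show "\<psi> \<in> hom T M" by (rule \<psi>)
    show "eval_expr M \<phi> \<psi> e = \<one>\<^bsub>M\<^esub>"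
    proof
      fix z
      show "eval_expr M \<phi> \<psi> e z = \<one>\<^bsub>M\<^esub> z"
      proof (cases "z \<in> ?S")
        case True
        then obtain q l where z: "z = (q, l)" "q \<in> carrier Q" "l \<in> carrier ?L" by blast
        have "W q \<in> ?N" using F.normal_closure_incl[OF W_image_closed[OF subset_refl]] z(2) by blast
        then have "f (W q) = \<one>\<^bsub>?L\<^esub>" unfolding f_def using f_one[OF W_closed[OF z(2)]] by blast
        \<comment> \<open>Since c lies in the kernel, the starting coset in \<open>eval\<close> is q
          itself, so every point of the set is reached.\<close>
        then have "eval_expr M \<phi> \<psi> e z = z"
          using eval[OF e z(2,3)] L.l_one[OF z(3)] z
          by (simp del: mult_FactGroup one_FactGroup add: prod_e \<pi>_c)
        then show ?thesis using True unfolding M_def by (simp add: BijGroup_one_apply)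
      next
        case False
        obtain l where "l \<in> carrier ?L" using L.one_closed by blast
        then have "eval_expr M \<phi> \<psi> e \<in> extensional ?S"
          using eval[OF e Q.one_closed] unfolding M_def by (auto simp: BijGroup_def dest: Bij_imp_extensional)
        then have "eval_expr M \<phi> \<psi> e z = undefined" using False by (rule extensional_arb)
        moreover have "\<one>\<^bsub>M\<^esub> z = undefined" using False unfolding M_def BijGroup_def by simp
        ultimately show ?thesis by (rule trans[OF _ sym])
      qed
    qed
  qed
qed

end

section \<open>Left-handed unique products\<close>

text \<open>Allows the quotient of T to be replaced by a copy on a type over which free powers are
  available.\<close>

lemma strong_unique_product_iso:
  assumes Q: "group Q" and R: "group R" and f: "f \<in> iso Q R" and sup: "strong_unique_product Q"
  shows "strong_unique_product R"
  unfolding strong_unique_product_def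
proof (intro allI impI)
  interpret Q: group Q by (rule Q)
  interpret R: group R by (rule R)
  fix A B assume AB: "A \<subseteq> carrier R \<and> B \<subseteq> carrier R \<and> finite A \<and> finite B \<and> A \<noteq> {} \<and> 2 \<le> card B"
  define g where "g = inv_into (carrier Q) f"
  have g: "g \<in> hom R Q" "inj_on g (carrier R)"
    using Q.iso_set_sym[OF f] by (auto simp: g_def iso_def bij_betw_def)
  have ud: "uniquely_decomposable R A B (a \<otimes>\<^bsub>R\<^esub> b)"
    if ab: "a \<in> A" "b \<in> B" "uniquely_decomposable Q (g ` A) (g ` B) (g a \<otimes>\<^bsub>Q\<^esub> g b)" for a b
    unfolding uniquely_decomposable_def
  proof (rule ex1I[of _ "(a, b)"])
    fix p assume p: "p \<in> A \<times> B \<and> fst p \<otimes>\<^bsub>R\<^esub> snd p = a \<otimes>\<^bsub>R\<^esub> b"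
    obtain a' b' where p': "p = (a', b')" by (cases p)
    have cl: "a \<in> carrier R" "b \<in> carrier R" "a' \<in> carrier R" "b' \<in> carrier R" using ab p p' AB by auto
    have "g a' \<otimes>\<^bsub>Q\<^esub> g b' = g a \<otimes>\<^bsub>Q\<^esub> g b"
      using p p' cl by (simp flip: hom_mult[OF g(1)])
    then have "(g a', g b') \<in> g ` A \<times> g ` B \<and> fst (g a', g b') \<otimes>\<^bsub>Q\<^esub> snd (g a', g b') = g a \<otimes>\<^bsub>Q\<^esub> g b"
      "(g a, g b) \<in> g ` A \<times> g ` B \<and> fst (g a, g b) \<otimes>\<^bsub>Q\<^esub> snd (g a, g b) = g a \<otimes>\<^bsub>Q\<^esub> g b"
      using p p' ab by auto
    then have "(g a', g b') = (g a, g b)"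
      using ab(3) unfolding uniquely_decomposable_def by (metis (no_types, lifting))
    then show "p = (a, b)" using p' cl g(2) by (auto dest: inj_onD)
  qed (use ab in simp)
  have "g ` A \<subseteq> carrier Q" "g ` B \<subseteq> carrier Q" "finite (g ` A)" "finite (g ` B)" "g ` A \<noteq> {}"
    using AB hom_carrier[OF g(1)] by auto
  moreover have "2 \<le> card (g ` B)" using AB card_image[OF inj_on_subset[OF g(2)], of B] by simp
  ultimately have "\<exists>x1 \<in> g ` A. \<exists>x2 \<in> g ` A. \<exists>y1 \<in> g ` B. \<exists>y2 \<in> g ` B. y1 \<noteq> y2 \<and>
      uniquely_decomposable Q (g ` A) (g ` B) (x1 \<otimes>\<^bsub>Q\<^esub> y1) \<and>
      uniquely_decomposable Q (g ` A) (g ` B) (x2 \<otimes>\<^bsub>Q\<^esub> y2)"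
    by (intro sup[unfolded strong_unique_product_def, rule_format]) simp
  then obtain a1 a2 b1 b2 where *: "a1 \<in> A" "a2 \<in> A" "b1 \<in> B" "b2 \<in> B" "g b1 \<noteq> g b2"
    "uniquely_decomposable Q (g ` A) (g ` B) (g a1 \<otimes>\<^bsub>Q\<^esub> g b1)"
    "uniquely_decomposable Q (g ` A) (g ` B) (g a2 \<otimes>\<^bsub>Q\<^esub> g b2)" by blast
  show "\<exists>x1\<in>A. \<exists>x2\<in>A. \<exists>y1\<in>B. \<exists>y2\<in>B. y1 \<noteq> y2 \<and>
      uniquely_decomposable R A B (x1 \<otimes>\<^bsub>R\<^esub> y1) \<and> uniquely_decomposable R A B (x2 \<otimes>\<^bsub>R\<^esub> y2)"
    by (rule bexI[OF _ *(1)], rule bexI[OF _ *(2)], rule bexI[OF _ *(3)], rule bexI[OF _ *(4)])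
       (use ud[OF *(1,3,6)] ud[OF *(2,4,7)] *(5) in auto)
qed

text \<open>Passing to inverses exchanges the roles of the two factors.\<close>

lemma strong_unique_product_left:
  assumes Q: "group Q" and sup: "strong_unique_product Q"
    and X: "finite X" "X \<noteq> {}" "X \<subseteq> carrier Q" and Y: "finite Y" "Y \<subseteq> carrier Q"
    and y: "y \<in> carrier Q" "\<not> Y \<subseteq> {y}"
  shows "\<exists>y1 \<in> Y - {y}. \<exists>x1 \<in> X. \<forall>y2 \<in> insert y Y - {y1}. \<forall>x2 \<in> X. y1 \<otimes>\<^bsub>Q\<^esub> x1 \<noteq> y2 \<otimes>\<^bsub>Q\<^esub> x2"
proof -
  interpret Q: group Q by (rule Q)
  let ?A = "m_inv Q ` X" and ?B = "m_inv Q ` insert y Y"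
  have YQ: "insert y Y \<subseteq> carrier Q" using Y y by auto
  have "card ?B = card (insert y Y)"
    using inj_on_subset[OF Q.inv_inj YQ] by (rule card_image)
  moreover have "2 \<le> card (insert y Y)"
  proof -
    obtain z where "z \<in> Y" "z \<noteq> y" using y(2) by blast
    then have "card {y, z} \<le> card (insert y Y)" using Y(1) by (intro card_mono) auto
    then show ?thesis using \<open>z \<noteq> y\<close> by simp
  qed
  ultimately have "\<exists>x1 \<in> ?A. \<exists>x2 \<in> ?A. \<exists>y1 \<in> ?B. \<exists>y2 \<in> ?B. y1 \<noteq> y2 \<and>
      uniquely_decomposable Q ?A ?B (x1 \<otimes>\<^bsub>Q\<^esub> y1) \<and> uniquely_decomposable Q ?A ?B (x2 \<otimes>\<^bsub>Q\<^esub> y2)"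
    using X YQ Y(1) by (intro sup[unfolded strong_unique_product_def, rule_format]) auto
  \<comment> \<open>Of two products with different second factors, at least one has a second factor
    other than the inverse of y.\<close>
  then have "\<exists>a \<in> ?A. \<exists>b \<in> ?B. b \<noteq> inv\<^bsub>Q\<^esub> y \<and> uniquely_decomposable Q ?A ?B (a \<otimes>\<^bsub>Q\<^esub> b)" by metis
  then obtain x1 y1 where x1: "x1 \<in> X" and y1: "y1 \<in> insert y Y" "inv\<^bsub>Q\<^esub> y1 \<noteq> inv\<^bsub>Q\<^esub> y"
    and ud: "uniquely_decomposable Q ?A ?B (inv\<^bsub>Q\<^esub> x1 \<otimes>\<^bsub>Q\<^esub> inv\<^bsub>Q\<^esub> y1)" by auto
  have "y1 \<otimes>\<^bsub>Q\<^esub> x1 \<noteq> y2 \<otimes>\<^bsub>Q\<^esub> x2" if y2: "y2 \<in> insert y Y - {y1}" and x2: "x2 \<in> X" for y2 x2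
  proof
    assume "y1 \<otimes>\<^bsub>Q\<^esub> x1 = y2 \<otimes>\<^bsub>Q\<^esub> x2"
    moreover have cl: "x1 \<in> carrier Q" "x2 \<in> carrier Q" "y1 \<in> carrier Q" "y2 \<in> carrier Q"
      using x1 x2 y1 y2 X YQ by auto
    ultimately have eq: "inv\<^bsub>Q\<^esub> x2 \<otimes>\<^bsub>Q\<^esub> inv\<^bsub>Q\<^esub> y2 = inv\<^bsub>Q\<^esub> x1 \<otimes>\<^bsub>Q\<^esub> inv\<^bsub>Q\<^esub> y1"
      by (simp flip: Q.inv_mult_group)
    obtain p where p: "\<And>r. r \<in> ?A \<times> ?B \<Longrightarrow> fst r \<otimes>\<^bsub>Q\<^esub> snd r = inv\<^bsub>Q\<^esub> x1 \<otimes>\<^bsub>Q\<^esub> inv\<^bsub>Q\<^esub> y1 \<Longrightarrow> r = p"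
      using ud unfolding uniquely_decomposable_def by blast
    have "(inv\<^bsub>Q\<^esub> x1, inv\<^bsub>Q\<^esub> y1) = p" by (rule p) (use x1 y1 in auto)
    moreover have "(inv\<^bsub>Q\<^esub> x2, inv\<^bsub>Q\<^esub> y2) = p" by (rule p) (use x2 y2 eq in auto)
    ultimately have "(inv\<^bsub>Q\<^esub> x1, inv\<^bsub>Q\<^esub> y1) = (inv\<^bsub>Q\<^esub> x2, inv\<^bsub>Q\<^esub> y2)" by (rule trans[OF _ sym])
    then have "inv\<^bsub>Q\<^esub> y1 = inv\<^bsub>Q\<^esub> y2" by (rule Pair_inject)
    then have "y1 = y2" using Q.inv_inj cl by (auto dest: inj_onD)
    then show False using y2 by simp
  qed
  then show ?thesis using x1 y1 by blast
qed

section \<open>Overgroups on words\<close>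

text \<open>The solution found acts on an unrelated set. Every element of the subgroup generated by
  both images is the value of a word, and choosing one word for each transports that subgroup to the
  required type.\<close>

lemma gen_solvable_overI:
  fixes G :: "('a, 'm) monoid_scheme" and T :: "('t, 'n) monoid_scheme"
  assumes G: "group G" and T: "group T" and M: "group M"
    and \<phi>: "\<phi> \<in> mon G M" and \<psi>: "\<psi> \<in> hom T M" and e: "gen_equation_over G T e"
    and ev: "eval_expr M \<phi> \<psi> e = \<one>\<^bsub>M\<^esub>"
  shows "gen_solvable_over G T e"
proof -
  interpret M: group M by (rule M)
  have \<phi>': "\<phi> \<in> hom G M" "inj_on \<phi> (carrier G)" using \<phi> by (auto simp: mon_def)
  interpret \<phi>: group_hom G M \<phi> using G M \<phi>' by (simp add: group_hom_def group_hom_axioms_def)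
  interpret \<psi>: group_hom T M \<psi> using T M \<psi> by (simp add: group_hom_def group_hom_axioms_def)
  let ?S = "\<phi> ` carrier G \<union> \<psi> ` carrier T"
  define H where "H = generate M ?S"
  have S: "?S \<subseteq> carrier M" by auto
  have H: "subgroup H M" unfolding H_def by (rule M.generate_is_subgroup[OF S])
  let ?H = "M\<lparr>carrier := H\<rparr>"
  have Hg: "group ?H" using H M by (rule subgroup.subgroup_is_group)
  define v where "v w = foldr (\<lambda>s y. case_sum \<phi> \<psi> s \<otimes>\<^bsub>M\<^esub> y) w \<one>\<^bsub>M\<^esub>" for w
  let ?L = "lists (Inl ` carrier G \<union> Inr ` carrier T)"
  have v_closed: "v w \<in> carrier M" if "w \<in> ?L" for w
    using that by (induction w) (auto simp: v_def)
  have v_append: "v (w @ w') = v w \<otimes>\<^bsub>M\<^esub> v w'" if "w \<in> ?L" "w' \<in> ?L" for w w'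
    using that(1)
  proof (induction w)
    case Nil
    then show ?case using v_closed[OF that(2)] by (simp add: v_def)
  next
    case (Cons s w)
    then have "case_sum \<phi> \<psi> s \<in> carrier M" by auto
    then show ?case using Cons v_closed[OF that(2)] v_closed[of w] by (simp add: v_def M.m_assoc)
  qed
  have "\<exists>w \<in> ?L. v w = h" if "h \<in> H" for h
    using that unfolding H_def
  proof induction
    case one
    show ?case by (rule bexI[of _ "[]"]) (auto simp: v_def)
  next
    case (incl h)
    then consider g where "g \<in> carrier G" "h = \<phi> g" | t where "t \<in> carrier T" "h = \<psi> t" by blast
    then show ?case
    proof cases
      case 1
      then show ?thesis by (intro bexI[of _ "[Inl g]"]) (auto simp: v_def)
    next
      case 2
      then show ?thesis by (intro bexI[of _ "[Inr t]"]) (auto simp: v_def)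
    qed
  next
    case (inv h)
    then consider g where "g \<in> carrier G" "h = \<phi> g" | t where "t \<in> carrier T" "h = \<psi> t" by blast
    then show ?case
    proof cases
      case 1
      then show ?thesis by (intro bexI[of _ "[Inl (inv\<^bsub>G\<^esub> g)]"]) (auto simp: v_def)
    next
      case 2
      then show ?thesis by (intro bexI[of _ "[Inr (inv\<^bsub>T\<^esub> t)]"]) (auto simp: v_def)
    qed
  next
    case (eng h1 h2)
    then obtain w1 w2 where w: "w1 \<in> ?L" "v w1 = h1" "w2 \<in> ?L" "v w2 = h2" by blast
    show ?case by (rule bexI[of _ "w1 @ w2"]) (use w v_append in auto)
  qed
  then obtain \<sigma> where \<sigma>: "\<And>h. h \<in> H \<Longrightarrow> v (\<sigma> h) = h" by metis
  then have inj: "inj_on \<sigma> (carrier ?H)" by (intro inj_on_inverseI[where g = v]) simp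
  let ?K = "image_group \<sigma> ?H"
  have K: "\<sigma> \<in> hom ?H ?K" "group ?K" using image_group_iso[OF Hg inj] by (auto simp: iso_def)
  have mem: "g \<in> carrier G \<Longrightarrow> \<phi> g \<in> H" "t \<in> carrier T \<Longrightarrow> \<psi> t \<in> H" for g t
    unfolding H_def by (auto intro: generate.incl)
  have "\<phi> \<in> mon G ?H"
    using \<phi> mem(1) unfolding mon_def by (auto simp: hom_def)
  moreover have "\<sigma> \<in> mon ?H ?K" using K inj by (simp add: mon_def)
  ultimately have "\<sigma> \<circ> \<phi> \<in> mon G ?K" by (rule mon_compose)
  moreover have "\<psi> \<in> hom T ?H" using \<psi> mem(2) by (auto simp: hom_def)
  then have "\<sigma> \<circ> \<psi> \<in> hom T ?K" using K(1) by (rule hom_compose)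
  moreover have "eval_expr ?K (\<sigma> \<circ> \<phi>) (\<sigma> \<circ> \<psi>) e = \<one>\<^bsub>?K\<^esub>"
  proof -
    have "\<sigma> (eval_expr ?H \<phi> \<psi> e) = eval_expr ?K (\<sigma> \<circ> \<phi>) (\<sigma> \<circ> \<psi>) e"
      by (rule hom_eval_expr(2)[OF Hg K(2,1)]) (use e mem in \<open>auto simp: gen_equation_over_def\<close>)
    moreover have "eval_expr ?H \<phi> \<psi> e = \<one>\<^bsub>?H\<^esub>" using ev by (simp add: eval_expr_def)
    ultimately show ?thesis using hom_one[OF K(1) Hg K(2)] by simp
  qed
  ultimately show ?thesis using K(2) unfolding gen_solvable_over_def by blast
qed

section \<open>The theorem\<close>

theorem mainTheorem3:
  fixes G :: "'a monoid" and T :: "'t monoid" and e :: "('a \<times> 't) list"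
  assumes "group G"
    and "\<And>(I :: ('a + 't) list set) w.
           \<lbrakk>equation_over (free_power I G) w; unimodular_equation w\<rbrakk>
             \<Longrightarrow> magnusian (free_power I G) w"
    and "group T"
    and "gen_equation_over G T e"
    and "unimodular_gen_equation T e"
  shows "gen_solvable_over G T e"
proof -
  interpret T: group T by (rule assms(3))
  define c where "c = var_prod T e"
  have c: "c \<in> carrier T"
    using assms(4) unfolding c_def by (induction e) (auto simp: var_prod_def gen_equation_over_def)
  define N where "N = generate T {c}"
  have N: "N \<lhd> T" and ord: "T.ord c = 0" and sup: "strong_unique_product (T Mod N)"
    using assms(5) by (simp_all add: unimodular_gen_equation_def N_def c_def)
  interpret N: normal N T by (rule N)
  let ?R = "T Mod N"
  have R: "group ?R" by (rule N.factorgroup_is_group)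
  define rep where "rep C = (SOME s. s \<in> carrier T \<and> N #>\<^bsub>T\<^esub> s = C)" for C
  have rep: "rep C \<in> carrier T" "N #>\<^bsub>T\<^esub> rep C = C" if C: "C \<in> carrier ?R" for C
  proof -
    have "\<exists>s. s \<in> carrier T \<and> N #>\<^bsub>T\<^esub> s = C" using C by (auto simp: carrier_FactGroup)
    from someI_ex[OF this] show "rep C \<in> carrier T" "N #>\<^bsub>T\<^esub> rep C = C" by (simp_all add: rep_def)
  qed
  \<comment> \<open>The hypothesis on free powers speaks of index sets of this list type, so a coset
    is coded as the one-letter word of its representative.\<close>
  define ix :: "'t set \<Rightarrow> ('a + 't) list" where "ix C = [Inr (rep C)]" for C
  have inj: "inj_on ix (carrier ?R)"
    using rep(2) by (intro inj_onI) (metis ix_def list.inject sum.inject(2))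
  define Q where "Q = image_group ix ?R"
  have ix: "ix \<in> iso ?R Q" and Q: "group Q" unfolding Q_def by (rule image_group_iso[OF R inj])+
  define \<pi> where "\<pi> = ix \<circ> (\<lambda>s. N #>\<^bsub>T\<^esub> s)"
  define \<tau> where "\<tau> q = rep (inv_into (carrier ?R) ix q)" for q
  have mem: "N #>\<^bsub>T\<^esub> s \<in> carrier ?R" if "s \<in> carrier T" for s using that by (auto simp: carrier_FactGroup)
  have \<pi>: "\<pi> \<in> hom T Q"
    unfolding \<pi>_def using N.r_coset_hom_Mod ix by (intro hom_compose) (auto simp: iso_def)
  have ker: "kernel T Q \<pi> = N"
  proof -
    have "\<pi> s = \<one>\<^bsub>Q\<^esub> \<longleftrightarrow> s \<in> N" if s: "s \<in> carrier T" for s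
    proof -
      have "\<pi> s = \<one>\<^bsub>Q\<^esub> \<longleftrightarrow> ix (N #>\<^bsub>T\<^esub> s) = ix N" by (simp add: \<pi>_def Q_def image_group_one)
      also have "\<dots> \<longleftrightarrow> N #>\<^bsub>T\<^esub> s = N"
        using inj mem[OF s] monoid.one_closed[OF group.is_monoid[OF R]] by (auto dest: inj_onD)
      also have "\<dots> \<longleftrightarrow> s \<in> N" using s N.rcos_const T.coset_join1[of N s] N.subset N.is_subgroup by auto
      finally show ?thesis .
    qed
    then show ?thesis using N.subset by (auto simp: kernel_def)
  qed
  have \<tau>: "\<tau> q \<in> carrier T \<and> \<pi> (\<tau> q) = q" if q: "q \<in> carrier Q" for q
  proof -
    have C: "inv_into (carrier ?R) ix q \<in> carrier ?R" "ix (inv_into (carrier ?R) ix q) = q"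
      using q by (simp_all add: Q_def image_group_carrier inv_into_into f_inv_into_f)
    then show ?thesis using rep[OF C(1)] by (simp add: \<tau>_def \<pi>_def)
  qed
  have supQ: "strong_unique_product Q" by (rule strong_unique_product_iso[OF R Q ix sup])
  interpret cyclic_extension_equation G T Q \<pi> \<tau> c e
  proof (intro cyclic_extension_equation.intro cyclic_extension.intro cyclic_extension_equation_axioms.intro)
    show "kernel T Q \<pi> = generate T {c}" using ker by (simp add: N_def)
    show "var_prod T e = c" by (simp add: c_def)
    show "\<exists>y1\<in>Y - {y}. \<exists>x1\<in>X. \<forall>y2\<in>insert y Y - {y1}. \<forall>x2\<in>X. y1 \<otimes>\<^bsub>Q\<^esub> x1 \<noteq> y2 \<otimes>\<^bsub>Q\<^esub> x2"
      if "finite X" "X \<noteq> {}" "X \<subseteq> carrier Q" "finite Y" "Y \<subseteq> carrier Q" "y \<in> carrier Q" "\<not> Y \<subseteq> {y}" for X Y y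
      by (rule strong_unique_product_left[OF Q supQ that])
  qed (use assms(1-4) Q \<pi> \<tau> c ord in blast)+
  obtain \<phi> \<psi> where "\<phi> \<in> mon G (BijGroup (carrier Q \<times> carrier (F Mod NC (carrier Q))))"
    "\<psi> \<in> hom T (BijGroup (carrier Q \<times> carrier (F Mod NC (carrier Q))))"
    "eval_expr (BijGroup (carrier Q \<times> carrier (F Mod NC (carrier Q)))) \<phi> \<psi> e
       = \<one>\<^bsub>BijGroup (carrier Q \<times> carrier (F Mod NC (carrier Q)))\<^esub>"
    by (rule solution_ex)
  then show ?thesis
    by (rule gen_solvable_overI[OF assms(1,3) group_BijGroup _ _ assms(4)])
qed

end
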